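(* Let $G$ be a $2$-stress-independent graph. For every subgraph $G'=(V',E')$ of $G$ with $|V'|\ge 8$ we have \[|E'|\le r_2(G')+|V'|-6\le 3|V'|-9.\]
   Context: All graphs are finite and simple. A framework $(G,p)$ in $\mathbb{R}^2$ is generic if its coordinates are algebraically independent over $\mathbb{Q}$. $\mathcal{R}_2(G)$ is the row matroid of the rigidity matrix of a generic framework in $\mathbb{R}^2$ (row of edge $xy$: $p(x)-p(y)$ in the columns of $x$, $p(y)-p(x)$ in those of $y$, zeros elsewhere); $r_2(G)$ is its rank. $\{u,v\}$ is $2$-linked in $G$ if $r_2(G+uv)=r_2(G)$. A stress of $(G,p)$ is $\omega\in\mathbb{R}^E$ with $\sum_{x:xy\in E}\omega(xy)(p(x)-p(y))=0$ for every vertex $y$; $S(G,p)$ is the stress space. $\{u,v\}$ is $2$-stress-linked in $G$ if it is $2$-linked and for every generic $(G,p)$ and every $(G,q)$ in $\mathbb{R}^2$ with $S(G,p)\subseteq S(G,q)$ we have $S(G+uv,p)\subseteq S(G+uv,q)$. $G$ is $2$-stress-independent if $\{u,v\}$ is not $2$-stress-linked in $G-uv$ for every edge $uv$. *)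

theory Defs
  imports "HOL-Analysis.Analysis" "HOL-Library.Poly_Mapping"
begin

text \<open>
  A graph is given by a vertex set \<open>V\<close> and a set \<open>E\<close> of two-element subsets of \<open>V\<close>.
  A framework on it is a map \<open>p :: 'a \<Rightarrow> real^2\<close>, of which only the values on \<open>V\<close> matter.
\<close>

definition simple_graph :: "'a set \<Rightarrow> 'a set set \<Rightarrow> bool" where
  "simple_graph V E \<longleftrightarrow> finite V \<and> (\<forall>e\<in>E. e \<subseteq> V \<and> card e = 2)"

definition subgraph :: "'a set \<Rightarrow> 'a set set \<Rightarrow> 'a set \<Rightarrow> 'a set set \<Rightarrow> bool" where
  "subgraph V' E' V E \<longleftrightarrow> simple_graph V' E' \<and> V' \<subseteq> V \<and> E' \<subseteq> E"

text \<open>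
  A polynomial with rational coefficients in variables of type \<open>'i\<close> is a finitely supported map
  from monomials to coefficients, a monomial being a finitely supported map from variables to
  exponents.
\<close>

definition mpoly_value :: "('i \<Rightarrow> real) \<Rightarrow> (('i \<Rightarrow>\<^sub>0 nat) \<Rightarrow>\<^sub>0 rat) \<Rightarrow> real" where
  "mpoly_value x P =
    (\<Sum>m\<in>Poly_Mapping.keys P.
      of_rat (Poly_Mapping.lookup P m) *
      (\<Prod>i\<in>Poly_Mapping.keys m. x i ^ Poly_Mapping.lookup m i))"

text \<open>Algebraic independence over the rationals of the family \<open>(x i)\<close>, \<open>i \<in> I\<close>.\<close>

definition alg_independent :: "'i set \<Rightarrow> ('i \<Rightarrow> real) \<Rightarrow> bool" where
  "alg_independent I x \<longleftrightarrow>
    (\<forall>P :: ('i \<Rightarrow>\<^sub>0 nat) \<Rightarrow>\<^sub>0 rat.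
      (\<forall>m\<in>Poly_Mapping.keys P. Poly_Mapping.keys m \<subseteq> I) \<longrightarrow> mpoly_value x P = 0 \<longrightarrow> P = 0)"

definition generic :: "'a set \<Rightarrow> ('a \<Rightarrow> real^2) \<Rightarrow> bool" where
  "generic V p \<longleftrightarrow> alg_independent (V \<times> (UNIV :: 2 set)) (\<lambda>(v, i). p v $ i)"

text \<open>
  The row of edge \<open>e\<close> of the rigidity matrix, with the two columns of each vertex \<open>v\<close> grouped
  into a vector; for \<open>v \<in> e\<close>, the element of \<open>e - {v}\<close> is the other end of \<open>e\<close>.
\<close>

definition rigidity_matrix :: "('a \<Rightarrow> real^2) \<Rightarrow> 'a set \<Rightarrow> 'a \<Rightarrow> real^2" where
  "rigidity_matrix p e v = (if v \<in> e then p v - p (the_elem (e - {v})) else 0)"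

definition rows_independent :: "'a set \<Rightarrow> ('a \<Rightarrow> real^2) \<Rightarrow> 'a set set \<Rightarrow> bool" where
  "rows_independent V p F \<longleftrightarrow>
    (\<forall>c :: 'a set \<Rightarrow> real.
      (\<forall>v\<in>V. (\<Sum>e\<in>F. c e *\<^sub>R rigidity_matrix p e v) = 0) \<longrightarrow> (\<forall>e\<in>F. c e = 0))"

text \<open>
  The matroid is given by its independent sets.  It is the same for all generic frameworks, so the
  choice of one is immaterial.
\<close>

definition rigidity_matroid :: "'a set \<Rightarrow> 'a set set \<Rightarrow> 'a set set set" where
  "rigidity_matroid V E = {F. F \<subseteq> E \<and> rows_independent V (SOME p. generic V p) F}"

definition r2 :: "'a set \<Rightarrow> 'a set set \<Rightarrow> nat" where
  "r2 V E = Max (card ` rigidity_matroid V E)"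

text \<open>Stresses are real functions on \<open>E\<close>, extended by zero to all sets of vertices.\<close>

definition stresses :: "'a set \<Rightarrow> 'a set set \<Rightarrow> ('a \<Rightarrow> real^2) \<Rightarrow> ('a set \<Rightarrow> real) set" where
  "stresses V E p =
    {w. (\<forall>e. e \<notin> E \<longrightarrow> w e = 0) \<and>
        (\<forall>y\<in>V. (\<Sum>x | x \<in> V \<and> {x, y} \<in> E. w {x, y} *\<^sub>R (p x - p y)) = 0)}"

text \<open>In the following, \<open>e\<close> is a pair \<open>{u, v}\<close> of distinct vertices in \<open>V\<close>.\<close>

definition linked :: "'a set \<Rightarrow> 'a set set \<Rightarrow> 'a set \<Rightarrow> bool" where
  "linked V E e \<longleftrightarrow> r2 V (insert e E) = r2 V E"

definition stress_linked :: "'a set \<Rightarrow> 'a set set \<Rightarrow> 'a set \<Rightarrow> bool" where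
  "stress_linked V E e \<longleftrightarrow>
    linked V E e \<and>
    (\<forall>p q. generic V p \<longrightarrow> stresses V E p \<subseteq> stresses V E q \<longrightarrow>
      stresses V (insert e E) p \<subseteq> stresses V (insert e E) q)"

definition stress_independent :: "'a set \<Rightarrow> 'a set set \<Rightarrow> bool" where
  "stress_independent V E \<longleftrightarrow> (\<forall>e\<in>E. \<not> stress_linked V (E - {e}) e)"

end

theory Submission
  imports Defs "HOL-Library.Function_Algebras"
begin

text \<open>
  Fix a generic \<open>p\<close>. Let \<open>s F\<close> be the dimension of the stress space of \<open>F\<close> and \<open>R F\<close> the dimension of the
  sum of the column spaces of its stress matrices, so that \<open>R F \<le> \<bar>V\<bar> - 3\<close>. In a stress-independent graph,
  deleting an edge that carries a stress lowers \<open>R\<close> as well as \<open>s\<close>. Hence \<open>R - s\<close> is monotone, and a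
  subgraph with \<open>s = 2\<close> and \<open>R \<ge> 5\<close> already yields \<open>s E \<le> \<bar>V\<bar> - 6\<close>.

  Otherwise consider a subgraph \<open>H\<close> with \<open>s H = 2\<close> in which any two edges lie on a common circuit. Circuits
  are rigid, so counting vertices and edges shows that the number \<open>c\<close> of circuits of \<open>H\<close> and the number \<open>q\<close>
  of vertices common to all of them satisfy \<open>c + 1 = 2 q\<close>. If each circuit misses a vertex of \<open>H\<close>, then
  \<open>c \<le> R H \<le> 4\<close>, so \<open>q = 2\<close> and \<open>H\<close> has at least 15 edges. If some circuit spans \<open>H\<close>, then
  \<open>c \<ge> 7 > R H\<close>, which forces three lines through pairs of six vertices to be concurrent or a \<open>K\<^sub>4\<close> in a
  place where none fits. Applied to a circuit plus a chord this excludes chords, so the ears of a connected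
  subgraph have at least three edges each, and \<open>\<bar>F\<bar> \<ge> 3 s F + 9\<close> for all connected \<open>F\<close> with \<open>s F \<ge> 2\<close>.
\<close>

section \<open>Linear algebra of finitely supported real functions\<close>

text \<open>Both thresholds come from the target \<open>s E + 6 \<le> card V\<close>. Since
  \<open>R E + 3 \<le> card V\<close>, an excess \<open>R - s\<close> of 3 is enough, and for two
  stresses this reads \<open>R \<ge> 5\<close>. A single circuit is too weak a start:
  \<open>K\<^sub>4\<close> has \<open>R = s = 1\<close>. Failing that, an independent edge set has
  at most \<open>2 * card V - 3\<close> edges, so \<open>3 * s E + 9 \<le> card E\<close> leads to
  the same target. Stress-independence enters only through vectors \<open>z\<close>, one for each
  edge carrying a stress, such that \<open>L \<omega> z\<close> is a fixed nonzero vector scaled by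
  the value of \<omega> on that edge. As every \<open>L \<omega>\<close> is symmetric, the vectors
  belonging to different circuits of \<open>H\<close> satisfy orthogonality relations; these limit
  how many circuits fit into a small \<open>R H\<close>. Stress-linkedness speaks about all generic
  frameworks at once. A single \<open>p\<close> can stand for all of them because stress spaces have
  generators that are rational functions of \<open>p\<close>, and such a function vanishes at all
  generic points or at none.\<close>

interpretation fs: vector_space "\<lambda>(c::real) (f::'i \<Rightarrow> real) i. c * f i"
  by unfold_locales (auto simp: fun_eq_iff algebra_simps)

text \<open>The functions live on an arbitrary type; finite dimension comes from the finite set
  outside which they vanish.\<close>

definition supp_in :: "'i set \<Rightarrow> ('i \<Rightarrow> real) set" where
  "supp_in I = {f. \<forall>i. i \<notin> I \<longrightarrow> f i = 0}"

definition unit_fun :: "'i \<Rightarrow> 'i \<Rightarrow> real" where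
  "unit_fun j = (\<lambda>i. if i = j then 1 else 0)"

lemma sum_fun_apply: "(\<Sum>j\<in>J. f j) i = (\<Sum>j\<in>J. f j i :: real)"
  by (induction J rule: infinite_finite_induct) auto

lemma subspace_supp_in: "fs.subspace (supp_in I)"
  by (auto simp: fs.subspace_def supp_in_def)

lemma supp_in_expand:
  assumes "finite I" "f \<in> supp_in I"
  shows "f = (\<Sum>j\<in>I. (\<lambda>i. f j * unit_fun j i))"
proof
  fix i
  have "(\<Sum>j\<in>I. f j * unit_fun j i) = (\<Sum>j\<in>I. if j = i then f i else 0)"
    by (rule sum.cong) (auto simp: unit_fun_def)
  also have "\<dots> = f i" using assms by (auto simp: supp_in_def)
  finally show "f i = (\<Sum>j\<in>I. (\<lambda>i. f j * unit_fun j i)) i" by (simp add: sum_fun_apply)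
qed

lemma supp_in_span:
  assumes "finite I" shows "supp_in I \<subseteq> fs.span (unit_fun ` I)"
proof
  fix f assume "f \<in> supp_in I"
  have "(\<Sum>j\<in>I. (\<lambda>i. f j * unit_fun j i)) \<in> fs.span (unit_fun ` I)"
    by (rule fs.span_sum, rule fs.span_scale, rule fs.span_base) auto
  then show "f \<in> fs.span (unit_fun ` I)"
    using supp_in_expand[OF assms \<open>f \<in> supp_in I\<close>] by simp
qed

lemma finite_indep_supp:
  assumes "finite I" "B \<subseteq> supp_in I" "fs.independent B"
  shows "finite B \<and> card B \<le> card I"
proof -
  have "finite B \<and> card B \<le> card ((unit_fun :: 'a \<Rightarrow> _) ` I)"
    using fs.independent_span_bound[of "unit_fun ` I" B] assms supp_in_span[OF assms(1)] by blast
  then show ?thesis using card_image_le[OF assms(1), of unit_fun] by linarith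
qed

lemma indep_card_le_dim:
  assumes "finite I" "X \<subseteq> supp_in I" "B \<subseteq> X" "fs.independent B"
  shows "finite B \<and> card B \<le> fs.dim X"
proof -
  obtain C where C: "C \<subseteq> X" "fs.independent C" "X \<subseteq> fs.span C" "card C = fs.dim X"
    by (rule fs.basis_exists[of X])
  have "finite C" using finite_indep_supp[OF assms(1), of C] C assms by blast
  then show ?thesis using fs.independent_span_bound[of C B] assms C by auto
qed

text \<open>\<open>fs.dim\<close> is the cardinality of a basis, which would be 0 for an infinite
  one; the finite support excludes this.\<close>

lemma dim_mono_supp:
  assumes "finite I" "Y \<subseteq> supp_in I" "X \<subseteq> Y"
  shows "fs.dim X \<le> fs.dim Y"
proof -
  obtain C where C: "C \<subseteq> X" "fs.independent C" "X \<subseteq> fs.span C" "card C = fs.dim X"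
    by (rule fs.basis_exists[of X])
  then show ?thesis using indep_card_le_dim[OF assms(1,2), of C] assms by auto
qed

lemma dim_less_supp:
  assumes "finite I" "Y \<subseteq> supp_in I" "X \<subseteq> Y" "fs.subspace X" "X \<noteq> Y"
  shows "fs.dim X < fs.dim Y"
proof -
  obtain C where C: "C \<subseteq> X" "fs.independent C" "X \<subseteq> fs.span C" "card C = fs.dim X"
    by (rule fs.basis_exists[of X])
  obtain y where y: "y \<in> Y" "y \<notin> X" using assms by blast
  have "fs.span C \<subseteq> X" using C(1) assms(4) by (simp add: fs.span_minimal)
  then have "y \<notin> fs.span C" using y by blast
  moreover from this have "y \<notin> C" using fs.span_base by blast
  ultimately have "fs.independent (insert y C)" "y \<notin> C"
    using C(2) by (simp_all add: fs.independent_insert)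
  moreover have "insert y C \<subseteq> Y" using y C assms by auto
  ultimately have "card (insert y C) \<le> fs.dim Y" "finite (insert y C)"
    using indep_card_le_dim[OF assms(1,2), of "insert y C"] by auto
  then show ?thesis using C \<open>y \<notin> C\<close> by auto
qed

text \<open>One step of rank-nullity: each \<open>x\<close> differs from an element of the kernel by
  a multiple of \<open>x0\<close>. Dimensions are computed below by chaining such steps.\<close>

lemma dim_functional:
  fixes f :: "('i \<Rightarrow> real) \<Rightarrow> real"
  assumes "finite I" "X \<subseteq> supp_in I" "fs.subspace X"
    and add: "\<And>x y. f (x + y) = f x + f y" and scale: "\<And>c x. f (\<lambda>i. c * x i) = c * f x"
    and x0: "x0 \<in> X" "f x0 \<noteq> 0"
  shows "fs.dim X = fs.dim {x \<in> X. f x = 0} + 1"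
proof -
  let ?K = "{x \<in> X. f x = 0}"
  have f0: "f 0 = 0" using add[of 0 0] by simp
  have sK: "fs.subspace ?K"
    unfolding fs.subspace_def
  proof (intro conjI ballI allI)
    show "0 \<in> ?K" using f0 fs.subspace_0[OF assms(3)] by blast
  next
    fix x y assume "x \<in> ?K" "y \<in> ?K"
    then show "x + y \<in> ?K" using fs.subspace_add[OF assms(3), of x y] add[of x y] by simp
  next
    fix c x assume "x \<in> ?K"
    then show "(\<lambda>i. c * x i) \<in> ?K" using fs.subspace_scale[OF assms(3), of x c] scale[of c x] by simp
  qed
  obtain C where C: "C \<subseteq> ?K" "fs.independent C" "?K \<subseteq> fs.span C" "card C = fs.dim ?K"
    by (rule fs.basis_exists[of ?K])
  have CK: "fs.span C \<subseteq> ?K" using C(1) sK by (simp add: fs.span_minimal)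
  then have "x0 \<notin> fs.span C" using x0 by blast
  moreover from this have "x0 \<notin> C" using fs.span_base by blast
  ultimately have ind: "fs.independent (insert x0 C)" "x0 \<notin> C"
    using C(2) by (simp_all add: fs.independent_insert)
  have sub: "insert x0 C \<subseteq> X" using x0 C by auto
  have fin: "finite (insert x0 C)" using indep_card_le_dim[OF assms(1,2) sub ind(1)] by auto
  have "X \<subseteq> fs.span (insert x0 C)"
  proof
    fix x assume x: "x \<in> X"
    let ?c = "f x / f x0"
    let ?y = "x + (\<lambda>i. - ?c * x0 i)"
    have "?y \<in> X" using x x0 assms(3) unfolding fs.subspace_def by blast
    moreover have "f ?y = 0" using add[of x "\<lambda>i. - ?c * x0 i"] scale[of "- ?c" x0] x0 by simp
    ultimately have "?y \<in> fs.span (insert x0 C)"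
      using C(3) fs.span_mono[of C "insert x0 C"] by blast
    moreover have "(\<lambda>i. ?c * x0 i) \<in> fs.span (insert x0 C)"
      by (rule fs.span_scale, rule fs.span_base) auto
    ultimately have "?y + (\<lambda>i. ?c * x0 i) \<in> fs.span (insert x0 C)" by (rule fs.span_add)
    moreover have "?y + (\<lambda>i. ?c * x0 i) = x" by (auto simp: fun_eq_iff)
    ultimately show "x \<in> fs.span (insert x0 C)" by (simp only:)
  qed
  then have "fs.dim X = card (insert x0 C)" using fs.dim_unique[OF sub _ ind(1)] by simp
  then show ?thesis using C(4) fin ind(2) by simp
qed

lemma dim_supp_in: "finite I \<Longrightarrow> fs.dim (supp_in I) = card I"
proof (induction I rule: finite_induct)
  case empty
  have "supp_in {} = {0 :: 'a \<Rightarrow> real}" by (auto simp: supp_in_def fun_eq_iff)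
  then have "fs.dim (supp_in ({} :: 'a set)) = card ({} :: ('a \<Rightarrow> real) set)"
    using fs.dim_unique[of "{}" "supp_in ({} :: 'a set)" 0] by (simp add: fs.independent_empty)
  then show ?case by simp
next
  case (insert j I)
  have "fs.dim (supp_in (insert j I)) = fs.dim {x \<in> supp_in (insert j I). x j = 0} + 1"
    by (rule dim_functional[of "insert j I" _ "\<lambda>x. x j" "unit_fun j", OF _ _ subspace_supp_in])
      (use insert in \<open>auto simp: supp_in_def unit_fun_def\<close>)
  moreover have "{x \<in> supp_in (insert j I). x j = 0} = (supp_in I :: ('a \<Rightarrow> real) set)"
    using insert by (auto simp: supp_in_def)
  ultimately show ?case using insert by simp
qed

text \<open>A family instead of a set, since members may coincide; a repeated vector yields the
  relation with coefficients 1 and -1.\<close>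

lemma dependent_family:
  fixes u :: "'j \<Rightarrow> 'i \<Rightarrow> real"
  assumes "finite I" "X \<subseteq> supp_in I" "finite J" "\<And>j. j \<in> J \<Longrightarrow> u j \<in> X" "fs.dim X < card J"
  obtains c where "\<exists>j\<in>J. c j \<noteq> 0" "(\<Sum>j\<in>J. (\<lambda>i. c j * u j i)) = 0"
proof (cases "inj_on u J")
  case True
  have "\<not> fs.independent (u ` J)"
    using indep_card_le_dim[OF assms(1,2), of "u ` J"] assms(4,5) card_image[OF True] by force
  then obtain T c where T: "finite T" "T \<subseteq> u ` J" "(\<Sum>v\<in>T. (\<lambda>i. c v * v i)) = 0" "\<exists>v\<in>T. c v \<noteq> 0"
    unfolding fs.dependent_explicit by blast
  define d where "d j = (if u j \<in> T then c (u j) else 0)" for j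
  have "(\<Sum>j\<in>J. (\<lambda>i. d j * u j i)) = (\<Sum>v\<in>u ` J. (\<lambda>i. (if v \<in> T then c v else 0) * v i))"
    by (simp add: sum.reindex[OF True] d_def)
  also have "\<dots> = (\<Sum>v\<in>T. (\<lambda>i. (if v \<in> T then c v else 0) * v i))"
    by (rule sum.mono_neutral_right) (use T assms(3) in \<open>auto simp: fun_eq_iff\<close>)
  also have "\<dots> = 0" using T(3) by simp
  finally have "(\<Sum>j\<in>J. (\<lambda>i. d j * u j i)) = 0" .
  moreover have "\<exists>j\<in>J. d j \<noteq> 0" using T unfolding d_def by (auto simp: subset_iff image_iff)
  ultimately show ?thesis using that by blast
next
  case False
  then obtain j k where jk: "j \<in> J" "k \<in> J" "j \<noteq> k" "u j = u k" unfolding inj_on_def by blast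
  define c where "c l = (if l = j then 1 else if l = k then -1 else (0::real))" for l
  have "(\<Sum>l\<in>J. (\<lambda>i. c l * u l i)) = (\<Sum>l\<in>{j,k}. (\<lambda>i. c l * u l i))"
    by (rule sum.mono_neutral_right) (use jk assms(3) in \<open>auto simp: c_def fun_eq_iff\<close>)
  also have "\<dots> = 0" using jk by (auto simp: c_def fun_eq_iff)
  finally have "(\<Sum>l\<in>J. (\<lambda>i. c l * u l i)) = 0" .
  moreover have "\<exists>l\<in>J. c l \<noteq> 0" using jk by (auto simp: c_def)
  ultimately show ?thesis using that by blast
qed

text \<open>Double annihilator, by induction on \<open>J\<close>. If some \<open>k0\<close> is
  killed by \<open>J\<close> but not by \<open>u l\<close>, a multiple of \<open>u l\<close> is
  subtracted from \<open>b\<close>. A vector killed by \<open>J\<close> can be shifted along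
  \<open>k0\<close> until \<open>u l\<close> kills it too, so the hypothesis passes to the
  difference.\<close>

lemma annihilator:
  fixes u :: "'j \<Rightarrow> 'i \<Rightarrow> real"
  assumes "finite I" "finite J" "\<And>j. j \<in> J \<Longrightarrow> u j \<in> supp_in I" "b \<in> supp_in I"
    and "\<And>m. (\<And>j. j \<in> J \<Longrightarrow> (\<Sum>i\<in>I. u j i * m i) = 0) \<Longrightarrow> (\<Sum>i\<in>I. b i * m i) = 0"
  obtains c where "\<And>i. b i = (\<Sum>j\<in>J. c j * u j i)"
proof -
  have "\<exists>c. \<forall>i. b i = (\<Sum>j\<in>J. c j * u j i)"
    using assms(2,3,4,5)
  proof (induction J arbitrary: b rule: finite_induct)
    case empty
    have "b i = 0" for i
    proof (cases "i \<in> I")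
      case True
      have "(\<Sum>k\<in>I. b k * unit_fun i k) = 0" using empty by blast
      moreover have "(\<Sum>k\<in>I. b k * unit_fun i k) = (\<Sum>k\<in>I. if k = i then b i else 0)"
        by (rule sum.cong) (auto simp: unit_fun_def)
      ultimately show ?thesis using True assms(1) by simp
    next
      case False
      then show ?thesis using empty by (auto simp: supp_in_def)
    qed
    then show ?case by simp
  next
    case (insert l J)
    show ?case
    proof (cases "\<exists>k0. (\<forall>j\<in>J. (\<Sum>i\<in>I. u j i * k0 i) = 0) \<and> (\<Sum>i\<in>I. u l i * k0 i) \<noteq> 0")
      case False
      then have "\<exists>c. \<forall>i. b i = (\<Sum>j\<in>J. c j * u j i)"
        using insert.IH[of b] insert.prems by blast
      then obtain c where c: "\<And>i. b i = (\<Sum>j\<in>J. c j * u j i)" by blast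
      have "b i = (\<Sum>j\<in>insert l J. (c(l := 0)) j * u j i)" for i
        using insert(1,2) c[of i] by (auto intro!: sum.cong)
      then show ?thesis by blast
    next
      case True
      then obtain k0 where k0: "\<And>j. j \<in> J \<Longrightarrow> (\<Sum>i\<in>I. u j i * k0 i) = 0"
        and k0l: "(\<Sum>i\<in>I. u l i * k0 i) \<noteq> 0" by blast
      define t where "t = (\<Sum>i\<in>I. b i * k0 i) / (\<Sum>i\<in>I. u l i * k0 i)"
      define b' where "b' i = b i - t * u l i" for i
      have "b' \<in> supp_in I" using insert.prems(1)[of l] insert.prems(2) by (auto simp: supp_in_def b'_def)
      moreover have "(\<Sum>i\<in>I. b' i * m i) = 0" if m: "\<And>j. j \<in> J \<Longrightarrow> (\<Sum>i\<in>I. u j i * m i) = 0" for m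
      proof -
        define s where "s = (\<Sum>i\<in>I. u l i * m i) / (\<Sum>i\<in>I. u l i * k0 i)"
        define m' where "m' i = m i - s * k0 i" for i
        have sm: "(\<Sum>i\<in>I. v i * m' i) = (\<Sum>i\<in>I. v i * m i) - s * (\<Sum>i\<in>I. v i * k0 i)" for v
          by (simp add: m'_def algebra_simps sum_subtractf sum_distrib_left)
        have "(\<Sum>i\<in>I. u j i * m' i) = 0" if "j \<in> insert l J" for j
          using that m k0 k0l by (auto simp: sm s_def)
        then have "(\<Sum>i\<in>I. b i * m' i) = 0" using insert.prems(3) by blast
        then have "(\<Sum>i\<in>I. b i * m i) = s * (\<Sum>i\<in>I. b i * k0 i)" by (simp add: sm)
        moreover have "(\<Sum>i\<in>I. b' i * m i) = (\<Sum>i\<in>I. b i * m i) - t * (\<Sum>i\<in>I. u l i * m i)"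
          by (simp add: b'_def algebra_simps sum_subtractf sum_distrib_left)
        ultimately show ?thesis using k0l by (simp add: s_def t_def)
      qed
      ultimately have "\<exists>c. \<forall>i. b' i = (\<Sum>j\<in>J. c j * u j i)"
        using insert.IH[of b'] insert.prems(1) by blast
      then obtain c where c: "\<And>i. b' i = (\<Sum>j\<in>J. c j * u j i)" by blast
      have "b i = (\<Sum>j\<in>insert l J. (c(l := t)) j * u j i)" for i
      proof -
        have "(\<Sum>j\<in>J. (c(l := t)) j * u j i) = (\<Sum>j\<in>J. c j * u j i)"
          using insert(2) by (intro sum.cong) auto
        then show ?thesis using insert(1,2) c[of i] by (simp add: b'_def)
      qed
      then show ?thesis by blast
    qed
  qed
  then show ?thesis using that by blast
qed

section \<open>Algebraic independence and density of generic points\<close>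

abbreviation lk where "lk \<equiv> Poly_Mapping.lookup"
abbreviation ks where "ks \<equiv> Poly_Mapping.keys"

definition monom_value :: "('i \<Rightarrow> real) \<Rightarrow> ('i \<Rightarrow>\<^sub>0 nat) \<Rightarrow> real" where
  "monom_value x m = (\<Prod>i\<in>ks m. x i ^ lk m i)"

lemma monom_value_superset:
  assumes "finite S" "ks m \<subseteq> S"
  shows "monom_value x m = (\<Prod>i\<in>S. x i ^ lk m i)"
  unfolding monom_value_def
  by (rule prod.mono_neutral_left) (use assms in \<open>auto simp: in_keys_iff\<close>)

lemma monom_value_add: "monom_value x (m + m') = monom_value x m * monom_value x m'"
proof -
  have "ks (m + m') \<subseteq> ks m \<union> ks m'" by (rule keys_add)
  then show ?thesis
    by (simp add: monom_value_superset[of "ks m \<union> ks m'"] lookup_add power_add prod.distrib)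
qed

lemma mpoly_value_superset:
  assumes "finite S" "ks P \<subseteq> S"
  shows "mpoly_value x P = (\<Sum>m\<in>S. of_rat (lk P m) * monom_value x m)"
  unfolding mpoly_value_def monom_value_def[symmetric]
  by (rule sum.mono_neutral_left) (use assms in \<open>auto simp: in_keys_iff\<close>)

lemma mpoly_value_add: "mpoly_value x (P + Q) = mpoly_value x P + mpoly_value x Q"
proof -
  have "ks (P + Q) \<subseteq> ks P \<union> ks Q" by (rule keys_add)
  then show ?thesis
    by (simp add: mpoly_value_superset[of "ks P \<union> ks Q"] lookup_add of_rat_add distrib_right sum.distrib)
qed

lemma mpoly_value_zero: "mpoly_value x 0 = 0"
  by (simp add: mpoly_value_def)

lemma mpoly_value_sum: "mpoly_value x (\<Sum>j\<in>J. P j) = (\<Sum>j\<in>J. mpoly_value x (P j))"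
  by (induction J rule: infinite_finite_induct) (auto simp: mpoly_value_zero mpoly_value_add)

lemma mpoly_value_single: "mpoly_value x (Poly_Mapping.single m c) = of_rat c * monom_value x m"
  by (subst mpoly_value_superset[of "{m}"]) auto

lemma mpoly_as_sum: "P = (\<Sum>m\<in>ks P. Poly_Mapping.single m (lk P m))"
proof (rule poly_mapping_eqI)
  fix k
  have "(\<Sum>m\<in>ks P. lk (Poly_Mapping.single m (lk P m)) k) = (\<Sum>m\<in>ks P. if m = k then lk P k else 0)"
    by (rule sum.cong) (auto simp: lookup_single when_def)
  then show "lk P k = lk (\<Sum>m\<in>ks P. Poly_Mapping.single m (lk P m)) k"
    by (auto simp: lookup_sum in_keys_iff)
qed

lemma mpoly_value_mult: "mpoly_value x (P * Q) = mpoly_value x P * mpoly_value x Q"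
proof -
  have "P * Q = (\<Sum>m\<in>ks P. \<Sum>m'\<in>ks Q. Poly_Mapping.single (m + m') (lk P m * lk Q m'))"
    by (subst (1) mpoly_as_sum[of P], subst (1) mpoly_as_sum[of Q]) (simp add: sum_product mult_single)
  then have "mpoly_value x (P * Q)
      = (\<Sum>m\<in>ks P. \<Sum>m'\<in>ks Q. of_rat (lk P m * lk Q m') * monom_value x (m + m'))"
    by (simp add: mpoly_value_sum mpoly_value_single)
  also have "\<dots> = mpoly_value x P * mpoly_value x Q"
    by (simp add: mpoly_value_superset[OF finite_keys subset_refl] sum_product of_rat_mult monom_value_add mult_ac)
  finally show ?thesis .
qed

definition mvars :: "'i set \<Rightarrow> (('i \<Rightarrow>\<^sub>0 nat) \<Rightarrow>\<^sub>0 rat) set" where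
  "mvars I = {P. \<forall>m\<in>ks P. ks m \<subseteq> I}"

lemma mvars_add: "P \<in> mvars I \<Longrightarrow> Q \<in> mvars I \<Longrightarrow> P + Q \<in> mvars I"
  using keys_add[of P Q] by (auto simp: mvars_def)

lemma mvars_mult: "P \<in> mvars I \<Longrightarrow> Q \<in> mvars I \<Longrightarrow> P * Q \<in> mvars I"
  unfolding mvars_def
proof safe
  fix m i
  assume PQ: "\<forall>m\<in>ks P. ks m \<subseteq> I" "\<forall>m\<in>ks Q. ks m \<subseteq> I" and m: "m \<in> ks (P * Q)" and i: "i \<in> ks m"
  obtain a b where ab: "m = a + b" "a \<in> ks P" "b \<in> ks Q" using m keys_mult[of P Q] by blast
  then have "i \<in> ks a \<union> ks b" using i keys_add[of a b] by blast
  then show "i \<in> I" using PQ ab by blast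
qed

lemma mvars_const: "Poly_Mapping.single 0 c \<in> mvars I"
  by (auto simp: mvars_def)

lemma mvars_var: "i \<in> I \<Longrightarrow> Poly_Mapping.single (Poly_Mapping.single i 1) 1 \<in> mvars I"
  by (auto simp: mvars_def)

lemma alg_independent_iff:
  "alg_independent I x \<longleftrightarrow> (\<forall>P\<in>mvars I. mpoly_value x P = 0 \<longrightarrow> P = 0)"
  by (auto simp: alg_independent_def mvars_def)

lemma countable_mvars:
  assumes "finite I" shows "countable (mvars I)"
proof -
  let ?M = "{m :: 'a \<Rightarrow>\<^sub>0 nat. ks m \<subseteq> I}"
  have c1: "countable (I \<rightarrow>\<^sub>E (UNIV :: nat set))" using assms by (intro countable_PiE) auto
  have i1: "inj_on (\<lambda>m. restrict (lk m) I) ?M"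
  proof (rule inj_onI)
    fix m m' :: "'a \<Rightarrow>\<^sub>0 nat"
    assume *: "m \<in> ?M" "m' \<in> ?M" "restrict (lk m) I = restrict (lk m') I"
    show "m = m'"
    proof (rule poly_mapping_eqI)
      fix k show "lk m k = lk m' k"
      proof (cases "k \<in> I")
        case True
        then show ?thesis using fun_cong[OF *(3), of k] by simp
      next
        case False
        then have "k \<notin> ks m" "k \<notin> ks m'" using *(1,2) by auto
        then show ?thesis by (simp add: in_keys_iff)
      qed
    qed
  qed
  have s1: "(\<lambda>m. restrict (lk m) I) ` ?M \<subseteq> (I \<rightarrow>\<^sub>E UNIV)"
    by (intro image_subsetI) simp
  have cM: "countable ?M" by (rule countable_image_inj_on[OF countable_subset[OF s1 c1] i1])
  let ?g = "\<lambda>P :: ('a \<Rightarrow>\<^sub>0 nat) \<Rightarrow>\<^sub>0 rat. (\<lambda>m. (m, lk P m)) ` ks P"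
  have c2: "countable {T. finite T \<and> T \<subseteq> ?M \<times> (UNIV :: rat set)}"
    by (rule countable_Collect_finite_subset) (use cM in auto)
  have s2: "?g ` mvars I \<subseteq> {T. finite T \<and> T \<subseteq> ?M \<times> (UNIV :: rat set)}"
    by (auto simp: mvars_def)
  have i2: "inj_on ?g (mvars I)"
  proof (rule inj_onI)
    fix P Q :: "('a \<Rightarrow>\<^sub>0 nat) \<Rightarrow>\<^sub>0 rat"
    assume "?g P = ?g Q"
    then have *: "(m, c) \<in> ?g P \<longleftrightarrow> (m, c) \<in> ?g Q" for m c by simp
    show "P = Q"
    proof (rule poly_mapping_eqI)
      fix k show "lk P k = lk Q k"
        using *[of k "lk P k"] *[of k "lk Q k"] by (auto simp: in_keys_iff image_iff)
    qed
  qed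
  show ?thesis by (rule countable_image_inj_on[OF countable_subset[OF s2 c2] i2])
qed

lemma alg_independent_subset: "alg_independent I x \<Longrightarrow> J \<subseteq> I \<Longrightarrow> alg_independent J x"
  by (auto simp: alg_independent_iff mvars_def)

text \<open>Substituting \<open>t\<close> turns each of countably many polynomials \<open>P\<close>
  into a univariate one with finitely many roots. It is nonzero because its coefficient of some
  degree \<open>d\<close> is the value at \<open>x\<close> of a nonzero polynomial \<open>Q\<close>
  in the variables from \<open>I\<close>.\<close>

lemma countable_not_alg_independent:
  assumes "finite I" "i \<notin> I" "alg_independent I x"
  shows "countable {t. \<not> alg_independent (insert i I) (x(i := t))}"
proof -
  define co where "co P m = of_rat (lk P m) * (\<Prod>j\<in>ks m - {i}. x j ^ lk m j)" for P m
  define uni where "uni P = (\<Sum>m\<in>ks P. Polynomial.monom (co P m) (lk m i))" for P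
  have val: "mpoly_value (x(i := t)) P = poly (uni P) t" for P t
  proof -
    have "monom_value (x(i := t)) m = (\<Prod>j\<in>ks m - {i}. x j ^ lk m j) * t ^ lk m i" for m
    proof -
      have "monom_value (x(i := t)) m = (\<Prod>j\<in>insert i (ks m - {i}). (x(i := t)) j ^ lk m j)"
        by (rule monom_value_superset) auto
      also have "\<dots> = t ^ lk m i * (\<Prod>j\<in>ks m - {i}. (x(i := t)) j ^ lk m j)"
        by (subst prod.insert) auto
      also have "(\<Prod>j\<in>ks m - {i}. (x(i := t)) j ^ lk m j) = (\<Prod>j\<in>ks m - {i}. x j ^ lk m j)"
        by (rule prod.cong) auto
      finally show ?thesis by (simp only: mult.commute)
    qed
    then show ?thesis
      by (simp add: mpoly_value_superset[OF finite_keys subset_refl] uni_def poly_sum poly_monom co_def mult_ac)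
  qed
  have nz: "uni P \<noteq> 0" if P: "P \<in> mvars (insert i I)" "P \<noteq> 0" for P
  proof
    assume "uni P = 0"
    from \<open>P \<noteq> 0\<close> have "ks P \<noteq> {}" by (metis poly_mapping_eqI in_keys_iff lookup_zero empty_iff)
    then obtain m0 where m0: "m0 \<in> ks P" by blast
    define d where "d = lk m0 i"
    define S where "S = {m \<in> ks P. lk m i = d}"
    \<comment> \<open>Deletes the variable \<open>i\<close> from a monomial. On \<open>S\<close> its
      exponent is constant, so distinct monomials stay distinct and the coefficient at
      \<open>m0\<close> survives in \<open>Q\<close>.\<close>
    define mp where "mp m = Poly_Mapping.update i (0::nat) m" for m
    define Q where "Q = (\<Sum>m\<in>S. Poly_Mapping.single (mp m) (lk P m))"
    have fS: "finite S" by (simp add: S_def)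
    have inj: "mp m = mp m' \<Longrightarrow> m \<in> S \<Longrightarrow> m' \<in> S \<Longrightarrow> m = m'" for m m'
    proof (rule poly_mapping_eqI)
      fix k assume "mp m = mp m'" "m \<in> S" "m' \<in> S"
      then show "lk m k = lk m' k"
        by (cases "k = i") (auto simp: S_def mp_def dest: arg_cong[where f = "\<lambda>z. lk z k"] simp: lookup_update)
    qed
    have lQ: "lk Q (mp m0) = lk P m0"
    proof -
      have "lk Q (mp m0) = (\<Sum>m\<in>S. lk (Poly_Mapping.single (mp m) (lk P m)) (mp m0))"
        by (simp add: Q_def lookup_sum)
      also have "\<dots> = (\<Sum>m\<in>S. if m = m0 then lk P m0 else 0)"
        by (rule sum.cong) (use inj m0 in \<open>auto simp: lookup_single when_def S_def d_def\<close>)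
      finally show ?thesis using m0 fS by (simp add: S_def d_def)
    qed
    have "Q \<in> mvars I"
      unfolding mvars_def
    proof safe
      fix k j assume k: "k \<in> ks Q" and j: "j \<in> ks k"
      have "\<exists>m\<in>S. k = mp m"
      proof (rule ccontr)
        assume "\<not> (\<exists>m\<in>S. k = mp m)"
        then have "lk Q k = 0" by (auto simp: Q_def lookup_sum lookup_single when_def intro!: sum.neutral)
        then show False using k by (simp add: in_keys_iff)
      qed
      then obtain m where m: "m \<in> S" "k = mp m" by blast
      then have "j \<in> ks m - {i}" using j by (simp add: mp_def keys_update)
      then show "j \<in> I" using m P by (auto simp: S_def mvars_def)
    qed
    moreover have "mpoly_value x Q = 0"
    proof -
      have mv: "monom_value x (mp m) = (\<Prod>j\<in>ks m - {i}. x j ^ lk m j)" for m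
        unfolding monom_value_def mp_def keys_update
        by (rule prod.cong) (auto simp: lookup_update)
      have "mpoly_value x Q = (\<Sum>m\<in>S. co P m)"
        by (simp add: Q_def mpoly_value_sum mpoly_value_single co_def mv)
      also have "\<dots> = (\<Sum>m\<in>ks P. if lk m i = d then co P m else 0)"
        unfolding S_def by (rule sum.inter_filter) simp
      also have "\<dots> = coeff (uni P) d"
        by (simp add: uni_def coeff_sum)
      finally show ?thesis using \<open>uni P = 0\<close> by simp
    qed
    ultimately have "Q = 0" using assms(3) by (simp add: alg_independent_iff)
    then show False using lQ m0 by (simp add: in_keys_iff)
  qed
  let ?B = "\<Union>P\<in>mvars (insert i I) - {0}. {t. poly (uni P) t = 0}"
  have "countable ?B"
  proof (rule countable_UN)
    show "countable (mvars (insert i I) - {0})" using countable_mvars[of "insert i I"] assms(1) by auto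
    show "countable {t. poly (uni P) t = 0}" if "P \<in> mvars (insert i I) - {0}" for P
      using nz[of P] that by (auto intro: countable_finite poly_roots_finite)
  qed
  moreover have "{t. \<not> alg_independent (insert i I) (x(i := t))} \<subseteq> ?B"
    by (auto simp: alg_independent_iff val)
  ultimately show ?thesis using countable_subset by blast
qed

section \<open>Existence and density of generic positions\<close>

lemma generic_subset: "generic V p \<Longrightarrow> W \<subseteq> V \<Longrightarrow> generic W p"
  unfolding generic_def by (rule alg_independent_subset) auto

lemma alg_independent_cong:
  assumes "alg_independent I x" "\<And>i. i \<in> I \<Longrightarrow> x i = y i"
  shows "alg_independent I y"
proof -
  have "mpoly_value x P = mpoly_value y P" if "P \<in> mvars I" for P
    unfolding mpoly_value_def
  proof (intro sum.cong arg_cong2[where f = "(*)"] prod.cong refl)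
    fix m i assume "m \<in> ks P" "i \<in> ks m"
    then have "x i = y i" using that assms(2) by (auto simp: mvars_def)
    then show "x i ^ lk m i = y i ^ lk m i" by simp
  qed
  then show ?thesis using assms(1) by (auto simp: alg_independent_iff)
qed

lemma interval_avoid_countable:
  fixes a e :: real
  assumes "countable B" "0 < e"
  obtains t where "\<bar>t - a\<bar> < e" "t \<notin> B"
proof -
  have "\<not> {a - e<..<a + e} \<subseteq> B"
    using countable_subset[OF _ assms(1)] uncountable_open_interval[of "a - e" "a + e"] assms(2) by auto
  then obtain t where "t \<in> {a - e<..<a + e}" "t \<notin> B" by blast
  then show ?thesis using that[of t] by (auto simp: abs_less_iff)
qed

text \<open>The two coordinates of \<open>x\<close> are chosen in turn, each close to the given one
  and outside a countable set.\<close>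

lemma generic_dense_vertex:
  fixes p :: "'a \<Rightarrow> real^2"
  assumes "finite V" "x \<in> V" "generic (V - {x}) p" "open U" "\<xi>0 \<in> U"
  obtains \<xi> where "\<xi> \<in> U" "generic V (p(x := \<xi>))"
proof -
  obtain e where e: "e > 0" "ball \<xi>0 e \<subseteq> U" using assms(4,5) open_contains_ball by blast
  define I0 where "I0 = (V - {x}) \<times> (UNIV :: 2 set)"
  define c where "c = (\<lambda>(v, i). p v $ i)"
  have f0: "finite I0" using assms(1) by (simp add: I0_def)
  have a0: "alg_independent I0 c" using assms(3) by (simp add: generic_def I0_def c_def)
  have "countable {t. \<not> alg_independent (insert (x, 1) I0) (c((x, 1) := t))}"
    by (rule countable_not_alg_independent) (use f0 a0 in \<open>auto simp: I0_def\<close>)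
  then obtain t1 where t1: "\<bar>t1 - \<xi>0 $ 1\<bar> < e / 2" "alg_independent (insert (x, 1) I0) (c((x, 1) := t1))"
    using interval_avoid_countable[of _ "e / 2" "\<xi>0 $ 1"] e(1) by force
  have "countable {t. \<not> alg_independent (insert (x, 2) (insert (x, 1) I0)) (c((x, 1) := t1, (x, 2) := t))}"
    by (rule countable_not_alg_independent) (use f0 t1 in \<open>auto simp: I0_def\<close>)
  then obtain t2 where t2: "\<bar>t2 - \<xi>0 $ 2\<bar> < e / 2"
      "alg_independent (insert (x, 2) (insert (x, 1) I0)) (c((x, 1) := t1, (x, 2) := t2))"
    using interval_avoid_countable[of _ "e / 2" "\<xi>0 $ 2"] e(1) by force
  define \<xi> :: "real^2" where "\<xi> = vector [t1, t2]"
  have ii: "insert (x, 2) (insert (x, 1) I0) = V \<times> (UNIV :: 2 set)"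
    using assms(2) by (auto simp: I0_def UNIV_2)
  have "generic V (p(x := \<xi>))"
    unfolding generic_def
  proof (rule alg_independent_cong[OF t2(2)[unfolded ii]])
    fix j :: "'a \<times> 2"
    obtain v b where j: "j = (v, b)" by (cases j)
    have "b = 1 \<or> b = 2" by (rule exhaust_2)
    then show "(c((x, 1) := t1, (x, 2) := t2)) j = (case j of (v, i) \<Rightarrow> (p(x := \<xi>)) v $ i)"
      by (auto simp: c_def \<xi>_def j)
  qed
  moreover have "dist \<xi>0 \<xi> < e"
  proof -
    have "norm (\<xi> - \<xi>0) \<le> \<bar>(\<xi> - \<xi>0) $ 1\<bar> + \<bar>(\<xi> - \<xi>0) $ 2\<bar>"
      using norm_le_l1_cart[of "\<xi> - \<xi>0"] by (simp add: sum_2)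
    also have "\<dots> < e" using t1(1) t2(1) by (simp add: \<xi>_def)
    finally show ?thesis by (simp add: dist_norm norm_minus_commute)
  qed
  ultimately show ?thesis using that e(2) by (auto simp: subset_iff)
qed

lemma generic_exists:
  assumes "finite V" shows "\<exists>p. generic V p"
  using assms
proof (induction V rule: finite_induct)
  case empty
  have "P = 0" if "P \<in> mvars {}" "mpoly_value x P = 0" for x :: "'a \<times> 2 \<Rightarrow> real" and P
  proof -
    have "ks P \<subseteq> {0}" using that(1) by (auto simp: mvars_def)
    then have "mpoly_value x P = of_rat (lk P 0)"
      by (subst mpoly_value_superset[of "{0}"]) (auto simp: monom_value_def)
    then have "lk P 0 = 0" using that(2) by simp
    then have "lk P k = 0" for k using \<open>ks P \<subseteq> {0}\<close> by (cases "k = 0") (auto simp: in_keys_iff subset_iff)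
    then show ?thesis by (intro poly_mapping_eqI) simp
  qed
  then show ?case by (auto simp: generic_def alg_independent_iff)
next
  case (insert x V)
  then obtain p where "generic V p" by blast
  then have "generic (insert x V - {x}) p" using insert by simp
  then show ?case
    using generic_dense_vertex[of "insert x V" x p UNIV 0] insert by auto
qed

section \<open>Rational functions of a generic framework\<close>

definition Pol :: "'a set \<Rightarrow> (('a \<Rightarrow> real^2) \<Rightarrow> real) set" where
  "Pol V = {\<phi>. \<exists>P\<in>mvars (V \<times> UNIV). \<forall>p. \<phi> p = mpoly_value (\<lambda>(v, i). p v $ i) P}"

lemma Pol_I: "P \<in> mvars (V \<times> UNIV) \<Longrightarrow> (\<And>p. \<phi> p = mpoly_value (\<lambda>(v, i). p v $ i) P) \<Longrightarrow> \<phi> \<in> Pol V"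
  unfolding Pol_def by blast

lemma Pol_E:
  assumes "\<phi> \<in> Pol V"
  obtains P where "P \<in> mvars (V \<times> UNIV)" "\<And>p. \<phi> p = mpoly_value (\<lambda>(v, i). p v $ i) P"
  using assms unfolding Pol_def by blast

lemma Pol_const: "(\<lambda>p. of_rat c) \<in> Pol V"
  by (rule Pol_I[OF mvars_const[of c]]) (simp add: mpoly_value_single monom_value_def)

lemma Pol_0: "(\<lambda>p. 0) \<in> Pol V" and Pol_1: "(\<lambda>p. 1) \<in> Pol V"
  using Pol_const[of 0] Pol_const[of 1] by simp_all

lemma Pol_coord: "v \<in> V \<Longrightarrow> (\<lambda>p. p v $ i) \<in> Pol V"
  by (rule Pol_I[OF mvars_var[of "(v, i)"]]) (simp_all add: mpoly_value_single monom_value_def)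

lemma Pol_add: "\<phi> \<in> Pol V \<Longrightarrow> \<psi> \<in> Pol V \<Longrightarrow> (\<lambda>p. \<phi> p + \<psi> p) \<in> Pol V"
  by (elim Pol_E, rule Pol_I, erule (1) mvars_add) (simp add: mpoly_value_add)

lemma Pol_mult: "\<phi> \<in> Pol V \<Longrightarrow> \<psi> \<in> Pol V \<Longrightarrow> (\<lambda>p. \<phi> p * \<psi> p) \<in> Pol V"
  by (elim Pol_E, rule Pol_I, erule (1) mvars_mult) (simp add: mpoly_value_mult)

lemma Pol_diff: "\<phi> \<in> Pol V \<Longrightarrow> \<psi> \<in> Pol V \<Longrightarrow> (\<lambda>p. \<phi> p - \<psi> p) \<in> Pol V"
  using Pol_add[OF _ Pol_mult[OF Pol_const[of "-1"]], of \<phi> V \<psi>] by simp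

text \<open>The point \<open>q\<close> is arbitrary: to show that a polynomial does not vanish at a
  generic \<open>p\<close>, one convenient special position suffices.\<close>

lemma generic_Pol_zero:
  assumes "\<phi> \<in> Pol V" "generic V p" "\<phi> p = 0" shows "\<phi> q = 0"
proof -
  obtain P where P: "P \<in> mvars (V \<times> UNIV)" "\<And>p. \<phi> p = mpoly_value (\<lambda>(v, i). p v $ i) P"
    by (rule Pol_E[OF assms(1)]) blast
  have "P = 0" using assms(2,3) P by (auto simp: generic_def alg_independent_iff)
  then show ?thesis using P(2) by (simp add: mpoly_value_zero)
qed

text \<open>Only the values at generic \<open>p\<close> matter, so \<open>RF V\<close> behaves as the field of rational functions.\<close>

definition RF :: "'a set \<Rightarrow> (('a \<Rightarrow> real^2) \<Rightarrow> real) set" where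
  "RF V = {\<phi>. \<exists>A\<in>Pol V. \<exists>B\<in>Pol V. \<forall>p. generic V p \<longrightarrow> B p \<noteq> 0 \<and> \<phi> p = A p / B p}"

lemma RF_I:
  assumes "A \<in> Pol V" "B \<in> Pol V" "\<And>p. generic V p \<Longrightarrow> B p \<noteq> 0" "\<And>p. generic V p \<Longrightarrow> \<phi> p = A p / B p"
  shows "\<phi> \<in> RF V"
  using assms unfolding RF_def by blast

lemma RF_E:
  assumes "\<phi> \<in> RF V"
  obtains A B where "A \<in> Pol V" "B \<in> Pol V" "\<And>p. generic V p \<Longrightarrow> B p \<noteq> 0" "\<And>p. generic V p \<Longrightarrow> \<phi> p = A p / B p"
  using assms unfolding RF_def by blast

lemma Pol_RF: "\<phi> \<in> Pol V \<Longrightarrow> \<phi> \<in> RF V"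
  by (rule RF_I[OF _ Pol_1]) auto

lemmas RF_0 = Pol_RF[OF Pol_0] and RF_1 = Pol_RF[OF Pol_1]

lemma generic_RF_zero:
  assumes "\<phi> \<in> RF V" "generic V p" "\<phi> p = 0" "generic V q" shows "\<phi> q = 0"
proof -
  obtain A B where AB: "A \<in> Pol V" "B \<in> Pol V" "\<And>p. generic V p \<Longrightarrow> B p \<noteq> 0" "\<And>p. generic V p \<Longrightarrow> \<phi> p = A p / B p"
    by (rule RF_E[OF assms(1)]) blast
  have "A p = 0" using AB(3,4)[OF assms(2)] assms(3) by simp
  then have "A q = 0" using generic_Pol_zero[OF AB(1) assms(2)] by blast
  then show ?thesis using AB(4)[OF assms(4)] by simp
qed

lemma RF_add:
  assumes "\<phi> \<in> RF V" "\<psi> \<in> RF V" shows "(\<lambda>p. \<phi> p + \<psi> p) \<in> RF V"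
proof -
  obtain A B where AB: "A \<in> Pol V" "B \<in> Pol V" "\<And>p. generic V p \<Longrightarrow> B p \<noteq> 0" "\<And>p. generic V p \<Longrightarrow> \<phi> p = A p / B p"
    by (rule RF_E[OF assms(1)]) blast
  obtain C D where CD: "C \<in> Pol V" "D \<in> Pol V" "\<And>p. generic V p \<Longrightarrow> D p \<noteq> 0" "\<And>p. generic V p \<Longrightarrow> \<psi> p = C p / D p"
    by (rule RF_E[OF assms(2)]) blast
  show ?thesis
    by (rule RF_I[of "\<lambda>p. A p * D p + C p * B p" V "\<lambda>p. B p * D p"])
      (use AB CD in \<open>auto intro!: Pol_add Pol_mult simp: add_frac_eq\<close>)
qed

lemma RF_mult:
  assumes "\<phi> \<in> RF V" "\<psi> \<in> RF V" shows "(\<lambda>p. \<phi> p * \<psi> p) \<in> RF V"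
proof -
  obtain A B where AB: "A \<in> Pol V" "B \<in> Pol V" "\<And>p. generic V p \<Longrightarrow> B p \<noteq> 0" "\<And>p. generic V p \<Longrightarrow> \<phi> p = A p / B p"
    by (rule RF_E[OF assms(1)]) blast
  obtain C D where CD: "C \<in> Pol V" "D \<in> Pol V" "\<And>p. generic V p \<Longrightarrow> D p \<noteq> 0" "\<And>p. generic V p \<Longrightarrow> \<psi> p = C p / D p"
    by (rule RF_E[OF assms(2)]) blast
  show ?thesis
    by (rule RF_I[of "\<lambda>p. A p * C p" V "\<lambda>p. B p * D p"])
      (use AB CD in \<open>auto intro!: Pol_mult\<close>)
qed

lemma RF_diff: "\<phi> \<in> RF V \<Longrightarrow> \<psi> \<in> RF V \<Longrightarrow> (\<lambda>p. \<phi> p - \<psi> p) \<in> RF V"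
  using RF_add[OF _ RF_mult[OF Pol_RF[OF Pol_const[of "-1"]]], of \<phi> V \<psi>] by simp

lemma RF_divide:
  assumes "\<phi> \<in> RF V" "\<psi> \<in> RF V" shows "(\<lambda>p. \<phi> p / \<psi> p) \<in> RF V"
proof (cases "\<exists>p. generic V p \<and> \<psi> p \<noteq> 0")
  case True
  obtain A B where AB: "A \<in> Pol V" "B \<in> Pol V" "\<And>p. generic V p \<Longrightarrow> B p \<noteq> 0" "\<And>p. generic V p \<Longrightarrow> \<phi> p = A p / B p"
    by (rule RF_E[OF assms(1)]) blast
  obtain C D where CD: "C \<in> Pol V" "D \<in> Pol V" "\<And>p. generic V p \<Longrightarrow> D p \<noteq> 0" "\<And>p. generic V p \<Longrightarrow> \<psi> p = C p / D p"
    by (rule RF_E[OF assms(2)]) blast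
  have "C p \<noteq> 0" if "generic V p" for p
    using True generic_RF_zero[OF assms(2) that] CD(4)[OF that] by fastforce
  then show ?thesis
    by (intro RF_I[of "\<lambda>p. A p * D p" V "\<lambda>p. B p * C p"])
      (use AB CD in \<open>auto intro!: Pol_mult\<close>)
next
  case False
  \<comment> \<open>Here \<psi> vanishes at every generic point, and division by 0 gives 0.\<close>
  then show ?thesis by (intro RF_I[OF Pol_0 Pol_1]) auto
qed

lemma RF_sum: "(\<And>j. j \<in> J \<Longrightarrow> (\<lambda>p. \<phi> p j) \<in> RF V) \<Longrightarrow> (\<lambda>p. \<Sum>j\<in>J. \<phi> p j) \<in> RF V"
  by (induction J rule: infinite_finite_induct) (simp_all add: RF_0 RF_add)

lemma RF_if: "(P \<Longrightarrow> \<phi> \<in> RF V) \<Longrightarrow> (\<not> P \<Longrightarrow> \<psi> \<in> RF V) \<Longrightarrow> (\<lambda>p. if P then \<phi> p else \<psi> p) \<in> RF V"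
  by (cases P) auto

lemma RF_unit_fun: "(\<lambda>p. unit_fun j i) \<in> RF V"
  unfolding unit_fun_def by (intro RF_if RF_0 RF_1)

lemma subspace_functional_kernel:
  fixes a :: "'j \<Rightarrow> real"
  shows "fs.subspace {x. (\<Sum>j\<in>J. a j * x j) = 0}"
  unfolding fs.subspace_def
proof (intro conjI ballI allI)
  show "0 \<in> {x. (\<Sum>j\<in>J. a j * x j) = 0}" by simp
next
  fix x y assume "x \<in> {x. (\<Sum>j\<in>J. a j * x j) = 0}" "y \<in> {x. (\<Sum>j\<in>J. a j * x j) = 0}"
  then show "x + y \<in> {x. (\<Sum>j\<in>J. a j * x j) = 0}" by (simp add: distrib_left sum.distrib)
next
  fix c x assume "x \<in> {x. (\<Sum>j\<in>J. a j * x j) = 0}"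
  then have "c * (\<Sum>j\<in>J. a j * x j) = 0" by simp
  then show "(\<lambda>i. c * x i) \<in> {x. (\<Sum>j\<in>J. a j * x j) = 0}"
    by (simp add: sum_distrib_left mult.left_commute)
qed

text \<open>Gaussian elimination, uniform in \<open>p\<close>. A pivot that is nonzero at one
  generic point is nonzero at all of them, so the same elimination step is valid everywhere.
  \<open>K\<close> is merely a spanning set: the map \<open>T\<close> sends the pivot vector to
  0.\<close>

lemma RF_kernel:
  fixes R :: "(('a \<Rightarrow> real^2) \<Rightarrow> 'j \<Rightarrow> real) set"
  assumes "finite J" "finite R" "\<And>\<alpha> j. \<alpha> \<in> R \<Longrightarrow> j \<in> J \<Longrightarrow> (\<lambda>p. \<alpha> p j) \<in> RF V"
  shows "\<exists>K :: (('a \<Rightarrow> real^2) \<Rightarrow> 'j \<Rightarrow> real) set. finite K \<and> (\<forall>\<kappa>\<in>K. \<forall>j. (\<lambda>p. \<kappa> p j) \<in> RF V) \<and>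
    (\<forall>p. generic V p \<longrightarrow>
      {x \<in> supp_in J. \<forall>\<alpha>\<in>R. (\<Sum>j\<in>J. \<alpha> p j * x j) = 0} = fs.span ((\<lambda>\<kappa>. \<kappa> p) ` K))"
  using assms(2,3)
proof (induction R rule: finite_induct)
  case empty
  let ?K = "(\<lambda>j. \<lambda>p :: 'a \<Rightarrow> real^2. unit_fun j) ` J"
  have "supp_in J = fs.span (unit_fun ` J)"
  proof
    show "fs.span (unit_fun ` J) \<subseteq> supp_in J"
      by (rule fs.span_minimal[OF _ subspace_supp_in]) (auto simp: supp_in_def unit_fun_def)
  qed (rule supp_in_span[OF assms(1)])
  moreover have "(\<lambda>\<kappa>. \<kappa> p) ` ?K = unit_fun ` J" for p :: "'a \<Rightarrow> real^2" by (simp add: image_image)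
  ultimately show ?case using assms(1) RF_unit_fun by (intro exI[of _ ?K]) auto
next
  case (insert \<alpha> R)
  then obtain K :: "(('a \<Rightarrow> real^2) \<Rightarrow> 'j \<Rightarrow> real) set"
    where K: "finite K" "\<And>\<kappa> j. \<kappa> \<in> K \<Longrightarrow> (\<lambda>p. \<kappa> p j) \<in> RF V"
      "\<And>p. generic V p \<Longrightarrow> {x \<in> supp_in J. \<forall>\<alpha>\<in>R. (\<Sum>j\<in>J. \<alpha> p j * x j) = 0} = fs.span ((\<lambda>\<kappa>. \<kappa> p) ` K)"
    by auto
  define f where "f p x = (\<Sum>j\<in>J. \<alpha> p j * x j)" for p x
  have fadd: "f p (x + y) = f p x + f p y" for p x y by (simp add: f_def distrib_left sum.distrib)
  have fscale: "f p (\<lambda>i. c * x i) = c * f p x" for p c x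
    by (simp add: f_def sum_distrib_left mult.left_commute)
  have fsub: "fs.subspace {x. f p x = 0}" for p unfolding f_def by (rule subspace_functional_kernel)
  have fRF: "(\<lambda>p. f p (\<kappa> p)) \<in> RF V" if "\<kappa> \<in> K" for \<kappa>
    unfolding f_def using insert.prems K(2)[OF that] by (intro RF_sum RF_mult) auto
  have split: "{x \<in> supp_in J. \<forall>\<alpha>\<in>insert \<alpha> R. (\<Sum>j\<in>J. \<alpha> p j * x j) = 0}
      = fs.span ((\<lambda>\<kappa>. \<kappa> p) ` K) \<inter> {x. f p x = 0}" if "generic V p" for p
    using K(3)[OF that] by (auto simp: f_def)
  show ?case
  proof (cases "\<exists>\<kappa>\<in>K. \<exists>p. generic V p \<and> f p (\<kappa> p) \<noteq> 0")
    case False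
    have "fs.span ((\<lambda>\<kappa>. \<kappa> p) ` K) \<subseteq> {x. f p x = 0}" if "generic V p" for p
      by (rule fs.span_minimal[OF _ fsub]) (use False that in auto)
    then have "fs.span ((\<lambda>\<kappa>. \<kappa> p) ` K) \<inter> {x. f p x = 0} = fs.span ((\<lambda>\<kappa>. \<kappa> p) ` K)"
      if "generic V p" for p using that by blast
    then show ?thesis using K(1,2) split by (intro exI[of _ K]) simp
  next
    case True
    then obtain \<kappa>0 p0 where \<kappa>0: "\<kappa>0 \<in> K" "generic V p0" "f p0 (\<kappa>0 p0) \<noteq> 0" by blast
    have nz: "f p (\<kappa>0 p) \<noteq> 0" if "generic V p" for p
      using generic_RF_zero[OF fRF[OF \<kappa>0(1)] that _ \<kappa>0(2)] \<kappa>0(3) by blast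
    define T where "T p x = (\<lambda>i. x i - f p x / f p (\<kappa>0 p) * \<kappa>0 p i)" for p x
    let ?K' = "(\<lambda>\<kappa> p. T p (\<kappa> p)) ` K"
    have "fs.span ((\<lambda>\<kappa>. \<kappa> p) ` K) \<inter> {x. f p x = 0} = fs.span ((\<lambda>\<kappa>. \<kappa> p) ` ?K')"
      if p: "generic V p" for p
    proof
      have Tadd: "T p (x + y) = T p x + T p y" for x y
        by (auto simp: T_def fadd fun_eq_iff add_divide_distrib algebra_simps)
      have Tscale: "T p (\<lambda>i. c * x i) = (\<lambda>i. c * T p x i)" for c x
        unfolding T_def fscale by (auto simp: fun_eq_iff algebra_simps)
      have T0: "T p 0 = 0" using Tadd[of 0 0] by simp
      show "fs.span ((\<lambda>\<kappa>. \<kappa> p) ` K) \<inter> {x. f p x = 0} \<subseteq> fs.span ((\<lambda>\<kappa>. \<kappa> p) ` ?K')"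
      proof safe
        fix x assume x: "x \<in> fs.span ((\<lambda>\<kappa>. \<kappa> p) ` K)" "f p x = 0"
        have "T p x \<in> fs.span ((\<lambda>\<kappa>. \<kappa> p) ` ?K')"
          using x(1)
        proof (rule fs.span_induct)
          show "fs.subspace {x. T p x \<in> fs.span ((\<lambda>\<kappa>. \<kappa> p) ` ?K')}"
            unfolding fs.subspace_def
          proof (intro conjI ballI allI)
            show "0 \<in> {x. T p x \<in> fs.span ((\<lambda>\<kappa>. \<kappa> p) ` ?K')}" using T0 fs.span_zero by simp
          next
            fix x y
            assume "x \<in> {x. T p x \<in> fs.span ((\<lambda>\<kappa>. \<kappa> p) ` ?K')}" "y \<in> {x. T p x \<in> fs.span ((\<lambda>\<kappa>. \<kappa> p) ` ?K')}"
            then show "x + y \<in> {x. T p x \<in> fs.span ((\<lambda>\<kappa>. \<kappa> p) ` ?K')}"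
              unfolding mem_Collect_eq Tadd by (rule fs.span_add)
          next
            fix c x
            assume "x \<in> {x. T p x \<in> fs.span ((\<lambda>\<kappa>. \<kappa> p) ` ?K')}"
            then show "(\<lambda>i. c * x i) \<in> {x. T p x \<in> fs.span ((\<lambda>\<kappa>. \<kappa> p) ` ?K')}"
              unfolding mem_Collect_eq Tscale by (rule fs.span_scale)
          qed
        next
          fix x assume "x \<in> (\<lambda>\<kappa>. \<kappa> p) ` K"
          then show "T p x \<in> fs.span ((\<lambda>\<kappa>. \<kappa> p) ` ?K')" by (intro fs.span_base) auto
        qed
        moreover have "T p x = x" using x(2) by (simp add: T_def)
        ultimately show "x \<in> fs.span ((\<lambda>\<kappa>. \<kappa> p) ` ?K')" by simp
      qed
      show "fs.span ((\<lambda>\<kappa>. \<kappa> p) ` ?K') \<subseteq> fs.span ((\<lambda>\<kappa>. \<kappa> p) ` K) \<inter> {x. f p x = 0}"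
      proof (rule fs.span_minimal)
        show "fs.subspace (fs.span ((\<lambda>\<kappa>. \<kappa> p) ` K) \<inter> {x. f p x = 0})"
          by (intro fs.subspace_inter fs.subspace_span fsub)
        have Teq: "T p x = x + (\<lambda>i. (- (f p x / f p (\<kappa>0 p))) * \<kappa>0 p i)" for x
          by (auto simp: T_def fun_eq_iff)
        have "f p (T p x) = 0" for x unfolding Teq fadd fscale using nz[OF p] by simp
        moreover have "T p (\<kappa> p) \<in> fs.span ((\<lambda>\<kappa>. \<kappa> p) ` K)" if "\<kappa> \<in> K" for \<kappa>
          unfolding Teq by (intro fs.span_add fs.span_scale fs.span_base) (use that \<kappa>0 in auto)
        ultimately show "(\<lambda>\<kappa>. \<kappa> p) ` ?K' \<subseteq> fs.span ((\<lambda>\<kappa>. \<kappa> p) ` K) \<inter> {x. f p x = 0}" by auto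
      qed
    qed
    moreover have "(\<lambda>p. T p (\<kappa> p) j) \<in> RF V" if "\<kappa> \<in> K" for \<kappa> j
      unfolding T_def using K(2) fRF that \<kappa>0(1) by (intro RF_diff RF_mult RF_divide) auto
    ultimately show ?thesis using K(1) split by (intro exI[of _ ?K']) auto
  qed
qed

section \<open>Stress spaces parametrised by rational functions\<close>

definition lap :: "'a set \<Rightarrow> ('a set \<Rightarrow> real) \<Rightarrow> ('a \<Rightarrow> real) \<Rightarrow> 'a \<Rightarrow> real" where
  "lap V \<omega> z x = (if x \<in> V then \<Sum>y\<in>V. \<omega> {x, y} * (z x - z y) else 0)"

definition St :: "'a set \<Rightarrow> ('a \<Rightarrow> real^2) \<Rightarrow> 'a set set \<Rightarrow> ('a set \<Rightarrow> real) set" where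
  "St V p F = {\<omega> \<in> supp_in F. \<forall>i. lap V \<omega> (\<lambda>v. p v $ i) = 0}"

definition KE :: "'a set \<Rightarrow> 'a set set" where
  "KE V = {e. e \<subseteq> V \<and> card e = 2}"

lemma finite_KE: "finite V \<Longrightarrow> finite (KE V)"
  by (rule finite_subset[of _ "Pow V"]) (auto simp: KE_def)

lemma St_RF:
  assumes V: "finite V" and F: "finite F"
  obtains K where "finite K" "\<And>\<kappa> e. \<kappa> \<in> K \<Longrightarrow> (\<lambda>p. \<kappa> p e) \<in> RF V"
    "\<And>p. generic V p \<Longrightarrow> St V p F = fs.span ((\<lambda>\<kappa>. \<kappa> p) ` K)"
proof -
  \<comment> \<open>The coefficient of the edge \<open>e\<close> in coordinate \<open>i\<close> of
    the equilibrium condition at \<open>x\<close>; the sum over \<open>y\<close> picks the other end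
    of \<open>e\<close>.\<close>
  define \<alpha> where "\<alpha> x i p e = (\<Sum>y\<in>V. if e = {x, y} then p x $ i - p y $ i else 0)"
    for x and i :: 2 and p :: "'a \<Rightarrow> real^2" and e
  define R where "R = (\<lambda>(x, i). \<alpha> x i) ` (V \<times> UNIV)"
  have "\<exists>K. finite K \<and> (\<forall>\<kappa>\<in>K. \<forall>e. (\<lambda>p. \<kappa> p e) \<in> RF V) \<and>
    (\<forall>p. generic V p \<longrightarrow>
      {x \<in> supp_in F. \<forall>\<alpha>\<in>R. (\<Sum>j\<in>F. \<alpha> p j * x j) = 0} = fs.span ((\<lambda>\<kappa>. \<kappa> p) ` K))"
  proof (rule RF_kernel[OF F])
    show "finite R" using V by (auto simp: R_def)
    show "(\<lambda>p. \<beta> p e) \<in> RF V" if "\<beta> \<in> R" for \<beta> e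
      using that unfolding R_def \<alpha>_def
      by (auto intro!: RF_sum RF_if RF_0 RF_diff Pol_RF[OF Pol_coord])
  qed
  then obtain K where K: "finite K" "\<And>\<kappa> e. \<kappa> \<in> K \<Longrightarrow> (\<lambda>p. \<kappa> p e) \<in> RF V"
    "\<And>p. generic V p \<Longrightarrow> {x \<in> supp_in F. \<forall>\<alpha>\<in>R. (\<Sum>j\<in>F. \<alpha> p j * x j) = 0} = fs.span ((\<lambda>\<kappa>. \<kappa> p) ` K)"
    by blast
  have eq: "(\<Sum>e\<in>F. \<alpha> x i p e * \<omega> e) = lap V \<omega> (\<lambda>v. p v $ i) x"
    if "\<omega> \<in> supp_in F" "x \<in> V" for \<omega> x i p
  proof -
    have "(\<Sum>e\<in>F. \<alpha> x i p e * \<omega> e)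
        = (\<Sum>y\<in>V. \<Sum>e\<in>F. (if e = {x, y} then p x $ i - p y $ i else 0) * \<omega> e)"
      unfolding \<alpha>_def sum_distrib_right by (rule sum.swap)
    also have "\<dots> = (\<Sum>y\<in>V. \<omega> {x, y} * (p x $ i - p y $ i))"
    proof (rule sum.cong[OF refl])
      fix y
      have "(\<Sum>e\<in>F. (if e = {x, y} then p x $ i - p y $ i else 0) * \<omega> e)
          = (\<Sum>e\<in>F. if e = {x, y} then \<omega> {x, y} * (p x $ i - p y $ i) else 0)"
        by (rule sum.cong) auto
      also have "\<dots> = \<omega> {x, y} * (p x $ i - p y $ i)"
        using that(1) F by (auto simp: supp_in_def)
      finally show "(\<Sum>e\<in>F. (if e = {x, y} then p x $ i - p y $ i else 0) * \<omega> e)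
          = \<omega> {x, y} * (p x $ i - p y $ i)" .
    qed
    finally show ?thesis using that(2) by (simp add: lap_def)
  qed
  have "St V p F = {x \<in> supp_in F. \<forall>\<alpha>\<in>R. (\<Sum>j\<in>F. \<alpha> p j * x j) = 0}" for p
  proof -
    have "(\<forall>i. lap V \<omega> (\<lambda>v. p v $ i) = 0) \<longleftrightarrow> (\<forall>\<alpha>\<in>R. (\<Sum>j\<in>F. \<alpha> p j * \<omega> j) = 0)"
      if "\<omega> \<in> supp_in F" for \<omega>
    proof -
      have "(\<forall>\<alpha>\<in>R. (\<Sum>j\<in>F. \<alpha> p j * \<omega> j) = 0) \<longleftrightarrow> (\<forall>x\<in>V. \<forall>i. lap V \<omega> (\<lambda>v. p v $ i) x = 0)"
        using eq[OF that] by (auto simp: R_def)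
      also have "\<dots> \<longleftrightarrow> (\<forall>i. lap V \<omega> (\<lambda>v. p v $ i) = 0)"
        by (auto simp: fun_eq_iff lap_def)
      finally show ?thesis by blast
    qed
    then show ?thesis by (auto simp: St_def)
  qed
  then show ?thesis using that[of K] K by simp
qed

text \<open>Generators of the stress space that vanish at \<open>p\<close> vanish at
  \<open>q\<close>. This makes the choice of framework in \<open>rigidity_matroid\<close>
  immaterial, and it keeps a circuit dependent while one of its vertices moves.\<close>

lemma independence_generic:
  assumes "finite V" "finite F" "generic V p" "generic V q" "St V p F \<subseteq> {0}"
  shows "St V q F \<subseteq> {0}"
proof -
  obtain K where K: "finite K" "\<And>\<kappa> e. \<kappa> \<in> K \<Longrightarrow> (\<lambda>p. \<kappa> p e) \<in> RF V"
    "\<And>p. generic V p \<Longrightarrow> St V p F = fs.span ((\<lambda>\<kappa>. \<kappa> p) ` K)"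
    by (rule St_RF[OF assms(1,2)]) blast
  have "\<kappa> q = 0" if "\<kappa> \<in> K" for \<kappa>
  proof
    fix e
    have "\<kappa> p \<in> St V p F" using K(3)[OF assms(3)] that by (simp add: fs.span_base)
    then have "\<kappa> p e = 0" using assms(5) by auto
    then show "\<kappa> q e = 0 e" using generic_RF_zero[OF K(2)[OF that] assms(3) _ assms(4)] by simp
  qed
  then have "(\<lambda>\<kappa>. \<kappa> q) ` K \<subseteq> {0}" by auto
  then have "fs.span ((\<lambda>\<kappa>. \<kappa> q) ` K) \<subseteq> {0}"
    by (rule fs.span_minimal) (simp add: fs.subspace_single_0)
  then show ?thesis using K(3)[OF assms(4)] by simp
qed

lemma lap_add_left: "lap V (\<omega> + \<omega>') z = lap V \<omega> z + lap V \<omega>' z"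
  by (auto simp: lap_def fun_eq_iff distrib_right sum.distrib)

lemma lap_scale_left: "lap V (\<lambda>e. c * \<omega> e) z = (\<lambda>x. c * lap V \<omega> z x)"
  by (auto simp: lap_def fun_eq_iff sum_distrib_left mult.assoc)

lemma lap_add: "lap V \<omega> (z + z') = lap V \<omega> z + lap V \<omega> z'"
  by (auto simp: lap_def fun_eq_iff algebra_simps sum.distrib sum_subtractf)

lemma lap_scale: "lap V \<omega> (\<lambda>x. c * z x) = (\<lambda>x. c * lap V \<omega> z x)"
  by (auto simp: lap_def fun_eq_iff sum_distrib_left algebra_simps)

lemma lap_0 [simp]: "lap V \<omega> 0 = 0" and lap_0_left [simp]: "lap V 0 z = 0"
  by (auto simp: lap_def fun_eq_iff)

lemma lap_sum: "lap V \<omega> (\<Sum>j\<in>J. f j) = (\<Sum>j\<in>J. lap V \<omega> (f j))"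
  by (induction J rule: infinite_finite_induct)
    (simp_all only: sum.infinite sum.empty sum.insert lap_0 lap_add not_False_eq_True)

lemma lap_cong: "(\<And>v. v \<in> V \<Longrightarrow> z v = z' v) \<Longrightarrow> lap V \<omega> z = lap V \<omega> z'"
  by (auto simp: lap_def fun_eq_iff)

lemma lap_expand:
  assumes "finite V" "z \<in> supp_in V"
  shows "lap V \<omega> z x = (\<Sum>v\<in>V. lap V \<omega> (unit_fun v) x * z v)"
proof -
  have "lap V \<omega> z = (\<Sum>v\<in>V. lap V \<omega> (\<lambda>i. z v * unit_fun v i))"
    using supp_in_expand[OF assms] lap_sum by metis
  then show ?thesis by (simp add: lap_scale sum_fun_apply mult.commute)
qed

text \<open>The vectors satisfied by all stresses of \<open>F\<close>: the coordinates of the configurations \<open>q\<close> with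
  \<open>S(F,p) \<subseteq> S(F,q)\<close>.\<close>

definition NS :: "'a set \<Rightarrow> ('a \<Rightarrow> real^2) \<Rightarrow> 'a set set \<Rightarrow> ('a \<Rightarrow> real) set" where
  "NS V p F = {z. \<forall>\<omega>\<in>St V p F. lap V \<omega> z = 0}"

lemma NS_span:
  assumes "St V p F = fs.span K"
  shows "NS V p F = {z. \<forall>\<kappa>\<in>K. lap V \<kappa> z = 0}"
proof
  show "NS V p F \<subseteq> {z. \<forall>\<kappa>\<in>K. lap V \<kappa> z = 0}" by (auto simp: NS_def assms fs.span_base)
  show "{z. \<forall>\<kappa>\<in>K. lap V \<kappa> z = 0} \<subseteq> NS V p F"
  proof
    fix z assume z: "z \<in> {z. \<forall>\<kappa>\<in>K. lap V \<kappa> z = 0}"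
    have sub: "fs.subspace {\<omega>. lap V \<omega> z = 0}"
      unfolding fs.subspace_def
      by (auto simp: lap_add_left lap_scale_left fun_eq_iff)
    have "fs.span K \<subseteq> {\<omega>. lap V \<omega> z = 0}" by (rule fs.span_minimal[OF _ sub]) (use z in auto)
    then show "z \<in> NS V p F" by (auto simp: NS_def assms)
  qed
qed

text \<open>The inclusion says that generators of the stresses of \<open>F2\<close> kill generators
  of the \<open>NS\<close> space of \<open>F1\<close>. These are rational conditions on
  \<open>p\<close>, so they hold at every generic point or at none.\<close>

lemma NS_subset_generic:
  assumes V: "finite V" and F: "finite F1" "finite F2" and gen: "generic V p" "generic V q"
    and sub: "NS V p F1 \<subseteq> NS V p F2"
  shows "NS V q F1 \<subseteq> NS V q F2"
proof -
  obtain K1 where K1: "finite K1" "\<And>\<kappa> e. \<kappa> \<in> K1 \<Longrightarrow> (\<lambda>p. \<kappa> p e) \<in> RF V"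
    "\<And>p. generic V p \<Longrightarrow> St V p F1 = fs.span ((\<lambda>\<kappa>. \<kappa> p) ` K1)"
    by (rule St_RF[OF V F(1)]) blast
  obtain K2 where K2: "finite K2" "\<And>\<kappa> e. \<kappa> \<in> K2 \<Longrightarrow> (\<lambda>p. \<kappa> p e) \<in> RF V"
    "\<And>p. generic V p \<Longrightarrow> St V p F2 = fs.span ((\<lambda>\<kappa>. \<kappa> p) ` K2)"
    by (rule St_RF[OF V F(2)]) blast
  define \<alpha> where "\<alpha> \<kappa> x p v = lap V (\<kappa> p) (unit_fun v) x"
    for \<kappa> :: "('a \<Rightarrow> real^2) \<Rightarrow> 'a set \<Rightarrow> real" and x p v
  define R where "R = (\<lambda>(\<kappa>, x). \<alpha> \<kappa> x) ` (K1 \<times> V)"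
  have RFl: "(\<lambda>p. lap V (\<kappa> p) (\<zeta> p) x) \<in> RF V"
    if "\<And>e. (\<lambda>p. \<kappa> p e) \<in> RF V" "\<And>v. (\<lambda>p. \<zeta> p v) \<in> RF V" for \<kappa> \<zeta> x
    unfolding lap_def using that by (intro RF_if RF_sum RF_mult RF_diff RF_0)
  have "\<exists>K. finite K \<and> (\<forall>\<kappa>\<in>K. \<forall>e. (\<lambda>p. \<kappa> p e) \<in> RF V) \<and>
    (\<forall>p. generic V p \<longrightarrow>
      {x \<in> supp_in V. \<forall>\<alpha>\<in>R. (\<Sum>j\<in>V. \<alpha> p j * x j) = 0} = fs.span ((\<lambda>\<kappa>. \<kappa> p) ` K))"
  proof (rule RF_kernel[OF V])
    show "finite R" using V K1 by (auto simp: R_def)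
    show "(\<lambda>p. \<beta> p e) \<in> RF V" if "\<beta> \<in> R" for \<beta> e
      using that K1(2) unfolding R_def \<alpha>_def by (auto intro!: RFl RF_unit_fun)
  qed
  then obtain K3 where K3: "finite K3" "\<And>\<kappa> e. \<kappa> \<in> K3 \<Longrightarrow> (\<lambda>p. \<kappa> p e) \<in> RF V"
    "\<And>p. generic V p \<Longrightarrow> {x \<in> supp_in V. \<forall>\<alpha>\<in>R. (\<Sum>j\<in>V. \<alpha> p j * x j) = 0} = fs.span ((\<lambda>\<kappa>. \<kappa> p) ` K3)"
    by blast
  have N1: "NS V p F1 \<inter> supp_in V = fs.span ((\<lambda>\<kappa>. \<kappa> p) ` K3)" if "generic V p" for p
  proof -
    have "(\<forall>\<kappa>\<in>K1. lap V (\<kappa> p) z = 0) \<longleftrightarrow> (\<forall>\<alpha>\<in>R. (\<Sum>j\<in>V. \<alpha> p j * z j) = 0)"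
      if z: "z \<in> supp_in V" for z
    proof -
      have "(\<forall>\<alpha>\<in>R. (\<Sum>j\<in>V. \<alpha> p j * z j) = 0) \<longleftrightarrow> (\<forall>\<kappa>\<in>K1. \<forall>x\<in>V. lap V (\<kappa> p) z x = 0)"
        using lap_expand[OF V z] by (auto simp: R_def \<alpha>_def)
      also have "\<dots> \<longleftrightarrow> (\<forall>\<kappa>\<in>K1. lap V (\<kappa> p) z = 0)"
        by (auto simp: fun_eq_iff lap_def)
      finally show ?thesis by blast
    qed
    then show ?thesis
      unfolding K3(3)[OF that, symmetric] NS_span[OF K1(3)[OF that]] by auto
  qed
  have key: "lap V (\<kappa> q) (\<zeta> q) = 0" if "\<zeta> \<in> K3" "\<kappa> \<in> K2" for \<zeta> \<kappa>
  proof
    fix x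
    have "\<zeta> p \<in> fs.span ((\<lambda>\<kappa>. \<kappa> p) ` K3)" by (rule fs.span_base) (use that(1) in simp)
    then have "\<zeta> p \<in> NS V p F1" using N1[OF gen(1)] by auto
    then have "lap V (\<kappa> p) (\<zeta> p) x = 0"
      using sub that(2) NS_span[OF K2(3)[OF gen(1)]] by auto
    then show "lap V (\<kappa> q) (\<zeta> q) x = 0 x"
      using generic_RF_zero[OF RFl[OF K2(2)[OF that(2)] K3(2)[OF that(1)]] gen(1) _ gen(2)] by simp
  qed
  show ?thesis
  proof
    fix z assume z: "z \<in> NS V q F1"
    \<comment> \<open>Values outside \<open>V\<close> do not affect \<open>lap\<close>; cutting them
      off moves \<open>z\<close> into the finite-dimensional space spanned by
      \<open>K3\<close>.\<close>
    define z' where "z' v = (if v \<in> V then z v else 0)" for v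
    have lz: "lap V \<omega> z' = lap V \<omega> z" for \<omega> by (rule lap_cong) (simp add: z'_def)
    have "z' \<in> NS V q F1 \<inter> supp_in V" using z by (auto simp: NS_def lz supp_in_def z'_def)
    then have z'3: "z' \<in> fs.span ((\<lambda>\<kappa>. \<kappa> q) ` K3)" using N1[OF gen(2)] by simp
    have "lap V (\<kappa> q) z' = 0" if "\<kappa> \<in> K2" for \<kappa>
    proof -
      have "fs.span ((\<lambda>\<kappa>. \<kappa> q) ` K3) \<subseteq> {z. lap V (\<kappa> q) z = 0}"
      proof (rule fs.span_minimal)
        show "fs.subspace {z. lap V (\<kappa> q) z = 0}"
          unfolding fs.subspace_def by (auto simp: lap_add lap_scale fun_eq_iff)
      qed (use key that in auto)
      then show ?thesis using z'3 by blast
    qed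
    then show "z \<in> NS V q F2" using NS_span[OF K2(3)[OF gen(2)]] by (auto simp: lz)
  qed
qed

section \<open>Stresses as weighted Laplacians\<close>

text \<open>Twice the signed area of the triangle \<open>abc\<close>. As a function of one of its
  points it is affine and vanishes on the line through the other two.\<close>

definition tri :: "('a \<Rightarrow> real^2) \<Rightarrow> 'a \<Rightarrow> 'a \<Rightarrow> 'a \<Rightarrow> real" where
  "tri p a b c = (p b $ 1 - p a $ 1) * (p c $ 2 - p a $ 2) - (p b $ 2 - p a $ 2) * (p c $ 1 - p a $ 1)"

lemma Pol_tri: "a \<in> V \<Longrightarrow> b \<in> V \<Longrightarrow> c \<in> V \<Longrightarrow> (\<lambda>p. tri p a b c) \<in> Pol V"
  unfolding tri_def by (intro Pol_diff Pol_mult Pol_coord)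

lemma tri_generic:
  assumes "generic V p" "a \<in> V" "b \<in> V" "c \<in> V" "a \<noteq> b" "a \<noteq> c" "b \<noteq> c"
  shows "tri p a b c \<noteq> 0"
proof
  assume "tri p a b c = 0"
  then have "tri (\<lambda>v. if v = a then vector [0, 0] else if v = b then vector [1, 0] else vector [0, 1]) a b c = 0"
    using generic_Pol_zero[OF Pol_tri[OF assms(2-4)] assms(1)] by blast
  then show False using assms by (simp add: tri_def)
qed

lemma coord_generic:
  assumes "generic V p" "a \<in> V" "b \<in> V" "a \<noteq> b"
  shows "p a $ i \<noteq> p b $ i"
proof
  assume "p a $ i = p b $ i"
  moreover have "(\<lambda>p. p a $ i - p b $ i) \<in> Pol V" using assms by (intro Pol_diff Pol_coord)
  ultimately have "(\<lambda>v. if v = a then 1 else 0 :: real^2) a $ i - (\<lambda>v. if v = a then 1 else 0 :: real^2) b $ i = 0"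
    using generic_Pol_zero[of "\<lambda>p. p a $ i - p b $ i" V p "\<lambda>v. if v = a then 1 else 0"] assms(1) by simp
  then show False using assms(4) by simp
qed

lemma St_subspace: "fs.subspace (St V p F)"
  unfolding fs.subspace_def St_def using subspace_supp_in[of F]
  by (auto simp: fs.subspace_def lap_add_left lap_scale_left fun_eq_iff)

lemma St_mono: "F \<subseteq> G \<Longrightarrow> St V p F \<subseteq> St V p G"
  by (auto simp: St_def supp_in_def)

lemma St_restrict: "\<omega> \<in> St V p G \<Longrightarrow> (\<And>e. \<omega> e \<noteq> 0 \<Longrightarrow> e \<in> F) \<Longrightarrow> \<omega> \<in> St V p F"
  by (auto simp: St_def supp_in_def)

lemma St_supp: "\<omega> \<in> St V p F \<Longrightarrow> \<omega> e \<noteq> 0 \<Longrightarrow> e \<in> F"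
  by (auto simp: St_def supp_in_def)

lemma St_supp_in: "St V p F \<subseteq> supp_in F"
  by (auto simp: St_def)

definition ip :: "'a set \<Rightarrow> ('a \<Rightarrow> real) \<Rightarrow> ('a \<Rightarrow> real) \<Rightarrow> real" where
  "ip V f g = (\<Sum>v\<in>V. f v * g v)"

lemma ip_lap: "ip V (lap V \<omega> z) w = ip V z (lap V \<omega> w)"
proof -
  have "ip V (lap V \<omega> z) w
      = (\<Sum>x\<in>V. \<Sum>y\<in>V. \<omega> {x, y} * z x * w x) - (\<Sum>x\<in>V. \<Sum>y\<in>V. \<omega> {x, y} * z y * w x)"
    by (simp add: ip_def lap_def sum_distrib_right right_diff_distrib left_diff_distrib sum_subtractf)
  also have "(\<Sum>x\<in>V. \<Sum>y\<in>V. \<omega> {x, y} * z y * w x) = (\<Sum>x\<in>V. \<Sum>y\<in>V. \<omega> {x, y} * z x * w y)"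
    by (subst sum.swap) (simp add: insert_commute)
  also have "(\<Sum>x\<in>V. \<Sum>y\<in>V. \<omega> {x, y} * z x * w x) - (\<Sum>x\<in>V. \<Sum>y\<in>V. \<omega> {x, y} * z x * w y)
      = ip V z (lap V \<omega> w)"
    by (simp add: ip_def lap_def sum_distrib_left right_diff_distrib left_diff_distrib sum_subtractf mult_ac)
  finally show ?thesis .
qed

lemma ip_commute: "ip V f g = ip V g f"
  by (simp add: ip_def mult.commute)

lemma ip_add: "ip V (f + g) h = ip V f h + ip V g h"
  by (simp add: ip_def distrib_right sum.distrib)

lemma ip_scale: "ip V (\<lambda>v. c * f v) h = c * ip V f h"
  by (simp add: ip_def sum_distrib_left mult.assoc)

lemma ip_0 [simp]: "ip V 0 h = 0" "ip V f 0 = 0"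
  by (simp_all add: ip_def)

lemma ip_self_eq_0:
  assumes "finite V" "f \<in> supp_in V" "ip V f f = 0" shows "f = 0"
proof
  fix v
  have "\<forall>v\<in>V. f v * f v = 0"
    using assms(1,3) unfolding ip_def by (subst (asm) sum_nonneg_eq_0_iff) auto
  then show "f v = 0 v" using assms(2) by (cases "v \<in> V") (auto simp: supp_in_def)
qed

lemma lap_unit:
  assumes "finite V" "x \<in> V" "y \<in> V" "x \<noteq> y"
  shows "lap V \<omega> (unit_fun x) y = - \<omega> {x, y}"
proof -
  have "lap V \<omega> (unit_fun x) y = (\<Sum>u\<in>V. if u = x then - \<omega> {x, y} else 0)"
    unfolding lap_def using assms(3,4) by (auto simp: unit_fun_def insert_commute[of y] intro!: sum.cong)
  then show ?thesis using assms by simp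
qed

lemma lap_supp_in: "lap V \<omega> z \<in> supp_in V"
  by (auto simp: lap_def supp_in_def)

definition star :: "'a set set \<Rightarrow> 'a \<Rightarrow> 'a set set" where
  "star F x = {e \<in> F. x \<in> e}"

lemma KE_E:
  assumes "e \<in> KE V"
  obtains x y where "e = {x, y}" "x \<noteq> y" "x \<in> V" "y \<in> V"
  using assms by (auto simp: KE_def card_2_iff)

lemma KE_other:
  assumes "e \<in> KE V" "v \<in> e"
  obtains y where "e = {v, y}" "v \<noteq> y" "y \<in> V"
  using assms by (elim KE_E) (auto simp: insert_commute)

lemma pair_KE: "x \<in> V \<Longrightarrow> y \<in> V \<Longrightarrow> x \<noteq> y \<Longrightarrow> {x, y} \<in> KE V"
  by (simp add: KE_def)

lemma star_bij:
  assumes "F \<subseteq> KE V"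
  shows "bij_betw (\<lambda>y. {v, y}) {y \<in> V - {v}. {v, y} \<in> F} (star F v)"
  unfolding bij_betw_def
proof
  show "inj_on (\<lambda>y. {v, y}) {y \<in> V - {v}. {v, y} \<in> F}"
    by (rule inj_onI) (auto simp: doubleton_eq_iff)
  show "(\<lambda>y. {v, y}) ` {y \<in> V - {v}. {v, y} \<in> F} = star F v"
  proof
    show "star F v \<subseteq> (\<lambda>y. {v, y}) ` {y \<in> V - {v}. {v, y} \<in> F}"
    proof
      fix e assume e: "e \<in> star F v"
      then have "e \<in> KE V" "v \<in> e" using assms by (auto simp: star_def)
      then obtain y where "e = {v, y}" "v \<noteq> y" "y \<in> V" by (rule KE_other)
      then show "e \<in> (\<lambda>y. {v, y}) ` {y \<in> V - {v}. {v, y} \<in> F}" using e by (auto simp: star_def)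
    qed
  qed (auto simp: star_def)
qed

lemma handshake:
  assumes "finite W" "F \<subseteq> KE V" "finite F" "\<Union>F \<subseteq> W"
  shows "(\<Sum>x\<in>W. card (star F x)) = 2 * card F"
proof -
  have "(\<Sum>x\<in>W. card (star F x)) = (\<Sum>x\<in>W. \<Sum>e\<in>F. if x \<in> e then 1 else 0)"
  proof (rule sum.cong[OF refl])
    fix x show "card (star F x) = (\<Sum>e\<in>F. if x \<in> e then 1 else 0)"
      unfolding star_def using assms(3) by (simp add: sum.If_cases Int_def)
  qed
  also have "\<dots> = (\<Sum>e\<in>F. \<Sum>x\<in>W. if x \<in> e then 1 else 0)" by (rule sum.swap)
  also have "\<dots> = (\<Sum>e\<in>F. 2)"
  proof (rule sum.cong[OF refl])
    fix e assume "e \<in> F"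
    then have "W \<inter> {x. x \<in> e} = e" "card e = 2" using assms by (auto simp: KE_def)
    then show "(\<Sum>x\<in>W. if x \<in> e then 1 else 0) = (2::nat)" using assms(1) by (simp add: sum.If_cases)
  qed
  finally show ?thesis by simp
qed

lemma finite_Union_KE: "finite V \<Longrightarrow> F \<subseteq> KE V \<Longrightarrow> finite (\<Union>F) \<and> \<Union>F \<subseteq> V"
  by (auto simp: KE_def intro: finite_subset[of _ V])

section \<open>Affine dependences and the dimension of the stress space\<close>

locale framework =
  fixes V :: "'a set" and p :: "'a \<Rightarrow> real^2"
  assumes finV: "finite V" and gen: "generic V p" and card3: "3 \<le> card V"
begin

abbreviation X where "X v \<equiv> p v $ 1"
abbreviation Y where "Y v \<equiv> p v $ 2"
abbreviation S where "S F \<equiv> St V p F"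
abbreviation L where "L \<omega> z \<equiv> lap V \<omega> z"

definition s :: "'a set set \<Rightarrow> nat" where "s F = fs.dim (S F)"

lemma finKE: "F \<subseteq> KE V \<Longrightarrow> finite F"
  using finite_KE[OF finV] finite_subset by blast

lemma S_lap:
  assumes "\<omega> \<in> S F" shows "L \<omega> X = 0" "L \<omega> Y = 0" "L \<omega> (\<lambda>v. 1) = 0"
  using assms by (auto simp: St_def lap_def fun_eq_iff)

lemma S_I:
  assumes "\<omega> \<in> supp_in F" "L \<omega> X = 0" "L \<omega> Y = 0" shows "\<omega> \<in> S F"
  using assms by (auto simp: St_def forall_2)

text \<open>The affine dependences of the points \<open>p v\<close>. They contain the columns of all
  stress matrices.\<close>

definition affperp :: "('a \<Rightarrow> real) set" where
  "affperp = {l \<in> supp_in V. ip V l (\<lambda>v. 1) = 0 \<and> ip V l X = 0 \<and> ip V l Y = 0}"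

lemma lap_affperp: "\<omega> \<in> S F \<Longrightarrow> L \<omega> z \<in> affperp"
  using S_lap[of \<omega> F] by (simp add: affperp_def lap_supp_in ip_lap)

lemma affperp_tri:
  assumes "l \<in> affperp" shows "(\<Sum>v\<in>V. l v * tri p v b c) = 0"
proof -
  have "l v * tri p v b c = l v * 1 * (X b * Y c - Y b * X c) - l v * X v * (Y c - Y b) + l v * Y v * (X c - X b)" for v
    by (simp add: tri_def algebra_simps)
  then have "(\<Sum>v\<in>V. l v * tri p v b c)
      = ip V l (\<lambda>v. 1) * (X b * Y c - Y b * X c) - ip V l X * (Y c - Y b) + ip V l Y * (X c - X b)"
    by (simp add: ip_def sum.distrib sum_subtractf sum_distrib_right)
  then show ?thesis using assms by (simp add: affperp_def)
qed

text \<open>Three generic points are not collinear. If at most two points \<open>b\<close>,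
  \<open>c\<close> besides \<open>x\<close> carried weight, pairing \<open>l\<close> with the affine
  function \<open>tri p v b c\<close> of \<open>v\<close> would leave only the term at
  \<open>x\<close>.\<close>

lemma affperp_support:
  assumes "l \<in> affperp" "l \<noteq> 0"
  shows "4 \<le> card {v \<in> V. l v \<noteq> 0}"
proof (rule ccontr)
  let ?T = "{v \<in> V. l v \<noteq> 0}"
  assume "\<not> 4 \<le> card ?T"
  have "\<exists>x\<in>V. l x \<noteq> 0" using assms by (auto simp: affperp_def supp_in_def fun_eq_iff)
  then obtain x where x: "x \<in> V" "l x \<noteq> 0" by blast
  have c2: "card (?T - {x}) \<le> 2" using \<open>\<not> 4 \<le> card ?T\<close> x finV by (simp add: card_Diff_singleton_if)
  moreover have "?T - {x} \<subseteq> V - {x}" "2 \<le> card (V - {x})" using x finV card3 by (auto simp: card_Diff_singleton_if)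
  ultimately obtain U where U: "?T - {x} \<subseteq> U" "U \<subseteq> V - {x}" "card U = 2"
    using exists_subset_between[of "?T - {x}" 2 "V - {x}"] finV by auto
  then obtain b c where bc: "U = {b, c}" "b \<noteq> c" by (auto simp: card_2_iff)
  have "(\<Sum>v\<in>V. l v * tri p v b c) = (\<Sum>v\<in>V. if v = x then l x * tri p x b c else 0)"
  proof (rule sum.cong[OF refl])
    fix v assume "v \<in> V"
    then show "l v * tri p v b c = (if v = x then l x * tri p x b c else 0)"
      using U bc by (cases "v \<in> U") (auto simp: tri_def)
  qed
  then have "l x * tri p x b c = 0" using affperp_tri[OF assms(1), of b c] x finV by simp
  moreover have "tri p x b c \<noteq> 0" by (rule tri_generic[OF gen]) (use x U bc in auto)
  ultimately show False using x by simp
qed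

text \<open>The column of the stress matrix at \<open>x\<close> is a nonzero affine dependence, so
  it has four nonzero entries, and these lie at \<open>x\<close> and at neighbours along edges
  carrying \<omega>.\<close>

lemma stress_degree:
  assumes F: "F \<subseteq> KE V" and \<omega>: "\<omega> \<in> S F" and e: "e \<in> F" "\<omega> e \<noteq> 0" "x \<in> e"
  shows "3 \<le> card {f \<in> star F x. \<omega> f \<noteq> 0}"
proof -
  obtain y where y: "e = {x, y}" "x \<noteq> y" "y \<in> V" using KE_other[of e V x] e F by blast
  have x: "x \<in> V" using e F by (auto simp: KE_def)
  let ?r = "L \<omega> (unit_fun x)"
  have "?r y \<noteq> 0" using lap_unit[OF finV x y(3) y(2)] e y by simp
  then have "4 \<le> card {v \<in> V. ?r v \<noteq> 0}" using affperp_support[OF lap_affperp[OF \<omega>]] by force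
  moreover have "{v \<in> V. ?r v \<noteq> 0} \<subseteq> insert x {u \<in> V - {x}. \<omega> {x, u} \<noteq> 0}"
    using lap_unit[OF finV x] by auto
  then have "card {v \<in> V. ?r v \<noteq> 0} \<le> card (insert x {u \<in> V - {x}. \<omega> {x, u} \<noteq> 0})"
    by (rule card_mono[rotated]) (use finV in auto)
  moreover have "card (insert x {u \<in> V - {x}. \<omega> {x, u} \<noteq> 0}) \<le> card {u \<in> V - {x}. \<omega> {x, u} \<noteq> 0} + 1"
    by (simp add: card_insert_le_m1 card_insert_if finV)
  moreover have "card {u \<in> V - {x}. \<omega> {x, u} \<noteq> 0} \<le> card {f \<in> star F x. \<omega> f \<noteq> 0}"
  proof (rule card_inj_on_le)
    show "inj_on (\<lambda>u. {x, u}) {u \<in> V - {x}. \<omega> {x, u} \<noteq> 0}"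
      by (rule inj_onI) (auto simp: doubleton_eq_iff)
    show "(\<lambda>u. {x, u}) ` {u \<in> V - {x}. \<omega> {x, u} \<noteq> 0} \<subseteq> {f \<in> star F x. \<omega> f \<noteq> 0}"
      using St_supp[OF \<omega>] by (auto simp: star_def)
    show "finite {f \<in> star F x. \<omega> f \<noteq> 0}" using finKE[OF F] by (simp add: star_def)
  qed
  ultimately show ?thesis by linarith
qed

lemma s_insert_dep:
  assumes "F \<subseteq> KE V" "e \<notin> F" "e \<in> KE V" "\<omega> \<in> S (insert e F)" "\<omega> e \<noteq> 0"
  shows "s (insert e F) = s F + 1"
proof -
  have "{\<omega> \<in> S (insert e F). \<omega> e = 0} = S F"
    using assms(2) by (auto simp: St_def supp_in_def)
  moreover have "fs.dim (S (insert e F)) = fs.dim {\<omega> \<in> S (insert e F). \<omega> e = 0} + 1"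
    by (rule dim_functional[of "insert e F" "S (insert e F)" "\<lambda>\<omega>. \<omega> e" \<omega>, OF _ St_supp_in St_subspace])
      (use assms finKE in auto)
  ultimately show ?thesis by (simp add: s_def)
qed

lemma S_insert_indep:
  assumes "e \<notin> F" "\<And>\<omega>. \<omega> \<in> S (insert e F) \<Longrightarrow> \<omega> e = 0"
  shows "S (insert e F) = S F"
proof
  show "S (insert e F) \<subseteq> S F"
  proof
    fix \<omega> assume "\<omega> \<in> S (insert e F)"
    then have "\<omega> e' \<noteq> 0 \<Longrightarrow> e' \<in> F" for e' using assms(2)[of \<omega>] St_supp[of \<omega> V p "insert e F" e'] by blast
    then show "\<omega> \<in> S F" using \<open>\<omega> \<in> S (insert e F)\<close> by (rule St_restrict[rotated])
  qed
qed (rule St_mono, auto)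

lemma s_insert_le:
  assumes "F \<subseteq> KE V" "e \<in> KE V"
  shows "s F \<le> s (insert e F) \<and> s (insert e F) \<le> s F + 1"
proof (cases "e \<in> F")
  case True
  then show ?thesis by (simp add: insert_absorb)
next
  case False
  show ?thesis
  proof (cases "\<exists>\<omega>\<in>S (insert e F). \<omega> e \<noteq> 0")
    case True
    then show ?thesis using s_insert_dep[OF assms(1) False assms(2)] by auto
  next
    case 2: False
    then have "S (insert e F) = S F" using S_insert_indep[OF False] by blast
    then show ?thesis by (simp add: s_def)
  qed
qed

lemma s_mono:
  assumes "F \<subseteq> G" "G \<subseteq> KE V"
  shows "s F \<le> s G \<and> s G \<le> s F + card (G - F)"
proof -
  have "s F \<le> s (F \<union> T) \<and> s (F \<union> T) \<le> s F + card T" if "finite T" "T \<subseteq> G" for T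
    using that
  proof (induction T rule: finite_induct)
    case empty
    then show ?case by simp
  next
    case (insert e T)
    have "F \<union> T \<subseteq> KE V" "e \<in> KE V" using assms insert.prems by auto
    then have "s (F \<union> T) \<le> s (insert e (F \<union> T)) \<and> s (insert e (F \<union> T)) \<le> s (F \<union> T) + 1"
      by (rule s_insert_le)
    then show ?case using insert by simp
  qed
  from this[of "G - F"] show ?thesis using finKE[OF assms(2)] assms(1) by (simp add: Un_absorb1)
qed

lemma s_0_iff: "F \<subseteq> KE V \<Longrightarrow> s F = 0 \<longleftrightarrow> S F \<subseteq> {0}"
proof
  assume F: "F \<subseteq> KE V" and 0: "s F = 0"
  have z: "0 \<in> S F" using fs.subspace_0[OF St_subspace] .
  show "S F \<subseteq> {0}"
  proof (rule ccontr)
    assume "\<not> S F \<subseteq> {0}"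
    then have "fs.dim ({0} :: ('a set \<Rightarrow> real) set) < fs.dim (S F)"
      using z by (intro dim_less_supp[OF finKE[OF F] St_supp_in]) (auto simp: fs.subspace_single_0)
    then show False using 0 by (simp add: s_def)
  qed
next
  assume "S F \<subseteq> {0}"
  then have "fs.dim (S F) \<le> card ({} :: ('a set \<Rightarrow> real) set)"
    by (intro fs.dim_le_card) auto
  then show "s F = 0" by (simp add: s_def)
qed

text \<open>Each further edge carries a stress together with \<open>B\<close> alone, so adding the
  edges of \<open>F - B\<close> one at a time raises the stress dimension by one each time.\<close>

lemma max_indep:
  assumes F: "F \<subseteq> KE V"
  obtains B where "B \<subseteq> F" "S B \<subseteq> {0}" "card F = card B + s F"
    "\<And>e. e \<in> F - B \<Longrightarrow> \<exists>\<omega>\<in>S (insert e B). \<omega> e \<noteq> 0"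
proof -
  have fin: "finite F" by (rule finKE[OF F])
  define P where "P B \<longleftrightarrow> B \<subseteq> F \<and> S B \<subseteq> {0}" for B
  have "P {}" by (auto simp: P_def St_def supp_in_def fun_eq_iff)
  moreover have "\<forall>B. P B \<longrightarrow> card B < card F + 1"
    using card_mono[OF fin] by (auto simp: P_def less_Suc_eq_le)
  ultimately obtain B where B: "P B" "\<And>B'. P B' \<Longrightarrow> card B' \<le> card B"
    using ex_has_greatest_nat_lemma[of P "{}" card] ex_has_greatest_nat[of P "{}" card "card F + 1"] by blast
  have dep: "\<exists>\<omega>\<in>S (insert e B). \<omega> e \<noteq> 0" if e: "e \<in> F - B" for e
  proof (rule ccontr)
    assume "\<not> ?thesis"
    then have "S (insert e B) = S B" using e S_insert_indep by blast
    then have "P (insert e B)" using B(1) e by (auto simp: P_def)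
    then have "card (insert e B) \<le> card B" by (rule B(2))
    moreover have "finite B" using B(1) fin finite_subset by (auto simp: P_def)
    ultimately show False using e by simp
  qed
  have BF: "B \<subseteq> F" "S B \<subseteq> {0}" using B(1) by (auto simp: P_def)
  have "s (B \<union> T) = card T" if "finite T" "T \<subseteq> F - B" for T
    using that
  proof (induction T rule: finite_induct)
    case empty
    then show ?case using s_0_iff BF F by simp
  next
    case (insert e T)
    obtain \<omega> where \<omega>: "\<omega> \<in> S (insert e B)" "\<omega> e \<noteq> 0" using dep insert.prems by blast
    then have "\<omega> \<in> S (insert e (B \<union> T))" using St_mono[of "insert e B" "insert e (B \<union> T)"] by blast
    then have "s (insert e (B \<union> T)) = s (B \<union> T) + 1"
      by (intro s_insert_dep[of _ _ \<omega>]) (use \<omega> insert BF F in auto)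
    then show ?case using insert by simp
  qed
  from this[of "F - B"] have "s F = card (F - B)" using fin BF by (simp add: Un_absorb1)
  then have "card F = card B + s F" using card_Diff_subset[of B F] BF fin card_mono[OF fin BF(1)] finite_subset by fastforce
  then show ?thesis using that BF dep by blast
qed

lemma indep_card_le:
  assumes "F \<subseteq> G" "G \<subseteq> KE V" "S F \<subseteq> {0}" shows "card F + s G \<le> card G"
proof -
  have "s G \<le> card (G - F)" using s_mono[OF assms(1,2)] s_0_iff[of F] assms by auto
  moreover have "card (G - F) = card G - card F" "card F \<le> card G"
    using assms finKE card_Diff_subset card_mono finite_subset by metis+
  ultimately show ?thesis by linarith
qed

end

section \<open>Infinitesimal motions and rigidity\<close>

lemma card_ge2_obtain:
  assumes "2 \<le> card W" obtains x y where "x \<in> W" "y \<in> W" "x \<noteq> y"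
proof -
  obtain T where "T \<subseteq> W" "card T = 2" using obtain_subset_with_card_n[OF assms] by metis
  then show ?thesis using that by (auto simp: card_2_iff)
qed

context framework
begin

definition co :: "bool \<Rightarrow> 'a \<Rightarrow> real" where "co b v = (if b then X v else Y v)"

text \<open>Matrix columns and velocities are indexed by a vertex and a Boolean, \<open>True\<close>
  for the first coordinate. Rows thus become real functions with finite support, to which the linear
  algebra above applies.\<close>

definition row :: "'a set \<Rightarrow> 'a \<times> bool \<Rightarrow> real" where
  "row e = (\<lambda>(v, b). if v \<in> e then co b v - co b (the_elem (e - {v})) else 0)"

text \<open>Under the velocities \<open>m\<close>, the rate of change of half the squared distance
  between \<open>x\<close> and \<open>y\<close>.\<close>

definition strain :: "('a \<times> bool \<Rightarrow> real) \<Rightarrow> 'a \<Rightarrow> 'a \<Rightarrow> real" where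
  "strain m x y = (X x - X y) * (m (x, True) - m (y, True)) + (Y x - Y y) * (m (x, False) - m (y, False))"

lemma strain_commute: "strain m x y = strain m y x"
  by (simp add: strain_def algebra_simps)

lemma row_pair:
  assumes "x \<noteq> y"
  shows "row {x, y} (v, b) = (if v = x then co b x - co b y else if v = y then co b y - co b x else 0)"
proof -
  have "{x, y} - {x} = {y}" "{x, y} - {y} = {x}" using assms by auto
  then show ?thesis by (auto simp: row_def)
qed

lemma sum_pair_bool:
  fixes f :: "'a \<times> bool \<Rightarrow> real"
  shows "(\<Sum>i\<in>W \<times> UNIV. f i) = (\<Sum>v\<in>W. f (v, True)) + (\<Sum>v\<in>W. f (v, False))"
proof -
  have "(\<Sum>i\<in>W \<times> UNIV. f i) = (\<Sum>v\<in>W. \<Sum>b\<in>UNIV. f (v, b))" by (simp add: sum.cartesian_product)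
  then show ?thesis by (simp add: UNIV_bool sum.distrib add.commute)
qed

lemma row_strain:
  assumes "finite W" "x \<in> W" "y \<in> W" "x \<noteq> y"
  shows "(\<Sum>i\<in>W \<times> UNIV. row {x, y} i * m i) = strain m x y"
proof -
  have "(\<Sum>v\<in>W. row {x, y} (v, b) * m (v, b)) = (co b x - co b y) * (m (x, b) - m (y, b))" for b
  proof -
    have "(\<Sum>v\<in>W. row {x, y} (v, b) * m (v, b))
      = (\<Sum>v\<in>{x, y}. row {x, y} (v, b) * m (v, b))"
      by (rule sum.mono_neutral_right) (use assms in \<open>auto simp: row_pair[OF assms(4)]\<close>)
    then show ?thesis using assms by (simp add: row_pair algebra_simps)
  qed
  then show ?thesis by (simp add: sum_pair_bool co_def strain_def)
qed

lemma stress_rows: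
  assumes "\<omega> \<in> supp_in F" "F \<subseteq> KE V" "v \<in> V"
  shows "(\<Sum>e\<in>F. \<omega> e * row e (v, b)) = L \<omega> (co b) v"
proof -
  let ?N = "{y \<in> V - {v}. {v, y} \<in> F}"
  have "(\<Sum>e\<in>F. \<omega> e * row e (v, b)) = (\<Sum>e\<in>star F v. \<omega> e * row e (v, b))"
    by (rule sum.mono_neutral_right) (use finKE[OF assms(2)] in \<open>auto simp: star_def row_def\<close>)
  also have "\<dots> = (\<Sum>y\<in>?N. \<omega> {v, y} * row {v, y} (v, b))"
    by (rule sum.reindex_bij_betw[OF star_bij[OF assms(2)], symmetric])
  also have "\<dots> = (\<Sum>y\<in>?N. \<omega> {v, y} * (co b v - co b y))"
    by (rule sum.cong) (auto simp: row_pair)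
  also have "\<dots> = (\<Sum>y\<in>V. \<omega> {v, y} * (co b v - co b y))"
    by (rule sum.mono_neutral_left) (use finV assms in \<open>auto simp: supp_in_def\<close>)
  finally show ?thesis using assms(3) by (simp add: lap_def)
qed

lemma co_eq: "co True = X" "co False = Y"
  by (auto simp: co_def)

lemma row_supp: "e \<subseteq> W \<Longrightarrow> row e \<in> supp_in (W \<times> UNIV)"
  by (auto simp: row_def supp_in_def)

lemma S_iff_rows:
  assumes "\<omega> \<in> supp_in F" "F \<subseteq> KE V"
  shows "\<omega> \<in> S F \<longleftrightarrow> (\<forall>i. (\<Sum>e\<in>F. \<omega> e * row e i) = 0)"
proof
  assume \<omega>: "\<omega> \<in> S F"
  show "\<forall>i. (\<Sum>e\<in>F. \<omega> e * row e i) = 0"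
  proof
    fix i show "(\<Sum>e\<in>F. \<omega> e * row e i) = 0"
    proof (cases i)
      case (Pair v b)
      show ?thesis
      proof (cases "v \<in> V")
        case True
        then show ?thesis using stress_rows[OF assms True, of b] S_lap[OF \<omega>] Pair by (cases b) (simp_all add: co_eq)
      next
        case False
        then have "row e i = 0" if "e \<in> F" for e using that assms(2) Pair by (auto simp: row_def KE_def)
        then show ?thesis by simp
      qed
    qed
  qed
next
  assume r: "\<forall>i. (\<Sum>e\<in>F. \<omega> e * row e i) = 0"
  have "L \<omega> (co b) = 0" for b
  proof
    fix v show "L \<omega> (co b) v = 0 v"
      using stress_rows[OF assms, of v b] r by (cases "v \<in> V") (auto simp: lap_def)
  qed
  from this[of True] this[of False] show "\<omega> \<in> S F" using assms(1) by (intro S_I) (simp_all add: co_eq)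
qed

definition est :: "('a \<times> bool \<Rightarrow> real) \<Rightarrow> 'a set \<Rightarrow> real" where
  "est m e = (\<Sum>i\<in>V \<times> UNIV. row e i * m i)"

lemma est_pair: "x \<in> V \<Longrightarrow> y \<in> V \<Longrightarrow> x \<noteq> y \<Longrightarrow> est m {x, y} = strain m x y"
  unfolding est_def by (rule row_strain[OF finV])

lemma virtual_work:
  assumes "\<omega> \<in> S F" "F \<subseteq> KE V"
  shows "(\<Sum>e\<in>F. \<omega> e * est m e) = 0"
proof -
  have "(\<Sum>e\<in>F. \<omega> e * est m e) = (\<Sum>i\<in>V \<times> UNIV. (\<Sum>e\<in>F. \<omega> e * row e i) * m i)"
    unfolding est_def sum_distrib_left sum_distrib_right
    by (subst sum.swap) (simp add: mult.assoc)
  moreover have "\<omega> \<in> supp_in F" using assms(1) St_supp_in by blast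
  then have "\<forall>i. (\<Sum>e\<in>F. \<omega> e * row e i) = 0" using S_iff_rows[OF _ assms(2)] assms(1) by blast
  ultimately show ?thesis by (simp only: mult_zero_left sum.neutral_const)
qed

text \<open>The systems of forces on \<open>W\<close> in equilibrium: the orthogonal complement of
  two translations and a rotation.\<close>

definition perp3 :: "'a set \<Rightarrow> ('a \<times> bool \<Rightarrow> real) set" where
  "perp3 W = {l \<in> supp_in (W \<times> UNIV). (\<Sum>v\<in>W. l (v, True)) = 0 \<and> (\<Sum>v\<in>W. l (v, False)) = 0
      \<and> (\<Sum>v\<in>W. X v * l (v, False) - Y v * l (v, True)) = 0}"

lemma row_perp3:
  assumes "W \<subseteq> V" "e \<in> KE V" "e \<subseteq> W" shows "row e \<in> perp3 W"
proof -
  obtain x y where e: "e = {x, y}" "x \<noteq> y" using assms by (auto simp: KE_def card_2_iff)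
  have xy: "x \<in> W" "y \<in> W" using e assms by auto
  have fW: "finite W" using assms(1) finV finite_subset by blast
  have red: "(\<Sum>v\<in>W. f v) = f x + f y" if "\<And>v. v \<noteq> x \<Longrightarrow> v \<noteq> y \<Longrightarrow> f v = 0" for f :: "'a \<Rightarrow> real"
  proof -
    have "(\<Sum>v\<in>W. f v) = (\<Sum>v\<in>{x, y}. f v)"
      by (rule sum.mono_neutral_right) (use that xy fW in auto)
    then show ?thesis using e by simp
  qed
  have "(\<Sum>v\<in>W. row e (v, b)) = 0" for b
    by (subst red) (auto simp: e row_pair)
  moreover have "(\<Sum>v\<in>W. X v * row e (v, False) - Y v * row e (v, True)) = 0"
    using e by (subst red) (auto simp: row_pair co_def algebra_simps)
  ultimately show ?thesis using row_supp[OF assms(3)] by (simp add: perp3_def)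
qed

lemma dim_perp3:
  assumes W: "W \<subseteq> V" "2 \<le> card W"
  shows "fs.dim (perp3 W) + 3 = 2 * card W"
proof -
  have fW: "finite W" using assms(1) finV finite_subset by blast
  then have fI: "finite (W \<times> (UNIV :: bool set))" by simp
  obtain x y where xy: "x \<in> W" "y \<in> W" "x \<noteq> y"
    by (rule card_ge2_obtain[OF W(2)])
  define t1 where "t1 l = (\<Sum>v\<in>W. l (v, True))" for l :: "'a \<times> bool \<Rightarrow> real"
  define t2 where "t2 l = (\<Sum>v\<in>W. l (v, False))" for l :: "'a \<times> bool \<Rightarrow> real"
  define t3 where "t3 l = (\<Sum>v\<in>W. X v * l (v, False) - Y v * l (v, True))" for l
  define A0 where "A0 = (supp_in (W \<times> UNIV) :: ('a \<times> bool \<Rightarrow> real) set)"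
  define A1 where "A1 = {l \<in> A0. t1 l = 0}"
  define A2 where "A2 = {l \<in> A1. t2 l = 0}"
  have t1: "t1 (x + y) = t1 x + t1 y" "t1 (\<lambda>i. c * x i) = c * t1 x" for x y c
    by (simp_all add: t1_def sum.distrib sum_distrib_left)
  have t2: "t2 (x + y) = t2 x + t2 y" "t2 (\<lambda>i. c * x i) = c * t2 x" for x y c
    by (simp_all add: t2_def sum.distrib sum_distrib_left)
  have t3: "t3 (x + y) = t3 x + t3 y" "t3 (\<lambda>i. c * x i) = c * t3 x" for x y c
    by (simp_all add: t3_def sum.distrib[symmetric] sum_distrib_left algebra_simps)
  have z: "t1 0 = 0" "t2 0 = 0" by (simp_all add: t1_def t2_def)
  have s0: "fs.subspace A0" unfolding A0_def by (rule subspace_supp_in)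
  have s1: "fs.subspace A1"
    unfolding A1_def using s0 t1(2) by (auto simp: fs.subspace_def t1(1) z)
  have s2: "fs.subspace A2"
    unfolding A2_def using s1 t2(2) by (auto simp: fs.subspace_def t2(1) z)
  have sub: "A0 \<subseteq> supp_in (W \<times> UNIV)" "A1 \<subseteq> supp_in (W \<times> UNIV)" "A2 \<subseteq> supp_in (W \<times> UNIV)"
    by (auto simp: A0_def A1_def A2_def)
  have "fs.dim A0 = fs.dim A1 + 1"
    unfolding A1_def
    by (rule dim_functional[of "W \<times> UNIV" A0 t1 "unit_fun (x, True)", OF fI sub(1) s0 t1])
      (use xy fW in \<open>auto simp: A0_def supp_in_def unit_fun_def t1_def\<close>)
  moreover have "fs.dim A1 = fs.dim A2 + 1"
    unfolding A2_def
    by (rule dim_functional[of "W \<times> UNIV" A1 t2 "unit_fun (x, False)", OF fI sub(2) s1 t2])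
      (use xy fW in \<open>auto simp: A1_def A0_def supp_in_def unit_fun_def t1_def t2_def\<close>)
  moreover have "fs.dim A2 = fs.dim {l \<in> A2. t3 l = 0} + 1"
  proof (rule dim_functional[of "W \<times> UNIV" A2 t3, OF fI sub(3) s2 t3])
    \<comment> \<open>Opposite unit forces at \<open>x\<close> and \<open>y\<close> along the first
      axis; their torque is a difference of second coordinates, nonzero by genericity.\<close>
    define l where "l i = unit_fun (x, True) i - unit_fun (y, True) i" for i
    have ll: "l (v, b) = (if b then (if v = x then 1 else 0) - (if v = y then 1 else 0) else 0)" for v b
      by (auto simp: l_def unit_fun_def)
    show "l \<in> A2"
      using xy fW by (auto simp: A2_def A1_def A0_def supp_in_def t1_def t2_def ll sum_subtractf)
    have "t3 l = (\<Sum>v\<in>W. (if v = y then Y y else 0) - (if v = x then Y x else 0))"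
      unfolding t3_def by (rule sum.cong) (auto simp: ll)
    also have "\<dots> = Y y - Y x" using xy fW by (simp add: sum_subtractf)
    also have "\<dots> \<noteq> 0" using coord_generic[OF gen, of x y 2] xy subsetD[OF W(1)] by auto
    finally show "t3 l \<noteq> 0" .
  qed
  moreover have "{l \<in> A2. t3 l = 0} = perp3 W"
    by (auto simp: perp3_def A2_def A1_def A0_def t1_def t2_def t3_def)
  moreover have "fs.dim A0 = 2 * card W" unfolding A0_def using dim_supp_in[OF fI] by (simp add: card_cartesian_product)
  ultimately show ?thesis by simp
qed

text \<open>The rows of edges inside \<open>W\<close> lie in \<open>perp3 W\<close>, which has
  dimension \<open>2 * card W - 3\<close>.\<close>

lemma indep_bound:
  assumes "F \<subseteq> KE V" "\<Union>F \<subseteq> W" "W \<subseteq> V" "2 \<le> card W" "S F \<subseteq> {0}"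
  shows "card F + 3 \<le> 2 * card W"
proof (rule ccontr)
  assume "\<not> ?thesis"
  then have lt: "fs.dim (perp3 W) < card F" using dim_perp3[OF assms(3,4)] by simp
  have fW: "finite (W \<times> (UNIV :: bool set))" using finite_subset[OF assms(3) finV] by simp
  have sub: "perp3 W \<subseteq> supp_in (W \<times> UNIV)" by (auto simp: perp3_def)
  have rp: "row e \<in> perp3 W" if "e \<in> F" for e
    by (rule row_perp3[OF assms(3)]) (use assms that in auto)
  obtain c where c: "\<exists>e\<in>F. c e \<noteq> 0" "(\<Sum>e\<in>F. (\<lambda>i. c e * row e i)) = 0"
    by (rule dependent_family[OF fW sub finKE[OF assms(1)] rp lt])
  define \<omega> where "\<omega> e = (if e \<in> F then c e else 0)" for e
  have "(\<Sum>e\<in>F. \<omega> e * row e i) = 0" for i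
  proof -
    have "(\<Sum>e\<in>F. \<omega> e * row e i) = (\<Sum>e\<in>F. (\<lambda>i. c e * row e i)) i"
      by (simp add: sum_fun_apply \<omega>_def)
    then show ?thesis using c(2) by simp
  qed
  then have "\<omega> \<in> S F" using S_iff_rows[of \<omega> F] assms(1) by (auto simp: supp_in_def \<omega>_def)
  then have "\<omega> = 0" using assms(5) by auto
  then show False using c(1) by (auto simp: \<omega>_def fun_eq_iff split: if_splits)
qed

text \<open>The infinitesimal isometries of the plane.\<close>

definition tm :: "real \<Rightarrow> real \<Rightarrow> real \<Rightarrow> 'a \<times> bool \<Rightarrow> real" where
  "tm \<alpha> \<beta> \<gamma> = (\<lambda>(v, b). if b then \<alpha> - \<gamma> * Y v else \<beta> + \<gamma> * X v)"

lemma strain_tm: "strain (\<lambda>i. m i - tm \<alpha> \<beta> \<gamma> i) x y = strain m x y"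
  by (simp add: strain_def tm_def algebra_simps)

text \<open>The angular velocity \<gamma> is read off from the first components, since generic
  points differ in their second coordinates; zero strain then makes the second components
  fit.\<close>

lemma normalise_motion:
  assumes "a \<in> V" "b \<in> V" "a \<noteq> b" "strain m a b = 0"
  obtains \<alpha> \<beta> \<gamma> where "\<And>c. m (a, c) = tm \<alpha> \<beta> \<gamma> (a, c)" "\<And>c. m (b, c) = tm \<alpha> \<beta> \<gamma> (b, c)"
proof -
  define \<gamma> where "\<gamma> = - (m (b, True) - m (a, True)) / (Y b - Y a)"
  define \<alpha> where "\<alpha> = m (a, True) + \<gamma> * Y a"
  define \<beta> where "\<beta> = m (a, False) - \<gamma> * X a"
  have d: "Y b - Y a \<noteq> 0" using coord_generic[OF gen assms(1-3), of 2] by simp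
  have 1: "\<gamma> * (Y b - Y a) = m (a, True) - m (b, True)" using d by (simp add: \<gamma>_def)
  have "(Y b - Y a) * (m (b, False) - m (a, False)) = (X b - X a) * (\<gamma> * (Y b - Y a))"
    unfolding 1 using assms(4) by (simp add: strain_def algebra_simps)
  then have "(Y b - Y a) * (m (b, False) - m (a, False) - \<gamma> * (X b - X a)) = 0" by (simp add: algebra_simps)
  then have 2: "m (b, False) - m (a, False) = \<gamma> * (X b - X a)" using d by simp
  have "m (a, c) = tm \<alpha> \<beta> \<gamma> (a, c)" for c by (cases c) (simp_all add: tm_def \<alpha>_def \<beta>_def)
  moreover have "m (b, c) = tm \<alpha> \<beta> \<gamma> (b, c)" for c
    using 1 2 by (cases c) (simp_all add: tm_def \<alpha>_def \<beta>_def algebra_simps)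
  ultimately show ?thesis using that by blast
qed

text \<open>The velocity of \<open>c\<close> is orthogonal to the directions towards
  \<open>a\<close> and \<open>b\<close>, which are linearly independent unless \<open>c\<close> is
  one of these points.\<close>

lemma motion_zero_third:
  assumes "a \<in> V" "b \<in> V" "c \<in> V" "a \<noteq> b" "strain m a c = 0" "strain m b c = 0"
    "\<And>d. m (a, d) = 0" "\<And>d. m (b, d) = 0"
  shows "m (c, d) = 0"
proof (cases "c = a \<or> c = b")
  case True
  then show ?thesis using assms by auto
next
  case False
  then have t: "tri p a b c \<noteq> 0" using tri_generic[OF gen] assms by auto
  have e1: "(X a - X c) * m (c, True) + (Y a - Y c) * m (c, False) = 0"
    using assms(5,7) by (simp add: strain_def algebra_simps)
  have e2: "(X b - X c) * m (c, True) + (Y b - Y c) * m (c, False) = 0"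
    using assms(6,8) by (simp add: strain_def algebra_simps)
  have "tri p a b c * m (c, True) = (Y b - Y c) * ((X a - X c) * m (c, True) + (Y a - Y c) * m (c, False))
      - (Y a - Y c) * ((X b - X c) * m (c, True) + (Y b - Y c) * m (c, False))"
    by (simp add: tri_def algebra_simps)
  moreover have "tri p a b c * m (c, False) = (X a - X c) * ((X b - X c) * m (c, True) + (Y b - Y c) * m (c, False))
      - (X b - X c) * ((X a - X c) * m (c, True) + (Y a - Y c) * m (c, False))"
    by (simp add: tri_def algebra_simps)
  ultimately have "tri p a b c * m (c, True) = 0" "tri p a b c * m (c, False) = 0" using e1 e2 by simp_all
  then show ?thesis using t by (cases d) auto
qed

lemma trivial_motion:
  assumes "W \<subseteq> V" "2 \<le> card W" "\<And>x y. x \<in> W \<Longrightarrow> y \<in> W \<Longrightarrow> strain m x y = 0"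
  obtains \<alpha> \<beta> \<gamma> where "\<And>v b. v \<in> W \<Longrightarrow> m (v, b) = tm \<alpha> \<beta> \<gamma> (v, b)"
proof -
  have fW: "finite W" using assms(1) finV finite_subset by blast
  obtain x y where xy: "x \<in> W" "y \<in> W" "x \<noteq> y"
    by (rule card_ge2_obtain[OF assms(2)])
  obtain \<alpha> \<beta> \<gamma> where t: "\<And>c. m (x, c) = tm \<alpha> \<beta> \<gamma> (x, c)" "\<And>c. m (y, c) = tm \<alpha> \<beta> \<gamma> (y, c)"
    by (rule normalise_motion[of x y m]) (use xy assms in auto)
  have "m (v, b) - tm \<alpha> \<beta> \<gamma> (v, b) = 0" if "v \<in> W" for v b
    by (rule motion_zero_third[of x y v "\<lambda>i. m i - tm \<alpha> \<beta> \<gamma> i"])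
      (use xy t assms that in \<open>auto simp: strain_tm\<close>)
  then have "m (v, b) = tm \<alpha> \<beta> \<gamma> (v, b)" if "v \<in> W" for v b using that by force
  then show ?thesis using that by blast
qed

definition rigid :: "'a set set \<Rightarrow> bool" where
  "rigid F \<longleftrightarrow> (\<forall>m. (\<forall>e\<in>F. est m e = 0) \<longrightarrow> (\<forall>x\<in>\<Union>F. \<forall>y\<in>\<Union>F. strain m x y = 0))"

lemma card_Union_ge2:
  assumes "F \<subseteq> KE V" "F \<noteq> {}" shows "2 \<le> card (\<Union>F)"
proof -
  obtain e where e: "e \<in> F" using assms by blast
  then have "card e = 2" "e \<subseteq> \<Union>F" using assms by (auto simp: KE_def)
  moreover have "finite (\<Union>F)" using finite_Union_KE[OF finV assms(1)] by blast
  ultimately show ?thesis using card_mono by metis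
qed

text \<open>The rows of a maximal independent \<open>B\<close> span \<open>perp3\<close>: velocities
  killed by \<open>B\<close> are killed by all of \<open>F\<close>, hence are isometries on
  \<open>\<Union>F\<close> by rigidity, hence orthogonal to \<open>perp3\<close>. So
  \<open>B\<close> attains the bound of \<open>indep_bound\<close>.\<close>

lemma rigid_card:
  assumes F: "F \<subseteq> KE V" "F \<noteq> {}" "rigid F"
  shows "card F + 3 = 2 * card (\<Union>F) + s F"
proof -
  let ?W = "\<Union>F"
  have WV: "?W \<subseteq> V" and fW: "finite ?W" using finite_Union_KE[OF finV F(1)] by auto
  have W2: "2 \<le> card ?W" by (rule card_Union_ge2[OF F(1,2)])
  obtain B where B: "B \<subseteq> F" "S B \<subseteq> {0}" "card F = card B + s F"
    "\<And>e. e \<in> F - B \<Longrightarrow> \<exists>\<omega>\<in>S (insert e B). \<omega> e \<noteq> 0"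
    by (rule max_indep[OF F(1)]) blast
  have BK: "B \<subseteq> KE V" "finite B" using B F finKE by auto
  have "card B + 3 \<le> 2 * card ?W"
    by (rule indep_bound[OF BK(1) _ WV W2 B(2)]) (use B in auto)
  moreover have "fs.dim (perp3 ?W) \<le> card (row ` B)"
  proof (rule fs.dim_le_card)
    show "finite (row ` B)" using BK by simp
    show "perp3 ?W \<subseteq> fs.span (row ` B)"
    proof
      fix l assume l: "l \<in> perp3 ?W"
      have key: "(\<Sum>i\<in>?W \<times> UNIV. l i * m i) = 0"
        if m: "\<And>e. e \<in> B \<Longrightarrow> (\<Sum>i\<in>?W \<times> UNIV. row e i * m i) = 0" for m
      proof -
        have estW: "est m e = (\<Sum>i\<in>?W \<times> UNIV. row e i * m i)" if "e \<in> F" for e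
          unfolding est_def by (rule sum.mono_neutral_right) (use WV finV that in \<open>auto simp: row_def split: if_splits\<close>)
        have "est m e = 0" if e: "e \<in> F" for e
        proof (cases "e \<in> B")
          case True
          then show ?thesis using m estW B by auto
        next
          case False
          then obtain \<omega> where \<omega>: "\<omega> \<in> S (insert e B)" "\<omega> e \<noteq> 0" using B(4) e by blast
          have "(\<Sum>f\<in>insert e B. \<omega> f * est m f) = 0"
            by (rule virtual_work[OF \<omega>(1)]) (use e F BK in auto)
          moreover have "est m f = 0" if "f \<in> B" for f using m[OF that] estW[of f] that B by auto
          ultimately show ?thesis using False BK \<omega> by simp
        qed
        then have "\<And>x y. x \<in> ?W \<Longrightarrow> y \<in> ?W \<Longrightarrow> strain m x y = 0"
          using F(3) unfolding rigid_def by blast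
        then obtain \<alpha> \<beta> \<gamma> where t: "\<And>v b. v \<in> ?W \<Longrightarrow> m (v, b) = tm \<alpha> \<beta> \<gamma> (v, b)"
          by (rule trivial_motion[OF WV W2]) blast+
        have "(\<Sum>i\<in>?W \<times> UNIV. l i * m i)
          = (\<Sum>v\<in>?W. l (v, True) * m (v, True)) + (\<Sum>v\<in>?W. l (v, False) * m (v, False))"
          by (rule sum_pair_bool)
        also have "\<dots> = (\<Sum>v\<in>?W. l (v, True) * m (v, True) + l (v, False) * m (v, False))"
          by (simp add: sum.distrib)
        also have "\<dots> = (\<Sum>v\<in>?W. \<alpha> * l (v, True) + \<beta> * l (v, False)
            + \<gamma> * (X v * l (v, False) - Y v * l (v, True)))"
          by (rule sum.cong) (auto simp: t tm_def algebra_simps)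
        also have "\<dots> = \<alpha> * (\<Sum>v\<in>?W. l (v, True)) + \<beta> * (\<Sum>v\<in>?W. l (v, False))
            + \<gamma> * (\<Sum>v\<in>?W. X v * l (v, False) - Y v * l (v, True))"
          by (simp only: sum.distrib sum_distrib_left)
        also have "\<dots> = 0" using l by (simp add: perp3_def)
        finally show ?thesis .
      qed
      have fWU: "finite (?W \<times> (UNIV :: bool set))" using fW by simp
      have rs: "row e \<in> supp_in (?W \<times> UNIV)" if "e \<in> B" for e
        by (rule row_supp) (use that B in auto)
      have ls: "l \<in> supp_in (?W \<times> UNIV)" using l by (simp add: perp3_def)
      have "\<exists>c. \<forall>i. l i = (\<Sum>e\<in>B. c e * row e i)"
        by (rule annihilator[of "?W \<times> UNIV" B row l, OF fWU BK(2) rs ls key]) blast+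
      then obtain c where "\<And>i. l i = (\<Sum>e\<in>B. c e * row e i)" by blast
      then have "l = (\<Sum>e\<in>B. (\<lambda>i. c e * row e i))" by (auto simp: sum_fun_apply)
      also have "\<dots> \<in> fs.span (row ` B)"
        by (rule fs.span_sum, rule fs.span_scale, rule fs.span_base) auto
      finally show "l \<in> fs.span (row ` B)" .
    qed
  qed
  moreover have "card (row ` B) \<le> card B" using BK card_image_le by blast
  moreover have "fs.dim (perp3 ?W) + 3 = 2 * card ?W" by (rule dim_perp3[OF WV W2])
  ultimately show ?thesis using B(3) by linarith
qed

end

section \<open>Stress circuits are rigid\<close>

text \<open>A 3 by 3 matrix with a nonzero kernel vector on one side has determinant 0; each entry
  of that vector times \<open>?D\<close> is a cofactor combination of the three relations.\<close>

lemma det3_zero: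
  fixes a1 a2 b1 b2 c1 c2 wa wb wc oa ob oc :: real
  assumes "oa * a1 + ob * b1 + oc * c1 = 0" "oa * a2 + ob * b2 + oc * c2 = 0"
    "oa * wa + ob * wb + oc * wc = 0" "oa \<noteq> 0 \<or> ob \<noteq> 0 \<or> oc \<noteq> 0"
  shows "(b1 * c2 - b2 * c1) * wa + (c1 * a2 - c2 * a1) * wb + (a1 * b2 - a2 * b1) * wc = 0" (is "?D = 0")
proof -
  have "oa * ?D = (b1 * c2 - b2 * c1) * (oa * wa + ob * wb + oc * wc)
      - (c2 * wb - b2 * wc) * (oa * a1 + ob * b1 + oc * c1) + (c1 * wb - b1 * wc) * (oa * a2 + ob * b2 + oc * c2)"
    by (simp add: algebra_simps)
  moreover have "ob * ?D = (c1 * a2 - c2 * a1) * (oa * wa + ob * wb + oc * wc)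
      - (a2 * wc - c2 * wa) * (oa * a1 + ob * b1 + oc * c1) + (a1 * wc - c1 * wa) * (oa * a2 + ob * b2 + oc * c2)"
    by (simp add: algebra_simps)
  moreover have "oc * ?D = (a1 * b2 - a2 * b1) * (oa * wa + ob * wb + oc * wc)
      - (b2 * wa - a2 * wb) * (oa * a1 + ob * b1 + oc * c1) + (b1 * wa - a1 * wb) * (oa * a2 + ob * b2 + oc * c2)"
    by (simp add: algebra_simps)
  ultimately have "oa * ?D = 0" "ob * ?D = 0" "oc * ?D = 0" using assms(1-3) by (simp_all only:)
  then show ?thesis using assms(4) by auto
qed

lemma St_comb:
  assumes "\<omega> \<in> St V p F" "\<sigma> \<in> St V p G"
  shows "(\<lambda>e. \<omega> e - c * \<sigma> e) \<in> St V p (F \<union> G)"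
proof -
  have "\<omega> \<in> St V p (F \<union> G)" "\<sigma> \<in> St V p (F \<union> G)"
    using assms St_mono[of F "F \<union> G"] St_mono[of G "F \<union> G"] by blast+
  then have "\<omega> + (\<lambda>e. (- c) * \<sigma> e) \<in> St V p (F \<union> G)"
    by (intro fs.subspace_add[OF St_subspace] fs.subspace_scale[OF St_subspace])
  moreover have "\<omega> + (\<lambda>e. (- c) * \<sigma> e) = (\<lambda>e. \<omega> e - c * \<sigma> e)" by (auto simp: fun_eq_iff)
  ultimately show ?thesis by (simp only:)
qed

context framework
begin

definition circuit :: "'a set set \<Rightarrow> bool" where
  "circuit C \<longleftrightarrow> C \<subseteq> KE V \<and> \<not> S C \<subseteq> {0} \<and> (\<forall>D. D \<subset> C \<longrightarrow> S D \<subseteq> {0})"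

lemma circuit_KE: "circuit C \<Longrightarrow> C \<subseteq> KE V"
  by (simp add: circuit_def)

lemma circuit_supp:
  assumes "circuit C" "\<omega> \<in> S C" "\<omega> \<noteq> 0" "e \<in> C" shows "\<omega> e \<noteq> 0"
proof
  assume 0: "\<omega> e = 0"
  have "\<omega> \<in> S (C - {e})"
    by (rule St_restrict[OF assms(2)]) (use St_supp[OF assms(2)] 0 in auto)
  moreover have "S (C - {e}) \<subseteq> {0}" using assms(1,4) unfolding circuit_def by blast
  ultimately show False using assms(3) by auto
qed

lemma circuit_stress:
  assumes "circuit C" obtains \<omega> where "\<omega> \<in> S C" "\<And>e. \<omega> e \<noteq> 0 \<longleftrightarrow> e \<in> C"
proof -
  obtain \<omega> where \<omega>: "\<omega> \<in> S C" "\<omega> \<noteq> 0" using assms by (auto simp: circuit_def)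
  then have "\<omega> e \<noteq> 0 \<longleftrightarrow> e \<in> C" for e using circuit_supp[OF assms \<omega>] St_supp[OF \<omega>(1)] by blast
  then show ?thesis using that \<omega> by blast
qed

lemma circuit_minimal:
  assumes "circuit C" "circuit D" "D \<subseteq> C" shows "D = C"
  using assms unfolding circuit_def by blast

text \<open>If the support is not minimal, some stress \<sigma> lives on a proper part of it. Either
  \<sigma> is itself nonzero at \<open>e\<close>, or subtracting a multiple of it shrinks the
  support of \<omega> without changing the value at \<open>e\<close>.\<close>

lemma circuit_exists:
  assumes "F \<subseteq> KE V" "\<omega> \<in> S F" "\<omega> e \<noteq> 0"
  shows "\<exists>C. circuit C \<and> e \<in> C \<and> C \<subseteq> {f. \<omega> f \<noteq> 0}"
  using assms(2,3)
proof (induction "card {f. \<omega> f \<noteq> 0}" arbitrary: \<omega> rule: less_induct)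
  case less
  let ?Z = "{f. \<omega> f \<noteq> 0}"
  have ZF: "?Z \<subseteq> F" using St_supp[OF less.prems(1)] by blast
  then have ZK: "?Z \<subseteq> KE V" "finite ?Z" using assms(1) finKE finite_subset by (blast, meson)
  have \<omega>Z: "\<omega> \<in> S ?Z" by (rule St_restrict[OF less.prems(1)]) simp
  show ?case
  proof (cases "circuit ?Z")
    case True
    then show ?thesis using less.prems(2) by blast
  next
    case False
    have "\<omega> \<noteq> 0" using less.prems(2) by auto
    then obtain D where D: "D \<subset> ?Z" "\<not> S D \<subseteq> {0}" using False ZK \<omega>Z unfolding circuit_def by blast
    then obtain \<sigma> where \<sigma>: "\<sigma> \<in> S D" "\<sigma> \<noteq> 0" by blast
    have \<sigma>F: "\<sigma> \<in> S F" using \<sigma>(1) D(1) ZF St_mono[of D F] by blast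
    show ?thesis
    proof (cases "\<sigma> e = 0")
      case False
      have sub: "{f. \<sigma> f \<noteq> 0} \<subset> ?Z" using St_supp[OF \<sigma>(1)] D(1) by blast
      then have "card {f. \<sigma> f \<noteq> 0} < card ?Z" by (rule psubset_card_mono[OF ZK(2)])
      from less.hyps[OF this \<sigma>F False] show ?thesis using sub by blast
    next
      case True
      obtain f where f: "\<sigma> f \<noteq> 0" using \<sigma>(2) by (auto simp: fun_eq_iff)
      define \<tau> where "\<tau> = (\<lambda>g. \<omega> g - (\<omega> f / \<sigma> f) * \<sigma> g)"
      have "\<tau> \<in> S F" using St_comb[OF less.prems(1) \<sigma>F, of "\<omega> f / \<sigma> f"] unfolding \<tau>_def Un_absorb .
      moreover have "\<tau> e \<noteq> 0" using True less.prems(2) by (simp add: \<tau>_def)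
      moreover have sub: "{g. \<tau> g \<noteq> 0} \<subset> ?Z"
      proof
        show "{g. \<tau> g \<noteq> 0} \<subseteq> ?Z"
        proof
          fix g assume "g \<in> {g. \<tau> g \<noteq> 0}"
          then have "\<omega> g \<noteq> 0 \<or> \<sigma> g \<noteq> 0" by (auto simp: \<tau>_def)
          then show "g \<in> ?Z" using St_supp[OF \<sigma>(1)] D(1) by blast
        qed
        have "f \<in> ?Z" using f St_supp[OF \<sigma>(1)] D(1) by blast
        moreover have "\<tau> f = 0" using f by (simp add: \<tau>_def)
        ultimately show "{g. \<tau> g \<noteq> 0} \<noteq> ?Z" by blast
      qed
      moreover have "card {g. \<tau> g \<noteq> 0} < card ?Z" by (rule psubset_card_mono[OF ZK(2) sub])
      ultimately have "\<exists>C. circuit C \<and> e \<in> C \<and> C \<subseteq> {g. \<tau> g \<noteq> 0}" using less.hyps by blast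
      then show ?thesis using sub by blast
    qed
  qed
qed

lemma circuit_degree:
  assumes "circuit C" "x \<in> \<Union>C" shows "3 \<le> card (star C x)"
proof -
  obtain \<omega> where \<omega>: "\<omega> \<in> S C" "\<And>e. \<omega> e \<noteq> 0 \<longleftrightarrow> e \<in> C" by (rule circuit_stress[OF assms(1)]) blast
  obtain e where e: "e \<in> C" "x \<in> e" using assms(2) by blast
  have "3 \<le> card {f \<in> star C x. \<omega> f \<noteq> 0}"
    by (rule stress_degree[OF circuit_KE[OF assms(1)] \<omega>(1) e(1) _ e(2)]) (use \<omega> e in simp)
  moreover have "{f \<in> star C x. \<omega> f \<noteq> 0} = star C x" using \<omega>(2) by (auto simp: star_def)
  ultimately show ?thesis by simp
qed

lemma circuit_nonempty: "circuit C \<Longrightarrow> C \<noteq> {}"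
  by (rule circuit_stress[of C]) (auto simp: circuit_def St_def supp_in_def fun_eq_iff)

lemma circuit_card_le:
  assumes "circuit C" shows "card C + 2 \<le> 2 * card (\<Union>C)"
proof -
  have CK: "C \<subseteq> KE V" "finite C" "C \<noteq> {}" using circuit_KE[OF assms] finKE circuit_nonempty[OF assms] by auto
  obtain e where e: "e \<in> C" using CK by blast
  have "card (C - {e}) + 3 \<le> 2 * card (\<Union>C)"
    by (rule indep_bound) (use CK e assms finite_Union_KE[OF finV CK(1)] card_Union_ge2[OF CK(1,3)] in
        \<open>auto simp: circuit_def\<close>)
  moreover have "card C = card (C - {e}) + 1" using e CK(2) by (metis card_Suc_Diff1 Suc_eq_plus1)
  ultimately show ?thesis by simp
qed

text \<open>The degree sum \<open>2 * card C\<close> is at most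
  \<open>4 * card (\<Union>C) - 4\<close>, so the average degree is below 4.\<close>

lemma circuit_degree_3_vertex:
  assumes "circuit C" obtains x where "x \<in> \<Union>C" "card (star C x) = 3"
proof -
  have CK: "C \<subseteq> KE V" "finite C" using circuit_KE[OF assms] finKE by auto
  have fW: "finite (\<Union>C)" using finite_Union_KE[OF finV CK(1)] by blast
  have "\<exists>x\<in>\<Union>C. card (star C x) < 4"
  proof (rule ccontr)
    assume "\<not> ?thesis"
    then have "(\<Sum>x\<in>\<Union>C. 4) \<le> (\<Sum>x\<in>\<Union>C. card (star C x))" by (intro sum_mono) (metis not_less)
    then have "4 * card (\<Union>C) \<le> 2 * card C" using handshake[OF fW CK] by simp
    then show False using circuit_card_le[OF assms] by simp
  qed
  then obtain x where x: "x \<in> \<Union>C" "card (star C x) < 4" by blast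
  then have "card (star C x) = 3" using circuit_degree[OF assms x(1)] by linarith
  then show ?thesis using that x by blast
qed

lemma framework_update: "generic V (p(x := \<xi>)) \<Longrightarrow> framework V (p(x := \<xi>))"
  using finV card3 by (simp add: framework_def)

text \<open>Since \<open>C\<close> stays dependent when the generic position \<open>\<xi>\<close> of \<open>x\<close> varies, the virtual work \<open>\<Psi> \<xi>\<close> done at
  \<open>a\<close>, \<open>b\<close>, \<open>c\<close> by the stress on the star of \<open>x\<close> vanishes at all generic \<open>\<xi>\<close>, hence by continuity also at
  the midpoint of \<open>a\<close> and \<open>b\<close>, where it is a multiple of the strain of \<open>ab\<close>.\<close>

lemma tri_strain:
  assumes C: "circuit C" and st: "star C x = {{x, a}, {x, b}, {x, c}}"
    and V: "x \<in> V" "a \<in> V" "b \<in> V" "c \<in> V" and d: "distinct [x, a, b, c]"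
    and m: "\<And>e. e \<in> C - star C x \<Longrightarrow> est m e = 0"
  shows "strain m a b = 0"
proof -
  define w where "w u \<xi> = (\<xi> $ 1 - X u) * m (u, True) + (\<xi> $ 2 - Y u) * m (u, False)" for u and \<xi> :: "real^2"
  define D where "D u v \<xi> = (\<xi> $ 1 - X u) * (\<xi> $ 2 - Y v) - (\<xi> $ 2 - Y u) * (\<xi> $ 1 - X v)" for u v and \<xi> :: "real^2"
  define \<Psi> where "\<Psi> \<xi> = D b c \<xi> * w a \<xi> + D c a \<xi> * w b \<xi> + D a b \<xi> * w c \<xi>" for \<xi>
  have CK: "C \<subseteq> KE V" "finite C" using circuit_KE[OF C] finKE by auto
  have gen0: "\<Psi> \<xi> = 0" if g: "generic V (p(x := \<xi>))" for \<xi>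
  proof -
    let ?p = "p(x := \<xi>)"
    interpret f': framework V ?p by (rule framework_update[OF g])
    have "\<not> St V ?p C \<subseteq> {0}"
      using independence_generic[OF finV CK(2) g gen] C by (auto simp: circuit_def)
    then obtain \<omega> where \<omega>: "\<omega> \<in> St V ?p C" "\<omega> \<noteq> 0" by blast
    have nbr: "\<omega> {x, u} = 0" if "u \<in> V" "u \<noteq> x" "u \<notin> {a, b, c}" for u
    proof (rule ccontr)
      assume "\<omega> {x, u} \<noteq> 0"
      then have "{x, u} \<in> star C x" using St_supp[OF \<omega>(1)] by (simp add: star_def)
      then show False using st that by (auto simp: doubleton_eq_iff)
    qed
    \<comment> \<open>If all three weights vanished, the position of \<open>x\<close> would be
      irrelevant, and \<omega> would be a nonzero stress of \<open>C\<close> at \<open>p\<close>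
      missing an edge.\<close>
    have nz: "\<omega> {x, a} \<noteq> 0 \<or> \<omega> {x, b} \<noteq> 0 \<or> \<omega> {x, c} \<noteq> 0"
    proof (rule ccontr)
      assume z: "\<not> ?thesis"
      then have zx: "\<omega> {x, u} = 0" if "u \<in> V" "u \<noteq> x" for u using nbr that by (cases "u \<in> {a, b, c}") auto
      then have zx': "\<omega> {u, x} = 0" if "u \<in> V" "u \<noteq> x" for u using that by (simp add: insert_commute)
      have "lap V \<omega> (\<lambda>v. p v $ i) = lap V \<omega> (\<lambda>v. ?p v $ i)" for i
      proof
        fix v show "lap V \<omega> (\<lambda>v. p v $ i) v = lap V \<omega> (\<lambda>v. ?p v $ i) v"
        proof (cases "v \<in> V")
          case True
          show ?thesis unfolding lap_def using True zx[of v]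
            by (auto intro!: sum.cong simp: zx zx')
        qed (simp add: lap_def)
      qed
      then have "\<omega> \<in> S C" using \<omega>(1) by (auto simp: St_def)
      moreover have "{x, a} \<in> C" using st by (auto simp: star_def)
      moreover have "\<omega> {x, a} = 0" using z by simp
      ultimately show False using circuit_supp[OF C _ \<omega>(2)] by blast
    qed
    have red: "(\<Sum>u\<in>V. \<omega> {x, u} * h u) = \<omega> {x, a} * h a + \<omega> {x, b} * h b + \<omega> {x, c} * h c"
      if "h x = 0" for h :: "'a \<Rightarrow> real"
    proof -
      have "(\<Sum>u\<in>V. \<omega> {x, u} * h u) = (\<Sum>u\<in>{a, b, c}. \<omega> {x, u} * h u)"
        by (rule sum.mono_neutral_right) (use finV V nbr that in auto)
      then show ?thesis using d by simp
    qed
    have eq: "\<omega> {x, a} * (\<xi> $ i - p a $ i) + \<omega> {x, b} * (\<xi> $ i - p b $ i) + \<omega> {x, c} * (\<xi> $ i - p c $ i) = 0" for i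
    proof -
      have "lap V \<omega> (\<lambda>v. ?p v $ i) x = 0" using \<omega>(1) by (auto simp: St_def)
      then have "(\<Sum>u\<in>V. \<omega> {x, u} * (?p x $ i - ?p u $ i)) = 0" using V by (simp add: lap_def)
      then show ?thesis by (subst (asm) red) (use d in auto)
    qed
    \<comment> \<open>The hypothesis does not involve the velocity of \<open>x\<close>, so it may be
      set to 0; the strain of an edge \<open>xu\<close> is then \<open>- w u \<xi>\<close>.\<close>
    define m' where "m' = (\<lambda>(v, b). if v = x then 0 else m (v, b))"
    have "f'.est m' e = 0" if e: "e \<in> C - star C x" for e
    proof -
      obtain u v where uv: "e = {u, v}" "u \<noteq> v" "u \<in> V" "v \<in> V" using e CK by (blast elim: KE_E)
      then have "u \<noteq> x" "v \<noteq> x" using e by (auto simp: star_def)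
      then have "f'.est m' e = est m e"
        using uv by (simp add: f'.est_pair est_pair f'.strain_def strain_def m'_def)
      then show ?thesis using m[OF e] by simp
    qed
    then have "(\<Sum>e\<in>C. \<omega> e * f'.est m' e) = (\<Sum>e\<in>star C x. \<omega> e * f'.est m' e)"
      by (intro sum.mono_neutral_right) (auto simp: CK star_def)
    also have "\<dots> = \<omega> {x, a} * f'.est m' {x, a} + \<omega> {x, b} * f'.est m' {x, b} + \<omega> {x, c} * f'.est m' {x, c}"
      unfolding st using d by (simp add: doubleton_eq_iff)
    also have "\<dots> = - (\<omega> {x, a} * w a \<xi> + \<omega> {x, b} * w b \<xi> + \<omega> {x, c} * w c \<xi>)"
    proof -
      have "f'.est m' {x, u} = - w u \<xi>" if "u \<in> V" "u \<noteq> x" for u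
      proof -
        have "m' (x, b) = 0" "m' (u, b) = m (u, b)" for b using that by (simp_all add: m'_def)
        then show ?thesis
          using f'.est_pair[OF V(1) that(1) that(2)[symmetric], of m'] that
          by (simp add: f'.strain_def w_def algebra_simps)
      qed
      moreover have "a \<noteq> x" "b \<noteq> x" "c \<noteq> x" using d by auto
      ultimately show ?thesis using V by (simp add: algebra_simps)
    qed
    finally have "\<omega> {x, a} * w a \<xi> + \<omega> {x, b} * w b \<xi> + \<omega> {x, c} * w c \<xi> = 0"
      using f'.virtual_work[OF \<omega>(1) CK(1), of m'] by simp
    from det3_zero[OF eq[of 1] eq[of 2] this nz] show ?thesis
      by (simp add: \<Psi>_def D_def)
  qed
  have cont: "continuous_on UNIV \<Psi>"
    unfolding \<Psi>_def w_def D_def by (intro continuous_intros)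
  have all0: "\<Psi> \<xi> = 0" for \<xi>
  proof (rule ccontr)
    assume "\<Psi> \<xi> \<noteq> 0"
    moreover have "open {\<xi>. \<Psi> \<xi> \<noteq> 0}" using cont by (intro open_Collect_neq) auto
    moreover have "generic (V - {x}) p" using generic_subset[OF gen] by blast
    ultimately obtain \<xi>' where "\<xi>' \<in> {\<xi>. \<Psi> \<xi> \<noteq> 0}" "generic V (p(x := \<xi>'))"
      using generic_dense_vertex[OF finV V(1), of p "{\<xi>. \<Psi> \<xi> \<noteq> 0}" \<xi>] by blast
    then show False using gen0 by blast
  qed
  define \<mu> :: "real^2" where "\<mu> = vector [(X a + X b) / 2, (Y a + Y b) / 2]"
  have "4 * \<Psi> \<mu> = - (tri p a b c * strain m a b)"
    by (simp add: \<Psi>_def D_def w_def \<mu>_def tri_def strain_def field_simps)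
  then have "tri p a b c * strain m a b = 0" using all0 by simp
  moreover have "tri p a b c \<noteq> 0" using tri_generic[OF gen V(2-4)] d by auto
  ultimately show ?thesis by simp
qed

text \<open>Six edges on four vertices exceed the bound 5. A stress vanishing on all edges at
  \<open>x\<close> would live on a triangle, whose degrees are too small.\<close>

lemma K4_stress:
  assumes V: "x \<in> V" "a \<in> V" "b \<in> V" "c \<in> V" and d: "distinct [x, a, b, c]"
  obtains \<tau> where "\<tau> \<in> S {{x, a}, {x, b}, {x, c}, {a, b}, {b, c}, {c, a}}"
    "\<tau> {x, a} \<noteq> 0 \<or> \<tau> {x, b} \<noteq> 0 \<or> \<tau> {x, c} \<noteq> 0"
proof -
  let ?F = "{{x, a}, {x, b}, {x, c}, {a, b}, {b, c}, {c, a}}"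
  let ?T = "{{a, b}, {b, c}, {c, a}}"
  have FK: "?F \<subseteq> KE V" using V d by (auto simp: KE_def)
  have d': "a \<noteq> x" "b \<noteq> x" "c \<noteq> x" "b \<noteq> a" "c \<noteq> a" "c \<noteq> b" using d by auto
  have "card ?F = 6" using d d' by (simp add: doubleton_eq_iff)
  moreover have "card {x, a, b, c} = 4" using d by simp
  ultimately have "\<not> S ?F \<subseteq> {0}"
    using indep_bound[OF FK, of "{x, a, b, c}"] V by auto
  then obtain \<tau> where \<tau>: "\<tau> \<in> S ?F" "\<tau> \<noteq> 0" by blast
  have "\<tau> {x, a} \<noteq> 0 \<or> \<tau> {x, b} \<noteq> 0 \<or> \<tau> {x, c} \<noteq> 0"
  proof (rule ccontr)
    assume z: "\<not> ?thesis"
    have \<tau>T: "\<tau> \<in> S ?T"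
      by (rule St_restrict[OF \<tau>(1)]) (use St_supp[OF \<tau>(1)] z in auto)
    obtain e where e: "\<tau> e \<noteq> 0" using \<tau>(2) by (auto simp: fun_eq_iff)
    then have eT: "e \<in> ?T" by (rule St_supp[OF \<tau>T])
    have "\<exists>y. y \<in> e \<and> y \<in> {a, b, c}" using eT by auto
    then obtain y where y: "y \<in> e" "y \<in> {a, b, c}" by blast
    have "3 \<le> card {f \<in> star ?T y. \<tau> f \<noteq> 0}"
      by (rule stress_degree[OF _ \<tau>T eT e y(1)]) (use FK in auto)
    also have "\<dots> \<le> card (star ?T y)" by (rule card_mono) (auto simp: star_def)
    also have "star ?T y \<subseteq> ?T - {({a, b, c} - {y})}"
      using y(2) d by (auto simp: star_def)
    then have "card (star ?T y) \<le> card (?T - {({a, b, c} - {y})})" by (rule card_mono[rotated]) simp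
    also have "{a, b, c} - {y} \<in> ?T" using y(2) d by (auto simp: doubleton_eq_iff insert_Diff_if)
    then have "card (?T - {({a, b, c} - {y})}) = card ?T - 1" by (subst card_Diff_singleton) auto
    also have "card ?T = 3" using d d' by (simp add: doubleton_eq_iff)
    finally show False by simp
  qed
  then show ?thesis using that \<tau> by blast
qed

text \<open>\<open>\<rho>\<close> expresses the row of \<open>ab\<close> by rows of edges of \<open>C\<close> on which \<open>m\<close> vanishes.\<close>

lemma pair_resolution:
  assumes C: "circuit C" and x: "x \<in> \<Union>C" "x \<noteq> a" "x \<noteq> b"
    and ab: "a \<in> \<Union>C" "b \<in> \<Union>C" "a \<noteq> b"
    and IH: "\<And>C'. circuit C' \<Longrightarrow> card (\<Union>C') < card (\<Union>C) \<Longrightarrow> rigid C'"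
    and res: "\<And>m. (\<And>e. e \<in> C - star C x \<Longrightarrow> est m e = 0) \<Longrightarrow> strain m a b = 0"
    and m: "\<And>e. e \<in> C \<Longrightarrow> est m e = 0" and m0: "\<And>d. m (a, d) = 0" "\<And>d. m (b, d) = 0"
  obtains \<rho> where "\<rho> \<in> supp_in (C - star C x)"
    "(\<lambda>e. unit_fun {a, b} e - \<rho> e) \<in> S (KE V)"
    "\<And>f v d. \<rho> f \<noteq> 0 \<Longrightarrow> v \<in> f \<Longrightarrow> m (v, d) = 0"
proof (cases "{a, b} \<in> C")
  case True
  have "unit_fun {a, b} \<in> supp_in (C - star C x)"
    using True x by (auto simp: supp_in_def unit_fun_def star_def)
  moreover have "(\<lambda>e. unit_fun {a, b} e - unit_fun {a, b} e) = (0 :: 'a set \<Rightarrow> real)" by auto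
  then have "(\<lambda>e. unit_fun {a, b} e - unit_fun {a, b} e) \<in> S (KE V)" using fs.subspace_0[OF St_subspace] by metis
  moreover have "m (v, d) = 0" if "unit_fun {a, b} f \<noteq> 0" "v \<in> f" for f v d
    using that m0 by (auto simp: unit_fun_def split: if_splits)
  ultimately show ?thesis by (rule that)
next
  case False
  let ?R = "C - star C x"
  have CK: "C \<subseteq> KE V" "finite C" using circuit_KE[OF C] finKE by auto
  have fW: "finite (\<Union>C)" and WV: "\<Union>C \<subseteq> V" using finite_Union_KE[OF finV CK(1)] by auto
  have abV: "a \<in> V" "b \<in> V" using ab WV by auto
  have abK: "{a, b} \<in> KE V" using abV ab(3) by (rule pair_KE)
  \<comment> \<open>By \<open>res\<close>, velocities without strain on \<open>C - star C x\<close>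
    have none on \<open>ab\<close>, so the row of \<open>ab\<close> lies in the span of the rows of
    these edges.\<close>
  have "\<exists>c. \<forall>i. row {a, b} i = (\<Sum>e\<in>?R. c e * row e i)"
  proof (rule annihilator[of "V \<times> UNIV" ?R row "row {a, b}"])
    show "row e \<in> supp_in (V \<times> UNIV)" if "e \<in> ?R" for e
      by (rule row_supp) (use that CK in \<open>auto simp: KE_def\<close>)
    show "row {a, b} \<in> supp_in (V \<times> UNIV)" by (rule row_supp) (use abV in auto)
    show "(\<Sum>i\<in>V \<times> UNIV. row {a, b} i * m i) = 0"
      if "\<And>e. e \<in> ?R \<Longrightarrow> (\<Sum>i\<in>V \<times> UNIV. row e i * m i) = 0" for m
      using res[of m] that est_pair[OF abV ab(3), of m] by (simp add: est_def)
  qed (use finV CK in auto)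
  then obtain c where c: "\<And>i. row {a, b} i = (\<Sum>e\<in>?R. c e * row e i)" by blast
  have abR: "{a, b} \<notin> ?R" using False by blast
  define \<omega> where "\<omega> e = (if e = {a, b} then 1 else if e \<in> ?R then - c e else 0)" for e
  have RK: "insert {a, b} ?R \<subseteq> KE V" using CK abK by blast
  have \<omega>: "\<omega> \<in> S (insert {a, b} ?R)"
  proof (subst S_iff_rows[OF _ RK])
    show "\<omega> \<in> supp_in (insert {a, b} ?R)" by (auto simp: supp_in_def \<omega>_def)
    show "\<forall>i. (\<Sum>e\<in>insert {a, b} ?R. \<omega> e * row e i) = 0"
    proof
      fix i
      have "(\<Sum>e\<in>?R. \<omega> e * row e i) = (\<Sum>e\<in>?R. - (c e * row e i))"
        by (rule sum.cong) (use abR in \<open>auto simp: \<omega>_def\<close>)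
      then show "(\<Sum>e\<in>insert {a, b} ?R. \<omega> e * row e i) = 0"
        using abR CK(2) c[of i] by (simp add: sum_negf \<omega>_def[of "{a, b}"])
    qed
  qed
  then obtain C' where C': "circuit C'" "{a, b} \<in> C'" "C' \<subseteq> {f. \<omega> f \<noteq> 0}"
    using circuit_exists[OF RK \<omega>, of "{a, b}"] by (auto simp: \<omega>_def)
  have C'R: "C' \<subseteq> insert {a, b} ?R" using C'(3) St_supp[OF \<omega>] by blast
  \<comment> \<open>\<open>C'\<close> avoids \<open>x\<close>, so it has fewer vertices than
    \<open>C\<close> and is rigid by \<open>IH\<close>; a motion vanishing at \<open>a\<close> and
    \<open>b\<close> vanishes on all of it.\<close>
  have "\<Union>C' \<subseteq> \<Union>C - {x}" using C'R ab x by (auto simp: star_def)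
  then have "\<Union>C' \<subset> \<Union>C" using x(1) by blast
  then have "card (\<Union>C') < card (\<Union>C)" by (rule psubset_card_mono[OF fW])
  then have rig: "rigid C'" by (rule IH[OF C'(1)])
  have "est m e = 0" if "e \<in> C'" for e
    using that C'R m est_pair[OF abV ab(3)] res[of m] by auto
  then have str: "strain m u v = 0" if "u \<in> \<Union>C'" "v \<in> \<Union>C'" for u v
    using rig that unfolding rigid_def by blast
  have UV: "\<Union>C' \<subseteq> V" using finite_Union_KE[OF finV circuit_KE[OF C'(1)]] by blast
  have z: "m (v, d) = 0" if "v \<in> \<Union>C'" for v d
    by (rule motion_zero_third[OF abV _ ab(3) _ _ m0]) (use that UV C'(2) in \<open>auto intro!: str\<close>)
  obtain \<sigma> where \<sigma>: "\<sigma> \<in> S C'" "\<And>e. \<sigma> e \<noteq> 0 \<longleftrightarrow> e \<in> C'" by (rule circuit_stress[OF C'(1)]) blast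
  define \<rho> where "\<rho> e = unit_fun {a, b} e - \<sigma> e / \<sigma> {a, b}" for e
  have \<rho>z: "\<rho> e = 0" if "e \<notin> C' - {{a, b}}" for e
    using that \<sigma>(2)[of e] \<sigma>(2)[of "{a, b}"] C'(2) by (cases "e = {a, b}") (auto simp: \<rho>_def unit_fun_def)
  have "\<rho> \<in> supp_in ?R" using \<rho>z C'R by (auto simp: supp_in_def)
  moreover have "(\<lambda>e. unit_fun {a, b} e - \<rho> e) = (\<lambda>e. (1 / \<sigma> {a, b}) * \<sigma> e)" by (auto simp: \<rho>_def)
  then have "(\<lambda>e. unit_fun {a, b} e - \<rho> e) \<in> S (KE V)"
    using fs.subspace_scale[OF St_subspace \<sigma>(1), of "1 / \<sigma> {a, b}"] St_mono[OF circuit_KE[OF C'(1)]] by auto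
  moreover have "m (v, d) = 0" if "\<rho> f \<noteq> 0" "v \<in> f" for f v d
    using \<rho>z[of f] that z by blast
  ultimately show ?thesis by (rule that)
qed

text \<open>Let \<open>x\<close> have degree three, with neighbours \<open>a\<close>,
  \<open>b\<close>, \<open>c\<close>. By \<open>tri_strain\<close>, a motion of \<open>C\<close>
  vanishes on all four after subtracting an isometry. In a stress of the \<open>K\<^sub>4\<close> on
  these vertices, the edges of the triangle \<open>abc\<close> are replaced by their resolutions
  \<rho>. The result \<tau>' is a stress of \<open>C\<close> that agrees with the old one at
  \<open>x\<close>; being nonzero, it is nonzero on every edge of \<open>C\<close>. So each edge
  away from \<open>x\<close> occurs in one of the resolutions, and there the motion
  vanishes.\<close>

theorem circuit_rigid: "circuit C \<Longrightarrow> rigid C"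
proof (induction "card (\<Union>C)" arbitrary: C rule: less_induct)
  case less
  note C = less.prems
  have CK: "C \<subseteq> KE V" "finite C" using circuit_KE[OF C] finKE by auto
  have fW: "finite (\<Union>C)" and WV: "\<Union>C \<subseteq> V" using finite_Union_KE[OF finV CK(1)] by auto
  obtain x where x: "x \<in> \<Union>C" "card (star C x) = 3" by (rule circuit_degree_3_vertex[OF C])
  have xV: "x \<in> V" using x WV by auto
  define N0 where "N0 = {y \<in> V - {x}. {x, y} \<in> C}"
  have bij: "bij_betw (\<lambda>y. {x, y}) N0 (star C x)" unfolding N0_def by (rule star_bij[OF CK(1)])
  have "card N0 = 3" using x(2) bij_betw_same_card[OF bij] by simp
  then obtain a b c where N: "N0 = {a, b, c}" "a \<noteq> b" "a \<noteq> c" "b \<noteq> c" unfolding card_3_iff by blast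
  have "star C x = (\<lambda>y. {x, y}) ` {a, b, c}" using bij N(1) by (simp add: bij_betw_def)
  then have st: "star C x = {{x, a}, {x, b}, {x, c}}" by simp
  have abc: "y \<in> V \<and> y \<noteq> x \<and> {x, y} \<in> C" if "y \<in> {a, b, c}" for y
    using that unfolding N(1)[symmetric] N0_def by blast
  have V: "a \<in> V" "b \<in> V" "c \<in> V" and d: "x \<noteq> a" "x \<noteq> b" "x \<noteq> c"
    and edges: "{x, a} \<in> C" "{x, b} \<in> C" "{x, c} \<in> C" using abc[of a] abc[of b] abc[of c] by auto
  have U: "a \<in> \<Union>C" "b \<in> \<Union>C" "c \<in> \<Union>C" using edges by auto
  have res: "strain m a b = 0" "strain m b c = 0" "strain m c a = 0"
    if "\<And>e. e \<in> C - star C x \<Longrightarrow> est m e = 0" for m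
    using tri_strain[OF C _ xV V, of m] tri_strain[OF C _ xV V(2,3,1), of m]
      tri_strain[OF C _ xV V(3,1,2), of m] st N d that by (auto simp: insert_commute)
  show "rigid C"
    unfolding rigid_def
  proof (intro allI impI ballI)
    fix m u w assume m: "\<forall>e\<in>C. est m e = 0" and uw: "u \<in> \<Union>C" "w \<in> \<Union>C"
    have "strain m a b = 0" by (rule res(1)) (use m in auto)
    then obtain \<alpha> \<beta> \<gamma> where t: "\<And>d. m (a, d) = tm \<alpha> \<beta> \<gamma> (a, d)" "\<And>d. m (b, d) = tm \<alpha> \<beta> \<gamma> (b, d)"
      using normalise_motion[OF V(1,2) N(2), of m] by blast
    define m' where "m' i = m i - tm \<alpha> \<beta> \<gamma> i" for i
    have sm: "strain m' y z = strain m y z" for y z unfolding m'_def by (rule strain_tm)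
    have m': "est m' e = 0" if "e \<in> C" for e
    proof -
      have "e \<in> KE V" using that CK by blast
      then obtain y z where "e = {y, z}" "y \<noteq> z" "y \<in> V" "z \<in> V" by (rule KE_E)
      then show ?thesis using m that est_pair[of y z] sm by auto
    qed
    have ma: "m' (a, d) = 0" and mb: "m' (b, d) = 0" for d using t by (simp_all add: m'_def)
    have mC: "\<And>e. e \<in> C - star C x \<Longrightarrow> est m' e = 0" using m' by blast
    have mc: "m' (c, d) = 0" for d
      by (rule motion_zero_third[OF V N(2) _ _ ma mb])
        (use res(2,3)[OF mC] in \<open>auto simp: strain_commute\<close>)
    have mx: "m' (x, d) = 0" for d
      by (rule motion_zero_third[OF V(1,2) xV N(2) _ _ ma mb])
        (use m'[OF edges(1)] m'[OF edges(2)] est_pair[OF xV V(1) d(1)] est_pair[OF xV V(2) d(2)]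
          in \<open>auto simp: strain_commute\<close>)
    obtain \<rho>1 where \<rho>1: "\<rho>1 \<in> supp_in (C - star C x)" "(\<lambda>e. unit_fun {a, b} e - \<rho>1 e) \<in> S (KE V)"
      "\<And>f v d. \<rho>1 f \<noteq> 0 \<Longrightarrow> v \<in> f \<Longrightarrow> m' (v, d) = 0"
      using pair_resolution[OF C x(1) d(1,2) U(1,2) N(2) less.hyps res(1) m' ma mb] by blast
    obtain \<rho>2 where \<rho>2: "\<rho>2 \<in> supp_in (C - star C x)" "(\<lambda>e. unit_fun {b, c} e - \<rho>2 e) \<in> S (KE V)"
      "\<And>f v d. \<rho>2 f \<noteq> 0 \<Longrightarrow> v \<in> f \<Longrightarrow> m' (v, d) = 0"
      using pair_resolution[OF C x(1) d(2,3) U(2,3) N(4) less.hyps res(2) m' mb mc] by blast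
    obtain \<rho>3 where \<rho>3: "\<rho>3 \<in> supp_in (C - star C x)" "(\<lambda>e. unit_fun {c, a} e - \<rho>3 e) \<in> S (KE V)"
      "\<And>f v d. \<rho>3 f \<noteq> 0 \<Longrightarrow> v \<in> f \<Longrightarrow> m' (v, d) = 0"
      using pair_resolution[OF C x(1) d(3,1) U(3,1) N(3)[symmetric] less.hyps res(3) m' mc ma] by blast
    have dst: "distinct [x, a, b, c]" using d N by auto
    obtain \<tau> where \<tau>: "\<tau> \<in> S {{x, a}, {x, b}, {x, c}, {a, b}, {b, c}, {c, a}}"
        "\<tau> {x, a} \<noteq> 0 \<or> \<tau> {x, b} \<noteq> 0 \<or> \<tau> {x, c} \<noteq> 0"
      by (rule K4_stress[OF xV V dst])
    have K6: "{{x, a}, {x, b}, {x, c}, {a, b}, {b, c}, {c, a}} \<subseteq> KE V" using V xV dst by (auto simp: KE_def)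
    have \<tau>K: "\<tau> \<in> S (KE V)" by (rule subsetD[OF St_mono[OF K6] \<tau>(1)])
    define \<tau>' where "\<tau>' = (\<lambda>e. \<tau> e - \<tau> {a, b} * (unit_fun {a, b} e - \<rho>1 e)
      - \<tau> {b, c} * (unit_fun {b, c} e - \<rho>2 e) - \<tau> {c, a} * (unit_fun {c, a} e - \<rho>3 e))"
    have \<tau>'K: "\<tau>' \<in> S (KE V)"
      using St_comb[OF St_comb[OF St_comb[OF \<tau>K \<rho>1(2), of "\<tau> {a, b}"] \<rho>2(2), of "\<tau> {b, c}"]
          \<rho>3(2), of "\<tau> {c, a}"] unfolding \<tau>'_def Un_absorb .
    have ne: "{a, b} \<noteq> {b, c}" "{b, c} \<noteq> {c, a}" "{a, b} \<noteq> {c, a}" using N by (auto simp: doubleton_eq_iff)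
    have off: "\<tau>' e = \<tau> {a, b} * \<rho>1 e + \<tau> {b, c} * \<rho>2 e + \<tau> {c, a} * \<rho>3 e" if "e \<notin> star C x" for e
    proof -
      have "\<tau> e = 0" if "e \<notin> {{a, b}, {b, c}, {c, a}}"
        using that \<open>e \<notin> star C x\<close> St_supp[OF \<tau>(1), of e] st by blast
      then have "\<tau> e = \<tau> {a, b} * unit_fun {a, b} e + \<tau> {b, c} * unit_fun {b, c} e + \<tau> {c, a} * unit_fun {c, a} e"
        using ne by (auto simp: unit_fun_def)
      then show ?thesis by (simp add: \<tau>'_def algebra_simps)
    qed
    have on: "\<tau>' e = \<tau> e" if "e \<in> star C x" for e
    proof -
      have "x \<in> e" using that by (simp add: star_def)
      then have "unit_fun {a, b} e = 0" "unit_fun {b, c} e = 0" "unit_fun {c, a} e = 0"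
        using d by (auto simp: unit_fun_def)
      moreover have "\<rho>1 e = 0" "\<rho>2 e = 0" "\<rho>3 e = 0"
        using \<rho>1(1) \<rho>2(1) \<rho>3(1) that by (auto simp: supp_in_def)
      ultimately show ?thesis by (simp add: \<tau>'_def)
    qed
    have "\<tau>' \<in> S C"
    proof (rule St_restrict[OF \<tau>'K])
      fix e assume nz: "\<tau>' e \<noteq> 0"
      show "e \<in> C"
      proof (rule ccontr)
        assume "e \<notin> C"
        then have "e \<notin> star C x" "\<rho>1 e = 0" "\<rho>2 e = 0" "\<rho>3 e = 0"
          using \<rho>1(1) \<rho>2(1) \<rho>3(1) by (auto simp: supp_in_def star_def)
        then show False using off[of e] nz by simp
      qed
    qed
    moreover have "\<tau>' \<noteq> 0"
    proof
      assume "\<tau>' = 0"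
      then show False using \<tau>(2) on[of "{x, a}"] on[of "{x, b}"] on[of "{x, c}"] st by auto
    qed
    ultimately have full: "\<tau>' e \<noteq> 0" if "e \<in> C" for e using circuit_supp[OF C] that by blast
    have zero: "m' (v, d) = 0" if v: "v \<in> \<Union>C" for v d
    proof (cases "v \<in> {x, a, b, c}")
      case True
      then show ?thesis using ma mb mc mx by auto
    next
      case False
      obtain e where e: "e \<in> C" "v \<in> e" using v by blast
      have ns: "e \<notin> star C x" using e False st by auto
      have "\<rho>1 e \<noteq> 0 \<or> \<rho>2 e \<noteq> 0 \<or> \<rho>3 e \<noteq> 0" using full[OF e(1)] off[OF ns] by auto
      then show ?thesis using \<rho>1(3) \<rho>2(3) \<rho>3(3) e(2) by blast
    qed
    have "strain m' u w = 0" using zero[OF uw(1)] zero[OF uw(2)] by (simp add: strain_def)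
    then show "strain m u w = 0" by (simp add: sm)
  qed
qed

section \<open>Connected stress graphs\<close>

lemma circuit_s: assumes "circuit C" shows "s C = 1"
proof -
  have CK: "C \<subseteq> KE V" by (rule circuit_KE[OF assms])
  obtain e where e: "e \<in> C" using circuit_nonempty[OF assms] by blast
  obtain \<omega> where \<omega>: "\<omega> \<in> S C" "\<And>e. \<omega> e \<noteq> 0 \<longleftrightarrow> e \<in> C" by (rule circuit_stress[OF assms]) blast
  have 1: "s (insert e (C - {e})) = s (C - {e}) + 1"
    by (rule s_insert_dep[of _ _ \<omega>]) (use e CK \<omega> in \<open>auto simp: insert_absorb\<close>)
  have "C - {e} \<subset> C" using e by blast
  then have "S (C - {e}) \<subseteq> {0}" using assms unfolding circuit_def by blast
  moreover have "C - {e} \<subseteq> KE V" using CK by blast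
  ultimately have "s (C - {e}) = 0" by (simp only: s_0_iff)
  with 1 show ?thesis using e by (simp add: insert_absorb)
qed

lemma circuit_card: "circuit C \<Longrightarrow> card C + 2 = 2 * card (\<Union>C)"
  using rigid_card[OF circuit_KE circuit_nonempty circuit_rigid] circuit_s by fastforce

lemma circuit_elimination:
  assumes "circuit C1" "circuit C2" "e \<in> C1 - C2" "h \<in> C1 \<inter> C2"
  obtains C3 where "circuit C3" "e \<in> C3" "C3 \<subseteq> (C1 \<union> C2) - {h}"
proof -
  obtain \<sigma>1 where 1: "\<sigma>1 \<in> S C1" "\<And>e. \<sigma>1 e \<noteq> 0 \<longleftrightarrow> e \<in> C1" by (rule circuit_stress[OF assms(1)]) blast
  obtain \<sigma>2 where 2: "\<sigma>2 \<in> S C2" "\<And>e. \<sigma>2 e \<noteq> 0 \<longleftrightarrow> e \<in> C2" by (rule circuit_stress[OF assms(2)]) blast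
  define \<tau> where "\<tau> = (\<lambda>g. \<sigma>1 g - (\<sigma>1 h / \<sigma>2 h) * \<sigma>2 g)"
  have \<tau>: "\<tau> \<in> S (C1 \<union> C2)" unfolding \<tau>_def by (rule St_comb[OF 1(1) 2(1)])
  have K: "C1 \<union> C2 \<subseteq> KE V" using circuit_KE assms by blast
  have "\<sigma>1 e \<noteq> 0" "\<sigma>2 e = 0" using assms(3) 1(2)[of e] 2(2)[of e] by auto
  then have "\<tau> e \<noteq> 0" by (simp add: \<tau>_def)
  then obtain C3 where C3: "circuit C3" "e \<in> C3" "C3 \<subseteq> {f. \<tau> f \<noteq> 0}" using circuit_exists[OF K \<tau>] by blast
  have "\<tau> h = 0" using assms(4) 2(2)[of h] by (auto simp: \<tau>_def)
  then have "C3 \<subseteq> (C1 \<union> C2) - {h}" using C3(3) St_supp[OF \<tau>] by blast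
  then show ?thesis using that C3 by blast
qed

text \<open>Eliminating \<open>h\<close> gives \<open>C3\<close> through \<open>e\<close> and
  \<open>C4\<close> through \<open>f\<close>. Replacing one of the given circuits may shrink the
  union. If neither replacement does, \<open>C4\<close> contains \<open>C2 - C1\<close>, which
  \<open>C3\<close> meets, and the pair \<open>C3\<close>, \<open>C4\<close> avoids
  \<open>h\<close>.\<close>

lemma circuit_common:
  assumes "circuit C1" "circuit C2" "C1 \<inter> C2 \<noteq> {}" "e \<in> C1" "f \<in> C2"
  shows "\<exists>C. circuit C \<and> C \<subseteq> C1 \<union> C2 \<and> e \<in> C \<and> f \<in> C"
  using assms
proof (induction "card (C1 \<union> C2)" arbitrary: C1 C2 rule: less_induct)
  case less
  note c1 = less.prems(1) and c2 = less.prems(2)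
  have fin: "finite (C1 \<union> C2)" using c1 c2 circuit_KE finKE by blast
  show ?case
  proof (cases "e \<in> C2 \<or> f \<in> C1")
    case True
    then show ?thesis using less.prems by blast
  next
    case False
    obtain h where h: "h \<in> C1 \<inter> C2" using less.prems(3) by blast
    obtain C3 where C3: "circuit C3" "e \<in> C3" "C3 \<subseteq> (C1 \<union> C2) - {h}"
      by (rule circuit_elimination[OF c1 c2 _ h, of e]) (use False less.prems in auto)
    obtain C4 where C4: "circuit C4" "f \<in> C4" "C4 \<subseteq> (C2 \<union> C1) - {h}"
      by (rule circuit_elimination[OF c2 c1, of f h]) (use False less.prems h in auto)
    have n3: "\<not> C3 \<subseteq> C1" using circuit_minimal[OF c1 C3(1)] C3(3) h by blast
    have n4: "\<not> C4 \<subseteq> C2" using circuit_minimal[OF c2 C4(1)] C4(3) h by blast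
    have i32: "C3 \<inter> C2 \<noteq> {}" using n3 C3(3) by blast
    have i14: "C1 \<inter> C4 \<noteq> {}" using n4 C4(3) by blast
    consider "C3 \<union> C2 \<subset> C1 \<union> C2" | "C1 \<union> C4 \<subset> C1 \<union> C2" | "C1 - C2 \<subseteq> C3" "C2 - C1 \<subseteq> C4"
      using C3(3) C4(3) by blast
    then show ?thesis
    proof cases
      case 1
      from less.hyps[OF psubset_card_mono[OF fin 1] C3(1) c2 i32 C3(2) less.prems(5)] 1 show ?thesis by blast
    next
      case 2
      from less.hyps[OF psubset_card_mono[OF fin 2] c1 C4(1) i14 less.prems(4) C4(2)] 2 show ?thesis by blast
    next
      case 3
      have i34: "C3 \<inter> C4 \<noteq> {}" using n3 C3(3) 3(2) by blast
      have sub: "C3 \<union> C4 \<subset> C1 \<union> C2" using C3(3) C4(3) h by blast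
      from less.hyps[OF psubset_card_mono[OF fin sub] C3(1) C4(1) i34 C3(2) C4(2)] sub show ?thesis by blast
    qed
  qed
qed

text \<open>Connectedness of the matroid of stresses, not of the graph; a single edge is excluded
  because it lies on no circuit.\<close>

definition conn :: "'a set set \<Rightarrow> bool" where
  "conn F \<longleftrightarrow> F \<noteq> {} \<and> F \<subseteq> KE V \<and> (\<forall>e\<in>F. \<forall>f\<in>F. \<exists>C\<subseteq>F. circuit C \<and> e \<in> C \<and> f \<in> C)"

lemma conn_KE: "conn F \<Longrightarrow> F \<subseteq> KE V" and conn_nonempty: "conn F \<Longrightarrow> F \<noteq> {}"
  by (auto simp: conn_def)

lemma conn_circuit:
  assumes "conn F" "e \<in> F" "f \<in> F"
  obtains C where "C \<subseteq> F" "circuit C" "e \<in> C" "f \<in> C"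
  using assms unfolding conn_def by blast

lemma circuit_conn: "circuit C \<Longrightarrow> conn C"
  using circuit_KE circuit_nonempty unfolding conn_def by blast

lemma conn_Un:
  assumes F: "conn F" and C: "circuit C" and i: "C \<inter> F \<noteq> {}"
  shows "conn (F \<union> C)"
proof -
  obtain g where g: "g \<in> C" "g \<in> F" using i by blast
  have mixed: "\<exists>D\<subseteq>F \<union> C. circuit D \<and> e \<in> D \<and> f \<in> D" if ef: "e \<in> F" "f \<in> C" for e f
  proof -
    obtain C1 where C1: "C1 \<subseteq> F" "circuit C1" "e \<in> C1" "g \<in> C1" by (rule conn_circuit[OF F ef(1) g(2)])
    have "C1 \<inter> C \<noteq> {}" using C1 g by blast
    then obtain D where D: "circuit D" "D \<subseteq> C1 \<union> C" "e \<in> D" "f \<in> D"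
      using circuit_common[OF C1(2) C _ C1(3) ef(2)] by blast
    have "D \<subseteq> F \<union> C" using D(2) C1(1) by blast
    then show ?thesis using D by blast
  qed
  have FF: "\<exists>D\<subseteq>F \<union> C. circuit D \<and> e \<in> D \<and> f \<in> D" if ef: "e \<in> F" "f \<in> F" for e f
  proof -
    obtain D where "D \<subseteq> F" "circuit D" "e \<in> D" "f \<in> D" by (rule conn_circuit[OF F ef])
    then show ?thesis by blast
  qed
  have "\<exists>D\<subseteq>F \<union> C. circuit D \<and> e \<in> D \<and> f \<in> D" if ef: "e \<in> F \<union> C" "f \<in> F \<union> C" for e f
  proof (cases "e \<in> F")
    case True
    then show ?thesis using mixed FF ef(2) by (cases "f \<in> F") auto
  next
    case eF: False
    then have eC: "e \<in> C" using ef by blast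
    show ?thesis
    proof (cases "f \<in> C")
      case True
      then show ?thesis using C eC by blast
    next
      case False
      then have "f \<in> F" using ef by blast
      from mixed[OF this eC] show ?thesis by blast
    qed
  qed
  then show ?thesis using conn_nonempty[OF F] conn_KE[OF F] circuit_KE[OF C] unfolding conn_def by blast
qed

text \<open>The circuits through one fixed edge cover \<open>F\<close> and are rigid; the isometry
  that stops this edge stops each of them.\<close>

lemma conn_rigid: assumes "conn F" shows "rigid F"
  unfolding rigid_def
proof (intro allI impI ballI)
  fix m u w assume m: "\<forall>e\<in>F. est m e = 0" and uw: "u \<in> \<Union>F" "w \<in> \<Union>F"
  have FK: "F \<subseteq> KE V" by (rule conn_KE[OF assms])
  obtain e where e: "e \<in> F" using conn_nonempty[OF assms] by blast
  then have "e \<in> KE V" using FK by blast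
  then obtain a b where ab: "e = {a, b}" "a \<noteq> b" "a \<in> V" "b \<in> V" by (rule KE_E)
  have "strain m a b = 0" using m e est_pair[OF ab(3,4,2)] ab by auto
  then obtain \<alpha> \<beta> \<gamma> where t: "\<And>d. m (a, d) = tm \<alpha> \<beta> \<gamma> (a, d)" "\<And>d. m (b, d) = tm \<alpha> \<beta> \<gamma> (b, d)"
    using normalise_motion[OF ab(3,4,2), of m] by blast
  define m' where "m' i = m i - tm \<alpha> \<beta> \<gamma> i" for i
  have sm: "strain m' y z = strain m y z" for y z unfolding m'_def by (rule strain_tm)
  have ma: "m' (a, d) = 0" and mb: "m' (b, d) = 0" for d using t by (simp_all add: m'_def)
  have zero: "m' (v, d) = 0" if vF: "v \<in> \<Union>F" for v d
  proof -
    obtain f where f: "f \<in> F" "v \<in> f" using vF by blast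
    obtain C where C: "C \<subseteq> F" "circuit C" "e \<in> C" "f \<in> C" by (rule conn_circuit[OF assms e f(1)])
    have abU: "a \<in> \<Union>C" "b \<in> \<Union>C" "v \<in> \<Union>C" using C ab f by auto
    have str: "strain m y z = 0" if "y \<in> \<Union>C" "z \<in> \<Union>C" for y z
      using circuit_rigid[OF C(2)] m C(1) that unfolding rigid_def by blast
    have "v \<in> V" using f FK by (auto simp: KE_def)
    then show ?thesis
      by (rule motion_zero_third[OF ab(3,4) _ ab(2) _ _ ma mb])
        (simp_all only: sm str[OF abU(1,3)] str[OF abU(2,3)])
  qed
  have "strain m' u w = 0" using zero[OF uw(1)] zero[OF uw(2)] by (simp add: strain_def)
  then show "strain m u w = 0" by (simp add: sm)
qed

lemma conn_card: "conn F \<Longrightarrow> card F + 3 = 2 * card (\<Union>F) + s F"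
  by (rule rigid_card[OF conn_KE conn_nonempty conn_rigid])

lemma conn_stress:
  assumes "conn F" "e \<in> F" obtains \<omega> where "\<omega> \<in> S F" "\<omega> e \<noteq> 0"
proof -
  obtain C where C: "C \<subseteq> F" "circuit C" "e \<in> C" using conn_circuit[OF assms assms(2)] by metis
  obtain \<omega> where \<omega>: "\<omega> \<in> S C" "\<And>e. \<omega> e \<noteq> 0 \<longleftrightarrow> e \<in> C" by (rule circuit_stress[OF C(2)]) blast
  have "\<omega> \<in> S F" by (rule subsetD[OF St_mono[OF C(1)] \<omega>(1)])
  then show ?thesis using that \<omega>(2) C(3) by blast
qed

lemma s_remove:
  assumes "F \<subseteq> KE V" "\<omega> \<in> S F" "\<omega> e \<noteq> 0" shows "s F = s (F - {e}) + 1"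
proof -
  have e: "e \<in> F" by (rule St_supp[OF assms(2,3)])
  have "s (insert e (F - {e})) = s (F - {e}) + 1"
    by (rule s_insert_dep[of _ _ \<omega>]) (use assms e in \<open>auto simp: insert_absorb\<close>)
  then show ?thesis using e by (simp add: insert_absorb)
qed

lemma conn_s_pos: assumes "conn F" shows "1 \<le> s F"
proof -
  obtain e where e: "e \<in> F" using conn_nonempty[OF assms] by blast
  obtain \<omega> where "\<omega> \<in> S F" "\<omega> e \<noteq> 0" by (rule conn_stress[OF assms e])
  then show ?thesis using s_remove[OF conn_KE[OF assms]] by auto
qed

lemma conn_s1_circuit:
  assumes "conn F" "s F = 1" shows "circuit F"
proof -
  obtain e where e: "e \<in> F" using conn_nonempty[OF assms(1)] by blast
  obtain C where C: "C \<subseteq> F" "circuit C" "e \<in> C" using conn_circuit[OF assms(1) e e] by metis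
  have "f \<in> C" if f: "f \<in> F" for f
  proof (rule ccontr)
    assume nf: "f \<notin> C"
    obtain \<omega> where \<omega>: "\<omega> \<in> S F" "\<omega> f \<noteq> 0" by (rule conn_stress[OF assms(1) f])
    have "s (F - {f}) = 0" using s_remove[OF conn_KE[OF assms(1)] \<omega>] assms(2) by simp
    moreover have "s C \<le> s (F - {f})"
      using s_mono[of C "F - {f}"] C nf conn_KE[OF assms(1)] by blast
    ultimately show False using circuit_s[OF C(2)] by simp
  qed
  then have "C = F" using C by blast
  then show ?thesis using C by simp
qed

text \<open>\<open>H\<close> is a largest proper connected subset. By maximality, a circuit that
  meets \<open>H\<close> and leaves it contains all of \<open>F - H\<close>; so once an edge outside
  \<open>H\<close> is deleted, all remaining stresses live on \<open>H\<close>.\<close>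

lemma ear:
  assumes F: "conn F" and s2: "2 \<le> s F"
  obtains H where "conn H" "H \<subset> F" "s F = s H + 1"
proof -
  have FK: "F \<subseteq> KE V" "finite F" using conn_KE[OF F] finKE by auto
  define P where "P H \<longleftrightarrow> conn H \<and> H \<subset> F" for H
  obtain e0 where e0: "e0 \<in> F" using conn_nonempty[OF F] by blast
  obtain C0 where C0: "C0 \<subseteq> F" "circuit C0" using conn_circuit[OF F e0 e0] by metis
  have "C0 \<noteq> F" using circuit_s[OF C0(2)] s2 by auto
  then have "P C0" using C0 circuit_conn by (auto simp: P_def)
  moreover have "\<forall>H. P H \<longrightarrow> card H < card F"
    using psubset_card_mono[OF FK(2)] by (auto simp: P_def)
  ultimately obtain H where H: "P H" "\<And>H'. P H' \<Longrightarrow> card H' \<le> card H"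
    using ex_has_greatest_nat[of P C0 card "card F"] by blast
  have Hc: "conn H" "H \<subset> F" using H(1) by (auto simp: P_def)
  have cross: "F - H \<subseteq> C" if C: "circuit C" "C \<subseteq> F" "C \<inter> H \<noteq> {}" "\<not> C \<subseteq> H" for C
  proof (rule ccontr)
    assume "\<not> F - H \<subseteq> C"
    then have "P (H \<union> C)" using conn_Un[OF Hc(1) C(1) C(3)] Hc C by (auto simp: P_def)
    then have "card (H \<union> C) \<le> card H" by (rule H(2))
    moreover have "H \<subset> H \<union> C" "finite (H \<union> C)" using C FK finite_subset Hc by (blast, auto intro: finite_subset)
    ultimately show False using psubset_card_mono[of "H \<union> C" H] by linarith
  qed
  obtain e where e: "e \<in> F" "e \<notin> H" using Hc by blast
  obtain h where h: "h \<in> H" using conn_nonempty[OF Hc(1)] by blast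
  have hF: "h \<in> F" using h Hc by blast
  obtain C where C: "C \<subseteq> F" "circuit C" "e \<in> C" "h \<in> C" by (rule conn_circuit[OF F e(1) hF])
  have FHC: "F - H \<subseteq> C" by (rule cross[OF C(2,1)]) (use C e h in auto)
  have "S (F - {e}) = S H"
  proof
    show "S H \<subseteq> S (F - {e})" by (rule St_mono) (use Hc e in blast)
    show "S (F - {e}) \<subseteq> S H"
    proof
      fix \<omega> assume \<omega>: "\<omega> \<in> S (F - {e})"
      show "\<omega> \<in> S H"
      proof (rule St_restrict[OF \<omega>], rule ccontr)
        fix g assume g: "\<omega> g \<noteq> 0" "g \<notin> H"
        have "F - {e} \<subseteq> KE V" using FK by blast
        from circuit_exists[OF this \<omega> g(1)] obtain C' where C': "circuit C'" "g \<in> C'" "C' \<subseteq> F - {e}"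
          using St_supp[OF \<omega>] by blast
        show False
        proof (cases "C' \<inter> H = {}")
          case True
          then have "C' \<subseteq> C" using C'(3) FHC by blast
          then have "C' = C" by (rule circuit_minimal[OF C(2) C'(1)])
          then show False using C'(3) C(3) by blast
        next
          case False
          have "F - H \<subseteq> C'" by (rule cross[OF C'(1) _ False]) (use C' g in auto)
          then show False using e C'(3) by blast
        qed
      qed
    qed
  qed
  then have "s (F - {e}) = s H" by (simp add: s_def)
  moreover obtain \<omega> where "\<omega> \<in> S F" "\<omega> e \<noteq> 0" by (rule conn_stress[OF F e(1)])
  then have "s F = s (F - {e}) + 1" by (rule s_remove[OF FK(1)])
  ultimately show ?thesis using that Hc by simp
qed

lemma conn_degree:
  assumes "conn F" "x \<in> \<Union>F" shows "3 \<le> card (star F x)"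
proof -
  obtain e where e: "e \<in> F" "x \<in> e" using assms(2) by blast
  obtain C where C: "C \<subseteq> F" "circuit C" "e \<in> C" using conn_circuit[OF assms(1) e(1) e(1)] by metis
  have "3 \<le> card (star C x)" by (rule circuit_degree[OF C(2)]) (use C e in auto)
  also have "\<dots> \<le> card (star F x)"
    by (rule card_mono) (use C finKE[OF conn_KE[OF assms(1)]] in \<open>auto simp: star_def\<close>)
  finally show ?thesis .
qed

section \<open>Spans of stress matrices in critical graphs\<close>

text \<open>The sum of the column spaces of the stress matrices of \<open>F\<close>.\<close>

definition Lsp :: "'a set set \<Rightarrow> ('a \<Rightarrow> real) set" where
  "Lsp F = fs.span {L \<omega> w | \<omega> w. \<omega> \<in> S F}"

definition R :: "'a set set \<Rightarrow> nat" where "R F = fs.dim (Lsp F)"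

lemma affperp_subspace: "fs.subspace affperp"
  unfolding fs.subspace_def affperp_def using subspace_supp_in[of V]
  by (auto simp: fs.subspace_def ip_add ip_scale)

lemma Lsp_affperp: "Lsp F \<subseteq> affperp"
  unfolding Lsp_def by (rule fs.span_minimal[OF _ affperp_subspace]) (use lap_affperp in auto)

lemma Lsp_supp: "Lsp F \<subseteq> supp_in V"
  using Lsp_affperp by (auto simp: affperp_def)

lemma lap_Lsp: "\<omega> \<in> S F \<Longrightarrow> L \<omega> w \<in> Lsp F"
  unfolding Lsp_def by (rule fs.span_base) blast

lemma Lsp_subspace: "fs.subspace (Lsp F)"
  unfolding Lsp_def by simp

lemma Lsp_mono: "F \<subseteq> G \<Longrightarrow> Lsp F \<subseteq> Lsp G"
  unfolding Lsp_def by (rule fs.span_mono) (use St_mono in blast)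

lemma dim_affperp: "fs.dim affperp + 3 = card V"
proof -
  obtain T where T: "T \<subseteq> V" "card T = 3" using obtain_subset_with_card_n[OF card3] by metis
  then obtain a b c where abc: "a \<in> V" "b \<in> V" "c \<in> V" "a \<noteq> b" "b \<noteq> c" "a \<noteq> c" by (auto simp: card_3_iff)
  define A0 where "A0 = (supp_in V :: ('a \<Rightarrow> real) set)"
  define A1 where "A1 = {l \<in> A0. ip V l (\<lambda>v. 1) = 0}"
  define A2 where "A2 = {l \<in> A1. ip V l X = 0}"
  have s0: "fs.subspace A0" unfolding A0_def by (rule subspace_supp_in)
  have s1: "fs.subspace A1" unfolding A1_def using s0 by (auto simp: fs.subspace_def ip_add ip_scale)
  have s2: "fs.subspace A2" unfolding A2_def using s1 by (auto simp: fs.subspace_def ip_add ip_scale)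
  have sub: "A0 \<subseteq> supp_in V" "A1 \<subseteq> supp_in V" "A2 \<subseteq> supp_in V"
    by (auto simp: A0_def A1_def A2_def)
  \<comment> \<open>Cofactors: \<open>l3\<close> is orthogonal to the constants and to the first
    coordinates, and pairs with the second coordinates to \<open>- tri p a b c\<close>.\<close>
  define l3 where "l3 v = (if v = a then X b - X c else if v = b then X c - X a else if v = c then X a - X b else 0)" for v
  define l2 where "l2 v = (if v = a then 1 else if v = b then -1 else 0 :: real)" for v
  have ip3: "ip V l3 h = l3 a * h a + l3 b * h b + l3 c * h c" for h
  proof -
    have "ip V l3 h = (\<Sum>v\<in>{a, b, c}. l3 v * h v)"
      unfolding ip_def by (rule sum.mono_neutral_right) (use abc finV in \<open>auto simp: l3_def\<close>)
    then show ?thesis using abc by simp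
  qed
  have ip2: "ip V l2 h = h a - h b" for h
  proof -
    have "ip V l2 h = (\<Sum>v\<in>{a, b}. l2 v * h v)"
      unfolding ip_def by (rule sum.mono_neutral_right) (use abc finV in \<open>auto simp: l2_def\<close>)
    then show ?thesis using abc by (simp add: l2_def)
  qed
  have "fs.dim A0 = fs.dim A1 + 1"
    unfolding A1_def
  proof (rule dim_functional[of V A0 "\<lambda>l. ip V l (\<lambda>v. 1)" "unit_fun a", OF finV sub(1) s0 ip_add ip_scale])
    show "unit_fun a \<in> A0" using abc by (auto simp: A0_def supp_in_def unit_fun_def)
    show "ip V (unit_fun a) (\<lambda>v. 1) \<noteq> 0" using abc finV by (simp add: ip_def unit_fun_def)
  qed
  moreover have "fs.dim A1 = fs.dim A2 + 1"
    unfolding A2_def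
  proof (rule dim_functional[of V A1 "\<lambda>l. ip V l X" l2, OF finV sub(2) s1 ip_add ip_scale])
    show "l2 \<in> A1" using abc ip2 by (auto simp: A1_def A0_def supp_in_def l2_def)
    show "ip V l2 X \<noteq> 0" using ip2 coord_generic[OF gen abc(1,2,4), of 1] by simp
  qed
  moreover have "fs.dim A2 = fs.dim {l \<in> A2. ip V l Y = 0} + 1"
  proof (rule dim_functional[of V A2 "\<lambda>l. ip V l Y" l3, OF finV sub(3) s2 ip_add ip_scale])
    have l: "l3 a = X b - X c" "l3 b = X c - X a" "l3 c = X a - X b" using abc by (auto simp: l3_def)
    have "ip V l3 (\<lambda>v. 1) = 0" "ip V l3 X = 0" by (simp_all add: ip3 l algebra_simps)
    then show "l3 \<in> A2"
      using abc by (auto simp: A2_def A1_def A0_def supp_in_def l3_def)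
    have "ip V l3 Y = - tri p a b c" by (simp add: ip3 l tri_def algebra_simps)
    then show "ip V l3 Y \<noteq> 0" using tri_generic[OF gen abc(1-3)] abc by simp
  qed
  moreover have "{l \<in> A2. ip V l Y = 0} = affperp" by (auto simp: affperp_def A2_def A1_def A0_def)
  moreover have "fs.dim A0 = card V" unfolding A0_def by (rule dim_supp_in[OF finV])
  ultimately show ?thesis by simp
qed

lemma R_le: "R F + 3 \<le> card V"
proof -
  have "R F \<le> fs.dim affperp"
    unfolding R_def by (rule dim_mono_supp[OF finV _ Lsp_affperp]) (auto simp: affperp_def)
  then show ?thesis using dim_affperp by simp
qed

lemma lap_zero_outside:
  assumes "\<omega> \<in> S F" "x \<notin> \<Union>F" shows "L \<omega> z x = 0"
proof -
  have "\<omega> {x, y} = 0" for y using assms St_supp[OF assms(1), of "{x, y}"] by blast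
  then show ?thesis by (simp add: lap_def)
qed

end

text \<open>The content of stress-independence at one generic \<open>p\<close>: deleting an edge
  that carries a stress enlarges \<open>NS\<close>. Edges without stress are unrestricted, since
  linkedness already fails for them.\<close>

locale critical = framework +
  fixes E :: "'a set set"
  assumes EK: "E \<subseteq> KE V"
    and crit: "\<And>e \<omega>. e \<in> E \<Longrightarrow> \<omega> \<in> St V p E \<Longrightarrow> \<omega> e \<noteq> 0 \<Longrightarrow> \<not> NS V p (E - {e}) \<subseteq> NS V p E"
begin

text \<open>A stress minus a suitable multiple of \<open>\<omega>0\<close> avoids \<open>e\<close>
  and is therefore satisfied by \<open>z\<close>. So \<open>L \<omega> z\<close> depends on \<omega>
  only through its value at \<open>e\<close>.\<close>

lemma crit_vector:
  assumes F: "F \<subseteq> E" and \<omega>0: "\<omega>0 \<in> S F" "\<omega>0 e \<noteq> 0"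
  obtains z a where "a \<noteq> 0" "a \<in> Lsp F" "\<And>\<omega>. \<omega> \<in> S F \<Longrightarrow> L \<omega> z = (\<lambda>x. \<omega> e * a x)"
proof -
  have \<omega>0E: "\<omega>0 \<in> S E" by (rule subsetD[OF St_mono[OF F] \<omega>0(1)])
  have eE: "e \<in> E" by (rule St_supp[OF \<omega>0E \<omega>0(2)])
  obtain z where z: "z \<in> NS V p (E - {e})" "z \<notin> NS V p E" using crit[OF eE \<omega>0E \<omega>0(2)] by blast
  have red: "L \<omega> z = (\<lambda>x. \<omega> e / \<omega>0 e * L \<omega>0 z x)" if "\<omega> \<in> S E" for \<omega>
  proof -
    let ?\<sigma> = "\<lambda>g. \<omega> g - (\<omega> e / \<omega>0 e) * \<omega>0 g"
    have "?\<sigma> \<in> S E" using St_comb[OF that \<omega>0E, of "\<omega> e / \<omega>0 e"] by simp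
    then have "?\<sigma> \<in> S (E - {e})"
      by (rule St_restrict) (use St_supp[OF \<open>?\<sigma> \<in> S E\<close>] \<omega>0 in auto)
    then have 0: "L ?\<sigma> z = 0" using z(1) by (simp add: NS_def)
    have "?\<sigma> = \<omega> + (\<lambda>g. (- (\<omega> e / \<omega>0 e)) * \<omega>0 g)" by (auto simp: fun_eq_iff)
    then have "L ?\<sigma> z = L \<omega> z + (\<lambda>x. (- (\<omega> e / \<omega>0 e)) * L \<omega>0 z x)"
      by (simp only: lap_add_left lap_scale_left)
    then have "L \<omega> z x + (- (\<omega> e / \<omega>0 e)) * L \<omega>0 z x = 0" for x
      using 0 by (metis plus_fun_apply zero_fun_apply)
    then show ?thesis by (auto simp: fun_eq_iff algebra_simps)
  qed
  define a where "a = (\<lambda>x. (1 / \<omega>0 e) * L \<omega>0 z x)"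
  have "L \<omega> z = (\<lambda>x. \<omega> e * a x)" if "\<omega> \<in> S E" for \<omega>
    using red[OF that] by (simp add: a_def)
  moreover have "a \<noteq> 0"
  proof
    assume "a = 0"
    then have "L \<omega> z = 0" if "\<omega> \<in> S E" for \<omega> using calculation[OF that] by (auto simp: fun_eq_iff)
    then show False using z(2) by (simp add: NS_def)
  qed
  moreover have "a \<in> Lsp F"
    unfolding a_def by (rule fs.subspace_scale[OF Lsp_subspace lap_Lsp[OF \<omega>0(1)]])
  ultimately show ?thesis using that[of a z] St_mono[OF F] by blast
qed

text \<open>The vector \<open>z\<close> is orthogonal to \<open>Lsp (F - {e})\<close>, while
  \<open>L \<omega> a\<close> in \<open>Lsp F\<close> pairs with it to
  \<open>\<omega> e * ip V a a\<close>, which is nonzero over the reals.\<close>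

lemma R_remove:
  assumes F: "F \<subseteq> E" and \<omega>: "\<omega> \<in> S F" "\<omega> e \<noteq> 0"
  shows "R (F - {e}) < R F"
proof -
  obtain z a where za: "a \<noteq> 0" "a \<in> Lsp F" "\<And>\<omega>. \<omega> \<in> S F \<Longrightarrow> L \<omega> z = (\<lambda>x. \<omega> e * a x)"
    by (rule crit_vector[OF F \<omega>]) blast
  have sub: "fs.subspace {l. ip V l z = 0}" by (auto simp: fs.subspace_def ip_add ip_scale)
  have "Lsp (F - {e}) \<subseteq> {l. ip V l z = 0}"
    unfolding Lsp_def
  proof (rule fs.span_minimal[OF _ sub], safe)
    fix \<tau> w assume \<tau>: "\<tau> \<in> S (F - {e})"
    have "\<tau> \<in> S F" by (rule subsetD[OF St_mono \<tau>]) auto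
    moreover have "\<tau> e = 0" using St_supp[OF \<tau>, of e] by blast
    ultimately have "L \<tau> z = 0" using za(3)[of \<tau>] by (auto simp: fun_eq_iff)
    then show "ip V (L \<tau> w) z = 0" by (simp add: ip_lap)
  qed
  moreover have "ip V (L \<omega> a) z = \<omega> e * ip V a a"
    unfolding ip_lap za(3)[OF \<omega>(1)] by (simp add: ip_def sum_distrib_left mult_ac)
  moreover have "ip V a a \<noteq> 0" using ip_self_eq_0[OF finV] za(1,2) Lsp_supp by blast
  ultimately have "L \<omega> a \<notin> Lsp (F - {e})" using \<omega>(2) by auto
  moreover have "L \<omega> a \<in> Lsp F" by (rule lap_Lsp[OF \<omega>(1)])
  ultimately show ?thesis
    unfolding R_def by (intro dim_less_supp[OF finV Lsp_supp Lsp_mono Lsp_subspace]) auto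
qed

text \<open>An edge that closes a stress raises \<open>s\<close> by one and \<open>R\<close> by at
  least one; any other edge changes neither. The sums avoid subtraction of natural numbers.\<close>

lemma excess_mono:
  assumes "F \<subseteq> G" "G \<subseteq> E" shows "R F + s G \<le> R G + s F"
proof -
  have "R F + s (F \<union> T) \<le> R (F \<union> T) + s F" if "finite T" "T \<subseteq> G" for T
    using that
  proof (induction T rule: finite_induct)
    case empty
    then show ?case by simp
  next
    case (insert e T)
    have IH: "R F + s (F \<union> T) \<le> R (F \<union> T) + s F" using insert by simp
    show ?case
    proof (cases "e \<in> F \<union> T")
      case True
      then show ?thesis using IH by (simp add: insert_absorb)
    next
      case False
      let ?G = "insert e (F \<union> T)"
      have GE: "?G \<subseteq> E" using insert.prems assms by auto
      have GK: "?G \<subseteq> KE V" using GE EK by blast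
      show ?thesis
      proof (cases "\<exists>\<omega>\<in>S ?G. \<omega> e \<noteq> 0")
        case True
        then obtain \<omega> where \<omega>: "\<omega> \<in> S ?G" "\<omega> e \<noteq> 0" by blast
        have "?G - {e} = F \<union> T" using False by blast
        then have "R (F \<union> T) < R ?G" "s ?G = s (F \<union> T) + 1"
          using R_remove[OF GE \<omega>] s_remove[OF GK \<omega>] by auto
        then show ?thesis using IH by simp
      next
        case 2: False
        then have "S ?G = S (F \<union> T)" using S_insert_indep[OF False] by blast
        then show ?thesis using IH by (simp add: s_def R_def Lsp_def)
      qed
    qed
  qed
  from this[of "G - F"] show ?thesis
    using finKE[of G] EK assms by (simp add: Un_absorb1 subset_trans)
qed

end

section \<open>Connected graphs with two independent stresses\<close>

text \<open>\<open>chordless\<close> is an assumption because it has two sources: the induction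
  hypothesis while chords are being excluded, and the finished result afterwards. It concerns only
  circuits that miss a vertex of \<open>H\<close>, which makes that induction possible.\<close>

locale theta = critical +
  fixes H :: "'a set set"
  assumes Hc: "conn H" and HE: "H \<subseteq> E" and s2: "s H = 2" and R4: "R H \<le> 4"
    and chordless: "\<And>C f. C \<subseteq> H \<Longrightarrow> circuit C \<Longrightarrow> \<Union>C \<noteq> \<Union>H \<Longrightarrow> f \<in> H - C \<Longrightarrow> \<not> f \<subseteq> \<Union>C"
begin

text \<open>Each edge of \<open>H\<close> lies outside exactly one circuit, so the sets \<open>H - C\<close> partition \<open>H\<close> and the vertex
  sets \<open>A C\<close> missed by the circuits are disjoint.\<close>

definition CC where "CC = {C. C \<subseteq> H \<and> circuit C}"

definition A where "A C = \<Union>H - \<Union>C"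

definition Q where "Q = {v \<in> \<Union>H. \<forall>C\<in>CC. v \<in> \<Union>C}"

lemma HK: "H \<subseteq> KE V" using HE EK by blast
lemma finH: "finite H" by (rule finKE[OF HK])
lemma fW: "finite (\<Union>H)" and WV: "\<Union>H \<subseteq> V" using finite_Union_KE[OF finV HK] by auto
lemma finA: "finite (A C)" using fW by (simp add: A_def)
lemma finQ: "finite Q" by (rule finite_subset[OF _ fW]) (auto simp: Q_def)
lemma finCC: "finite CC" by (rule finite_subset[of _ "Pow H"]) (auto simp: CC_def finH)
lemma CC_H: "C \<in> CC \<Longrightarrow> C \<subseteq> H" and CC_circuit: "C \<in> CC \<Longrightarrow> circuit C" by (auto simp: CC_def)

lemma s_H_remove: assumes "f \<in> H" shows "s (H - {f}) = 1"
proof -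
  obtain \<omega> where "\<omega> \<in> S H" "\<omega> f \<noteq> 0" by (rule conn_stress[OF Hc assms])
  then show ?thesis using s_remove[OF HK] s2 by fastforce
qed

lemma avoiding_exists: assumes "f \<in> H" obtains C where "C \<in> CC" "f \<notin> C"
proof -
  have K: "H - {f} \<subseteq> KE V" using HK by blast
  have "\<not> S (H - {f}) \<subseteq> {0}" using s_0_iff[OF K] s_H_remove[OF assms] by simp
  then obtain \<omega> where "\<omega> \<in> S (H - {f})" "\<omega> \<noteq> 0" by blast
  moreover from this obtain e where "\<omega> e \<noteq> 0" by (auto simp: fun_eq_iff)
  ultimately have \<omega>: "\<omega> \<in> S (H - {f})" "\<omega> e \<noteq> 0" by auto
  then obtain C where C: "circuit C" "C \<subseteq> {g. \<omega> g \<noteq> 0}" using circuit_exists[OF K \<omega>] by blast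
  then have "C \<subseteq> H - {f}" using St_supp[OF \<omega>(1)] by blast
  then show ?thesis using that[of C] C by (auto simp: CC_def)
qed

text \<open>Two different circuits avoiding \<open>f\<close> would give two independent stresses of
  \<open>H - {f}\<close>, which has only one.\<close>

lemma avoiding_unique:
  assumes C: "C \<in> CC" "C' \<in> CC" and f: "f \<in> H" "f \<notin> C" "f \<notin> C'" shows "C = C'"
proof (rule ccontr)
  assume ne: "C \<noteq> C'"
  have cc: "circuit C" "circuit C'" using C CC_circuit by auto
  obtain g where g: "g \<in> C" "g \<notin> C'" using circuit_minimal[OF cc(2,1)] ne by blast
  have K: "H - {f} \<subseteq> KE V" using HK by blast
  obtain \<omega> where \<omega>: "\<omega> \<in> S C" "\<And>e. \<omega> e \<noteq> 0 \<longleftrightarrow> e \<in> C" by (rule circuit_stress[OF cc(1)]) blast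
  have "C \<subseteq> H - {f}" using f CC_H[OF C(1)] by blast
  then have "\<omega> \<in> S (H - {f})" using \<omega>(1) by (rule subsetD[OF St_mono])
  then have "s (H - {f}) = s (H - {f} - {g}) + 1" by (rule s_remove[OF K]) (use \<omega> g in simp)
  then have "s (H - {f} - {g}) = 0" using s_H_remove[OF f(1)] by simp
  moreover have "s C' \<le> s (H - {f} - {g})"
    using s_mono[of C' "H - {f} - {g}"] f g CC_H[OF C(2)] HK by blast
  ultimately show False using circuit_s[OF cc(2)] by simp
qed

lemma CC_ne: assumes "C \<in> CC" shows "\<exists>e. e \<in> H - C"
proof (rule ccontr)
  assume "\<nexists>e. e \<in> H - C"
  then have "C = H" using CC_H[OF assms] by blast
  then show False using circuit_s[OF CC_circuit[OF assms]] s2 by simp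
qed

definition eC where "eC C = (SOME e. e \<in> H - C)"

lemma eC: assumes "C \<in> CC" shows "eC C \<in> H" "eC C \<notin> C"
  using someI_ex[OF CC_ne[OF assms]] by (auto simp: eC_def)

lemma eC_other: "C \<in> CC \<Longrightarrow> C' \<in> CC \<Longrightarrow> C' \<noteq> C \<Longrightarrow> eC C \<in> C'"
  using avoiding_unique eC by metis

definition sg where "sg C = (SOME \<omega>. \<omega> \<in> S C \<and> (\<forall>e. \<omega> e \<noteq> 0 \<longleftrightarrow> e \<in> C))"

lemma sg: assumes "C \<in> CC" shows "sg C \<in> S C" "sg C e \<noteq> 0 \<longleftrightarrow> e \<in> C" "sg C \<in> S H"
proof -
  obtain \<omega> where \<omega>: "\<omega> \<in> S C" "\<And>e. \<omega> e \<noteq> 0 \<longleftrightarrow> e \<in> C"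
    by (rule circuit_stress[OF CC_circuit[OF assms]]) blast
  then have "\<exists>\<omega>. \<omega> \<in> S C \<and> (\<forall>e. \<omega> e \<noteq> 0 \<longleftrightarrow> e \<in> C)" by blast
  from someI_ex[OF this] show 1: "sg C \<in> S C" and "sg C e \<noteq> 0 \<longleftrightarrow> e \<in> C" by (auto simp: sg_def)
  show "sg C \<in> S H" by (rule subsetD[OF St_mono[OF CC_H[OF assms]] 1])
qed

lemma sg_eC: "C \<in> CC \<Longrightarrow> C' \<in> CC \<Longrightarrow> sg C' (eC C) = 0 \<longleftrightarrow> C' = C"
  using sg(2)[of C' "eC C"] eC eC_other by metis

lemma other_circuit: assumes "C \<in> CC" obtains C' where "C' \<in> CC" "C' \<noteq> C"
proof -
  have "C \<noteq> {}" by (rule circuit_nonempty[OF CC_circuit[OF assms]])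
  then obtain f where f: "f \<in> C" by blast
  then have "f \<in> H" using CC_H[OF assms] by blast
  then obtain C' where "C' \<in> CC" "f \<notin> C'" by (rule avoiding_exists)
  then show ?thesis using that f by blast
qed

lemma missing_edge: "x \<in> A C \<Longrightarrow> x \<in> f \<Longrightarrow> f \<notin> C"
  by (auto simp: A_def)

lemma A_disjoint_edge:
  assumes "C \<in> CC" "C' \<in> CC" "C \<noteq> C'" "x \<in> A C" "y \<in> A C'" shows "{x, y} \<notin> H" "x \<noteq> y"
proof -
  have "{x, y} \<notin> C" "{x, y} \<notin> C'" using missing_edge[OF assms(4)] missing_edge[OF assms(5)] by simp_all
  then show "{x, y} \<notin> H" using avoiding_unique[OF assms(1,2), of "{x, y}"] assms(3) by auto
  show "x \<noteq> y"
  proof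
    assume "x = y"
    obtain f where f: "f \<in> H" "x \<in> f" using assms(4) by (auto simp: A_def)
    then have "f \<notin> C" "f \<notin> C'" using missing_edge[OF assms(4)] missing_edge[OF assms(5)] \<open>x = y\<close> by simp_all
    then show False using avoiding_unique[OF assms(1,2) f(1)] assms(3) by simp
  qed
qed

lemma card_H: "card H + 1 = 2 * card (\<Union>H)"
  using conn_card[OF Hc] s2 by simp

lemma card_A: assumes "C \<in> CC" shows "card (A C) + card (\<Union>C) = card (\<Union>H)"
proof -
  have "\<Union>C \<subseteq> \<Union>H" using CC_H[OF assms] by blast
  then show ?thesis unfolding A_def using fW
    by (metis card_Diff_subset card_mono finite_subset le_add_diff_inverse2)
qed

text \<open>By rigidity \<open>H\<close> has \<open>2 * card (\<Union>H) - 1\<close> edges and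
  \<open>C\<close> has \<open>2 * card (\<Union>C) - 2\<close>.\<close>

lemma card_class: assumes "C \<in> CC" shows "card (H - C) = 2 * card (A C) + 1"
proof -
  have "card (H - C) + card C = card H"
    using CC_H[OF assms] finH by (metis card_Diff_subset card_mono finite_subset le_add_diff_inverse2)
  then show ?thesis
    using card_H card_A[OF assms] circuit_card[OF CC_circuit[OF assms]] by linarith
qed

lemma classes_partition: "H = (\<Union>C\<in>CC. H - C)"
  using avoiding_exists by blast

lemma card_classes: "(\<Sum>C\<in>CC. card (H - C)) = card H"
proof -
  have "card (\<Union>C\<in>CC. H - C) = (\<Sum>C\<in>CC. card (H - C))"
    by (rule card_UN_disjoint) (use finCC finH avoiding_unique in blast)+
  then show ?thesis using classes_partition by simp
qed

lemma card_vertices: "card (\<Union>H) = card Q + (\<Sum>C\<in>CC. card (A C))"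
proof -
  have "\<Union>H = Q \<union> (\<Union>C\<in>CC. A C)" by (auto simp: Q_def A_def)
  moreover have "Q \<inter> (\<Union>C\<in>CC. A C) = {}" by (auto simp: Q_def A_def)
  moreover note finQ
  moreover have "card (\<Union>C\<in>CC. A C) = (\<Sum>C\<in>CC. card (A C))"
    by (rule card_UN_disjoint) (use finCC finA A_disjoint_edge(2) in blast)+
  moreover have "finite (\<Union>C\<in>CC. A C)" using finCC finA by blast
  ultimately show ?thesis by (metis card_Un_disjoint)
qed

text \<open>The classes partition the edges, while \<open>Q\<close> and the sets \<open>A C\<close>
  partition the vertices; when \<open>card_class\<close> is summed, the contributions of the sets
  \<open>A C\<close> cancel.\<close>

lemma card_CC: "card CC + 1 = 2 * card Q"
proof -
  have "(\<Sum>C\<in>CC. card (H - C)) = 2 * (\<Sum>C\<in>CC. card (A C)) + card CC"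
    using sum.cong[OF refl card_class, of CC] by (simp add: sum_Suc sum_distrib_left)
  then show ?thesis using card_classes card_vertices card_H by linarith
qed

lemma za_exists:
  assumes "C \<in> CC"
  shows "\<exists>z a. a \<noteq> 0 \<and> a \<in> Lsp H \<and> (\<forall>\<omega>\<in>S H. L \<omega> z = (\<lambda>x. \<omega> (eC C) * a x))"
proof -
  obtain C' where C': "C' \<in> CC" "C' \<noteq> C" by (rule other_circuit[OF assms])
  have nz: "sg C' (eC C) \<noteq> 0" using sg_eC[OF assms C'(1)] C'(2) by simp
  obtain z a where "a \<noteq> 0" "a \<in> Lsp H" "\<And>\<omega>. \<omega> \<in> S H \<Longrightarrow> L \<omega> z = (\<lambda>x. \<omega> (eC C) * a x)"
    by (rule crit_vector[OF HE sg(3)[OF C'(1)] nz]) blast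
  then show ?thesis by blast
qed

text \<open>A choice of the vectors of \<open>crit_vector\<close> for the class of edges outside the circuit \<open>C\<close>.\<close>

definition zz where "zz C = (SOME z. \<exists>a. a \<noteq> 0 \<and> a \<in> Lsp H \<and> (\<forall>\<omega>\<in>S H. L \<omega> z = (\<lambda>x. \<omega> (eC C) * a x)))"

definition aa where "aa C = (SOME a. a \<noteq> 0 \<and> a \<in> Lsp H \<and> (\<forall>\<omega>\<in>S H. L \<omega> (zz C) = (\<lambda>x. \<omega> (eC C) * a x)))"

lemma aa: assumes "C \<in> CC"
  shows "aa C \<noteq> 0" "aa C \<in> Lsp H" "\<And>\<omega>. \<omega> \<in> S H \<Longrightarrow> L \<omega> (zz C) = (\<lambda>x. \<omega> (eC C) * aa C x)"
proof -
  have "\<exists>a. a \<noteq> 0 \<and> a \<in> Lsp H \<and> (\<forall>\<omega>\<in>S H. L \<omega> (zz C) = (\<lambda>x. \<omega> (eC C) * a x))"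
    unfolding zz_def by (rule someI_ex[OF za_exists[OF assms]])
  from someI_ex[OF this] show "aa C \<noteq> 0" "aa C \<in> Lsp H"
      "\<And>\<omega>. \<omega> \<in> S H \<Longrightarrow> L \<omega> (zz C) = (\<lambda>x. \<omega> (eC C) * aa C x)"
    unfolding aa_def by blast+
qed

lemma aa_supp:
  assumes "C \<in> CC" "C' \<in> CC" "C' \<noteq> C" "aa C x \<noteq> 0" shows "x \<in> \<Union>C'"
proof (rule ccontr)
  assume "x \<notin> \<Union>C'"
  then have "L (sg C') (zz C) x = 0" by (rule lap_zero_outside[OF sg(1)[OF assms(2)]])
  then have "sg C' (eC C) * aa C x = 0" using aa(3)[OF assms(1) sg(3)[OF assms(2)]] by simp
  then show False using sg_eC[OF assms(1,2)] assms(3,4) by simp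
qed

text \<open>For every other circuit \<open>C'\<close>, \<open>aa C\<close> is a multiple of
  \<open>L (sg C') (zz C)\<close> and so vanishes off \<open>C'\<close>. Its support is thus
  confined to \<open>Q \<union> A C\<close>, and an affine dependence involves at least four
  points.\<close>

lemma Q_A_ge4: assumes "C \<in> CC" shows "4 \<le> card Q + card (A C)"
proof -
  obtain C' where C': "C' \<in> CC" "C' \<noteq> C" by (rule other_circuit[OF assms])
  have "4 \<le> card {v \<in> V. aa C v \<noteq> 0}"
    using affperp_support[of "aa C"] aa[OF assms] Lsp_affperp by blast
  also have "\<dots> \<le> card (Q \<union> A C)"
  proof (rule card_mono)
    show "finite (Q \<union> A C)" using finQ finA by simp
    show "{v \<in> V. aa C v \<noteq> 0} \<subseteq> Q \<union> A C"
    proof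
      fix v assume "v \<in> {v \<in> V. aa C v \<noteq> 0}"
      then have "\<And>D. D \<in> CC \<Longrightarrow> D \<noteq> C \<Longrightarrow> v \<in> \<Union>D" using aa_supp[OF assms] by blast
      moreover have "v \<in> \<Union>H" using calculation[OF C'] CC_H[OF C'(1)] by blast
      ultimately show "v \<in> Q \<union> A C" by (cases "v \<in> \<Union>C") (auto simp: Q_def A_def)
    qed
  qed
  also have "\<dots> \<le> card Q + card (A C)" by (rule card_Un_le)
  finally show ?thesis .
qed

lemma class_edges_touch:
  assumes "C \<in> CC" "A C \<noteq> {}" "f \<in> H - C" shows "\<exists>x\<in>A C. x \<in> f"
proof -
  have "\<Union>C \<noteq> \<Union>H" using assms(2) by (auto simp: A_def)
  then have "\<not> f \<subseteq> \<Union>C" by (rule chordless[OF CC_H[OF assms(1)] CC_circuit[OF assms(1)] _ assms(3)])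
  then show ?thesis using assms(3) by (auto simp: A_def)
qed

lemma star_class: "x \<in> A C \<Longrightarrow> star H x \<subseteq> H - C"
  by (auto simp: star_def A_def)

text \<open>Otherwise \<open>A C\<close> would be a single vertex of degree three with vanishing diagonal entry, and its row
  an affine dependence of its three neighbours.\<close>

lemma block_nonzero:
  assumes C: "C \<in> CC" "A C \<noteq> {}" and C': "C' \<in> CC" "C' \<noteq> C"
  shows "\<exists>x\<in>A C. \<exists>y\<in>A C. L (sg C') (unit_fun x) y \<noteq> 0"
proof (rule ccontr)
  assume "\<not> ?thesis"
  then have z: "\<And>x y. x \<in> A C \<Longrightarrow> y \<in> A C \<Longrightarrow> L (sg C') (unit_fun x) y = 0" by blast
  have AV: "A C \<subseteq> V" using WV by (auto simp: A_def)
  have HC: "H - C \<subseteq> C'" using avoiding_unique[OF C(1) C'(1)] C'(2) by blast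
  have noedge: "{x, y} \<notin> H" if "x \<in> A C" "y \<in> A C" "x \<noteq> y" for x y
  proof
    assume "{x, y} \<in> H"
    then have "{x, y} \<in> C'" using HC missing_edge[OF that(1), of "{x, y}"] by blast
    then have "sg C' {x, y} \<noteq> 0" using sg(2)[OF C'(1)] by blast
    moreover have "x \<in> V" "y \<in> V" using that AV by auto
    ultimately show False using z[OF that(1,2)] lap_unit[OF finV _ _ that(3), of "sg C'"] by simp
  qed
  \<comment> \<open>Without edges inside \<open>A C\<close> the stars are disjoint and make up
    \<open>H - C\<close>. Degrees of at least 3 with sum \<open>2 * card (A C) + 1\<close> leave
    room for one vertex only.\<close>
  have "card (\<Union>x\<in>A C. star H x) = (\<Sum>x\<in>A C. card (star H x))"
  proof (rule card_UN_disjoint[OF finA])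
    show "\<forall>i\<in>A C. finite (star H i)" using finH by (simp add: star_def)
    show "\<forall>i\<in>A C. \<forall>j\<in>A C. i \<noteq> j \<longrightarrow> star H i \<inter> star H j = {}"
    proof safe
      fix x y e assume xy: "x \<in> A C" "y \<in> A C" "x \<noteq> y" and e: "e \<in> star H x" "e \<in> star H y"
      have "e \<in> KE V" using e HK by (auto simp: star_def)
      then have "e = {x, y}" using e xy(3) by (auto simp: star_def KE_def card_2_iff)
      then show "e \<in> {}" using noedge[OF xy] e by (auto simp: star_def)
    qed
  qed
  moreover have "(\<Union>x\<in>A C. star H x) = H - C"
    using class_edges_touch[OF C] star_class by (fastforce simp: star_def)
  ultimately have sum: "(\<Sum>x\<in>A C. card (star H x)) = 2 * card (A C) + 1" using card_class[OF C(1)] by simp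
  have d3: "3 \<le> card (star H x)" if "x \<in> A C" for x
    by (rule conn_degree[OF Hc]) (use that in \<open>auto simp: A_def\<close>)
  have "3 * card (A C) \<le> (\<Sum>x\<in>A C. card (star H x))"
    using sum_bounded_below[of "A C" 3 "\<lambda>x. card (star H x)"] d3 by simp
  then have "card (A C) \<le> 1" using sum by simp
  then have "card (A C) = 1" using C(2) finA by (simp add: le_Suc_eq)
  then obtain x where x: "A C = {x}" by (auto simp: card_1_singleton_iff)
  have dx: "card (star H x) = 3" using sum x by simp
  have xV: "x \<in> V" using AV x by blast
  let ?r = "L (sg C') (unit_fun x)"
  have supp: "{v \<in> V. ?r v \<noteq> 0} \<subseteq> {v \<in> V - {x}. {x, v} \<in> H}"
  proof
    fix v assume v: "v \<in> {v \<in> V. ?r v \<noteq> 0}"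
    have "v \<noteq> x" using z[of x x] x v by auto
    moreover have "sg C' {x, v} \<noteq> 0" using lap_unit[OF finV xV, of v] v \<open>v \<noteq> x\<close> by auto
    then have "{x, v} \<in> H" using sg(2)[OF C'(1)] CC_H[OF C'(1)] by blast
    ultimately show "v \<in> {v \<in> V - {x}. {x, v} \<in> H}" using v by auto
  qed
  have "card {v \<in> V - {x}. {x, v} \<in> H} = 3"
    using bij_betw_same_card[OF star_bij[OF HK, of x]] dx by simp
  then have "card {v \<in> V. ?r v \<noteq> 0} \<le> 3"
    using card_mono[OF _ supp] finV by simp
  moreover have "?r \<noteq> 0"
  proof -
    have "star H x \<noteq> {}" using dx by auto
    then obtain e where e: "e \<in> H" "x \<in> e" by (auto simp: star_def)
    then have "e \<in> KE V" using HK by blast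
    then obtain y where y: "e = {x, y}" "x \<noteq> y" "y \<in> V" using e(2) by (rule KE_other)
    have "e \<in> C'" using HC e missing_edge[of x C e] x by blast
    then have "sg C' {x, y} \<noteq> 0" using sg(2)[OF C'(1)] y by blast
    then have "?r y \<noteq> 0" using lap_unit[OF finV xV y(3,2)] by simp
    then show ?thesis by auto
  qed
  ultimately show False using affperp_support[OF lap_affperp[OF sg(1)[OF C'(1)]], of "unit_fun x"] by simp
qed

text \<open>The chosen rows form a block diagonal pattern: no edge joins the sets \<open>A C\<close>
  of two circuits, so at \<open>fy C0\<close> only the row belonging to \<open>C0\<close> is
  nonzero.\<close>

lemma card_nonempty_le_R:
  assumes T: "T \<subseteq> CC" "\<And>C. C \<in> T \<Longrightarrow> A C \<noteq> {}" shows "card T \<le> R H"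
proof (rule ccontr)
  assume "\<not> ?thesis"
  then have lt: "fs.dim (Lsp H) < card T" by (simp add: R_def)
  have AV: "A C \<subseteq> V" for C using WV by (auto simp: A_def)
  have "\<forall>C\<in>T. \<exists>C' x y. C' \<in> CC \<and> x \<in> A C \<and> y \<in> A C \<and> L (sg C') (unit_fun x) y \<noteq> 0"
  proof
    fix C assume C: "C \<in> T"
    then have "C \<in> CC" using T by blast
    then obtain C' where "C' \<in> CC" "C' \<noteq> C" by (rule other_circuit)
    then show "\<exists>C' x y. C' \<in> CC \<and> x \<in> A C \<and> y \<in> A C \<and> L (sg C') (unit_fun x) y \<noteq> 0"
      using block_nonzero[of C C'] C T by blast
  qed
  then obtain D fx fy where D: "\<And>C. C \<in> T \<Longrightarrow> D C \<in> CC \<and> fx C \<in> A C \<and> fy C \<in> A C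
      \<and> L (sg (D C)) (unit_fun (fx C)) (fy C) \<noteq> 0"
    by metis
  define r where "r C = L (sg (D C)) (unit_fun (fx C))" for C
  have rL: "r C \<in> Lsp H" if "C \<in> T" for C
    unfolding r_def by (rule lap_Lsp) (use D[OF that] sg(3) in blast)
  have fT: "finite T" using T(1) finCC finite_subset by blast
  obtain c where c: "\<exists>C\<in>T. c C \<noteq> 0" "(\<Sum>C\<in>T. (\<lambda>i. c C * r C i)) = 0"
    by (rule dependent_family[OF finV Lsp_supp fT rL lt])
  then obtain C0 where C0: "C0 \<in> T" "c C0 \<noteq> 0" by blast
  have off: "r C (fy C0) = 0" if C: "C \<in> T" "C \<noteq> C0" for C
  proof -
    have ne: "{fx C, fy C0} \<notin> H" "fx C \<noteq> fy C0"
      using A_disjoint_edge[of C C0 "fx C" "fy C0"] D[OF C(1)] D[OF C0(1)] C C0 T by blast+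
    have "sg (D C) {fx C, fy C0} = 0"
      using sg(2)[of "D C" "{fx C, fy C0}"] ne(1) D[OF C(1)] CC_H by blast
    moreover have "fx C \<in> V" "fy C0 \<in> V" using D[OF C(1)] D[OF C0(1)] AV by blast+
    ultimately show ?thesis
      unfolding r_def using lap_unit[OF finV _ _ ne(2), of "sg (D C)"] by simp
  qed
  have "(\<Sum>C\<in>T. c C * r C (fy C0)) = 0"
    using c(2) by (simp add: sum_fun_apply fun_eq_iff)
  moreover have "(\<Sum>C\<in>T. c C * r C (fy C0)) = (\<Sum>C\<in>T. if C = C0 then c C0 * r C0 (fy C0) else 0)"
    by (rule sum.cong) (use off in auto)
  ultimately have "c C0 * r C0 (fy C0) = 0" using C0 fT by simp
  then show False using C0 D[OF C0(1)] by (simp add: r_def)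
qed

text \<open>The number of circuits is odd by \<open>card_CC\<close> and lies between 2 and 4, so it
  is 3 and \<open>card Q = 2\<close>. Each \<open>A C\<close> then has at least two vertices, which
  gives \<open>2 + 3 * 2\<close> vertices and at least \<open>2 * 8 - 1\<close> edges.\<close>

lemma theta_card:
  assumes "\<And>C. C \<in> CC \<Longrightarrow> A C \<noteq> {}" shows "15 \<le> card H"
proof -
  have c4: "card CC \<le> 4" using card_nonempty_le_R[of CC] assms R4 by simp
  obtain f where "f \<in> H" using conn_nonempty[OF Hc] by blast
  then obtain C where C: "C \<in> CC" by (rule avoiding_exists)
  obtain C' where C': "C' \<in> CC" "C' \<noteq> C" by (rule other_circuit[OF C])
  have "2 \<le> card CC" using card_mono[OF finCC, of "{C, C'}"] C C' by simp
  then have q: "card Q = 2" "card CC = 3" using card_CC c4 by presburger+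
  have "(\<Sum>C\<in>CC. 2) \<le> (\<Sum>C\<in>CC. card (A C))"
    by (rule sum_mono) (use Q_A_ge4 q in fastforce)
  then have "8 \<le> card (\<Union>H)" using card_vertices q by simp
  then show ?thesis using card_H by linarith
qed

end

text \<open>For generic \<open>p\<close>, the lines \<open>xy\<close>, \<open>ab\<close> and \<open>cd\<close> are not concurrent.\<close>

lemma not_concurrent_generic:
  assumes "generic V p" "{x, y, a, b, c, d} \<subseteq> V" "distinct [x, y, a, b, c, d]"
  shows "tri p x a b * tri p y c d \<noteq> tri p y a b * tri p x c d"
proof
  let ?\<phi> = "\<lambda>p. tri p x a b * tri p y c d - tri p y a b * tri p x c d"
  \<comment> \<open>Here \<open>y\<close> lies on the line \<open>ab\<close>, so the right-hand
    product is 0, while \<open>x\<close> is off that line and \<open>y\<close> is off the line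
    \<open>cd\<close>.\<close>
  define q :: "'a \<Rightarrow> real^2" where "q v = (if v = x then vector [0, 1] else if v = y then vector [2, 0]
    else if v = a then vector [0, 0] else if v = b then vector [1, 0] else if v = c then vector [0, 5]
    else vector [1, 7])" for v
  have q: "q x = vector [0, 1]" "q y = vector [2, 0]" "q a = vector [0, 0]" "q b = vector [1, 0]"
    "q c = vector [0, 5]" "q d = vector [1, 7]" using assms(3) by (auto simp: q_def)
  have "?\<phi> \<in> Pol V" using assms(2) by (intro Pol_diff Pol_mult Pol_tri) auto
  moreover assume "tri p x a b * tri p y c d = tri p y a b * tri p x c d"
  then have "?\<phi> p = 0" by simp
  ultimately have "?\<phi> q = 0" using generic_Pol_zero assms(1) by blast
  then show False by (simp add: tri_def q)
qed

section \<open>Isotropic classes and spanning circuits\<close>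

context theta
begin

lemma ip_unit: "x \<in> V \<Longrightarrow> ip V (unit_fun x) f = f x"
proof -
  assume x: "x \<in> V"
  have "ip V (unit_fun x) f = (\<Sum>v\<in>V. if v = x then f x else 0)"
    unfolding ip_def by (rule sum.cong) (auto simp: unit_fun_def)
  then show ?thesis using x finV by simp
qed

lemma ip_lap_zz:
  assumes "C \<in> CC" "\<omega> \<in> S H" shows "ip V (L \<omega> w) (zz C) = \<omega> (eC C) * ip V w (aa C)"
  unfolding ip_lap aa(3)[OF assms] by (simp add: ip_def sum_distrib_left mult_ac)

text \<open>The pairing of \<open>zz C'\<close> with \<open>zz C\<close> through the symmetric
  operator \<open>L (sg C')\<close> can be evaluated from either side; one side is 0 because
  \<open>sg C'\<close> vanishes at \<open>eC C'\<close>.\<close>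

lemma aa_zz_other:
  assumes "C \<in> CC" "C' \<in> CC" "C \<noteq> C'" shows "ip V (aa C) (zz C') = 0"
proof -
  let ?\<omega> = "sg C'"
  have \<omega>: "?\<omega> \<in> S H" by (rule sg(3)[OF assms(2)])
  have "?\<omega> (eC C) * ip V (zz C') (aa C) = ip V (L ?\<omega> (zz C')) (zz C)"
    by (rule ip_lap_zz[OF assms(1) \<omega>, symmetric])
  also have "\<dots> = ip V (L ?\<omega> (zz C)) (zz C')" by (subst ip_lap) (rule ip_commute)
  also have "\<dots> = ?\<omega> (eC C') * ip V (zz C) (aa C')" by (rule ip_lap_zz[OF assms(2) \<omega>])
  also have "?\<omega> (eC C') = 0" using sg_eC[OF assms(2,2)] by simp
  finally have "?\<omega> (eC C) * ip V (zz C') (aa C) = 0" by simp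
  moreover have "?\<omega> (eC C) \<noteq> 0" using sg_eC[OF assms(1,2)] assms(3) by simp
  ultimately show ?thesis by (simp add: ip_commute)
qed

lemma aa_pos: "C \<in> CC \<Longrightarrow> ip V (aa C) (aa C) \<noteq> 0"
  using ip_self_eq_0[OF finV] aa(1,2) Lsp_supp by blast

text \<open>Up to nonzero factors the \<open>zz C\<close> are dual to the \<open>aa C\<close>
  counted here, which are therefore linearly independent in \<open>Lsp H\<close>.\<close>

lemma card_anisotropic: "card {C \<in> CC. ip V (aa C) (zz C) \<noteq> 0} \<le> R H"
proof (rule ccontr)
  let ?T = "{C \<in> CC. ip V (aa C) (zz C) \<noteq> 0}"
  assume "\<not> ?thesis"
  then have lt: "fs.dim (Lsp H) < card ?T" by (simp add: R_def)
  have fT: "finite ?T" using finCC by simp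
  have aL: "aa C \<in> Lsp H" if "C \<in> ?T" for C using aa(2) that by blast
  obtain c where c: "\<exists>C\<in>?T. c C \<noteq> 0" "(\<Sum>C\<in>?T. (\<lambda>i. c C * aa C i)) = 0"
    by (rule dependent_family[OF finV Lsp_supp fT aL lt])
  then obtain C0 where C0: "C0 \<in> ?T" "c C0 \<noteq> 0" by blast
  have ips: "ip V (\<Sum>C\<in>T. f C) h = (\<Sum>C\<in>T. ip V (f C) h)" for T f h
    by (induction T rule: infinite_finite_induct) (simp_all only: sum.infinite sum.empty sum.insert ip_0 ip_add not_False_eq_True)
  have "0 = ip V (\<Sum>C\<in>?T. (\<lambda>i. c C * aa C i)) (zz C0)" unfolding c(2) by simp
  also have "\<dots> = (\<Sum>C\<in>?T. c C * ip V (aa C) (zz C0))" by (simp only: ips ip_scale)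
  also have "\<dots> = (\<Sum>C\<in>?T. if C = C0 then c C0 * ip V (aa C0) (zz C0) else 0)"
    by (rule sum.cong) (use aa_zz_other C0 in auto)
  also have "\<dots> = c C0 * ip V (aa C0) (zz C0)" using C0(1) fT by simp
  finally show False using C0 by simp
qed

text \<open>The component \<open>w\<close> of \<open>b\<close> orthogonal to \<open>a\<close> is
  orthogonal to \<open>b\<close> as well, hence to itself.\<close>

lemma parallel_to:
  assumes "a \<in> supp_in V" "b \<in> supp_in V" "b \<noteq> 0" "ip V a a \<noteq> 0"
    and "\<And>w. ip V w a = 0 \<Longrightarrow> ip V w b = 0"
  obtains k where "k \<noteq> 0" "\<And>x. b x = k * a x"
proof -
  define k where "k = ip V b a / ip V a a"
  define w where "w = b + (\<lambda>x. (- k) * a x)"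
  have wa: "ip V w a = 0" unfolding w_def ip_add ip_scale using assms(4) by (simp add: k_def)
  then have wb: "ip V w b = 0" by (rule assms(5))
  have "ip V w w = ip V b w + (- k) * ip V a w" by (subst (1) w_def) (simp only: ip_add ip_scale)
  also have "\<dots> = 0" using wa wb by (simp add: ip_commute)
  finally have "ip V w w = 0" .
  moreover have "w \<in> supp_in V" using assms(1,2) by (auto simp: w_def supp_in_def)
  ultimately have "w = 0" using ip_self_eq_0[OF finV] by blast
  then have "w x = 0" for x by simp
  then have "b x = k * a x" for x unfolding w_def by (simp add: algebra_simps)
  moreover from this have "k \<noteq> 0" using assms(3) by (auto simp: fun_eq_iff)
  ultimately show ?thesis using that by blast
qed

lemma dependent3:
  assumes "D \<subseteq> supp_in V" "fs.dim D \<le> 2" "u \<in> D" "v \<in> D" "w \<in> D"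
  obtains \<alpha> \<beta> \<gamma> :: real where "\<alpha> \<noteq> 0 \<or> \<beta> \<noteq> 0 \<or> \<gamma> \<noteq> 0" "\<And>x. \<alpha> * u x + \<beta> * v x + \<gamma> * w x = 0"
proof -
  define f where "f i = (if i = 0 then u else if i = 1 then v else w)" for i :: nat
  have c3: "fs.dim D < card {0, 1, 2 :: nat}" using assms(2) by simp
  have fD: "f i \<in> D" if "i \<in> {0, 1, 2}" for i using assms by (simp add: f_def)
  obtain c where c: "\<exists>i\<in>{0, 1, 2}. c i \<noteq> 0" "(\<Sum>i\<in>{0, 1, 2}. (\<lambda>x. c i * f i x)) = 0"
    by (rule dependent_family[OF finV assms(1) _ fD c3]) auto
  have "c 0 * u x + c 1 * v x + c 2 * w x = 0" for x
  proof -
    have "(\<Sum>i\<in>{0, 1, 2}. (\<lambda>x. c i * f i x)) x = 0" unfolding c(2) by simp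
    then show ?thesis by (simp add: f_def add.assoc)
  qed
  moreover have "c 0 \<noteq> 0 \<or> c 1 \<noteq> 0 \<or> c 2 \<noteq> 0" using c(1) by auto
  ultimately show ?thesis using that by blast
qed

text \<open>Three isotropic classes exist, and their vectors \<open>aa\<close> are parallel since they lie in
  the orthogonal complement \<open>D\<close> of two of the \<open>zz\<close>, of dimension at most two.\<close>

lemma isotropic_vector:
  assumes "7 \<le> card CC"
  obtains D a where "a \<in> D" "a \<noteq> 0" "D \<subseteq> affperp" "\<And>x. a x \<noteq> 0 \<Longrightarrow> x \<in> Q"
    "\<And>x \<omega>. x \<in> V \<Longrightarrow> a x = 0 \<Longrightarrow> \<omega> \<in> S H \<Longrightarrow> L \<omega> (unit_fun x) \<in> D"
    "\<And>r r'. r \<in> D \<Longrightarrow> r' \<in> D \<Longrightarrow> \<exists>\<alpha> \<beta> \<gamma>. (\<alpha> \<noteq> 0 \<or> \<beta> \<noteq> 0) \<and> (\<forall>x. \<alpha> * r x + \<beta> * r' x + \<gamma> * a x = 0)"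
proof -
  let ?I = "{C \<in> CC. ip V (aa C) (zz C) = 0}"
  have "card CC = card ?I + card {C \<in> CC. ip V (aa C) (zz C) \<noteq> 0}"
    by (subst card_Un_disjoint[symmetric]) (auto simp: finCC intro: arg_cong[where f = card])
  \<comment> \<open>At most \<open>R H \<le> 4\<close> of the seven or more classes are
    anisotropic.\<close>
  then have I3: "3 \<le> card ?I" using card_anisotropic R4 assms by linarith
  obtain T where T: "T \<subseteq> ?I" "card T = 3" by (rule obtain_subset_with_card_n[OF I3])
  obtain C1 C2 C3 where C123: "T = {C1, C2, C3}" "C1 \<noteq> C2" "C2 \<noteq> C3" "C1 \<noteq> C3"
    using T(2) unfolding card_3_iff by blast
  have "{C1, C2, C3} \<subseteq> ?I" using T(1) C123(1) by (simp only:)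
  then have C: "C1 \<in> ?I" "C2 \<in> ?I" "C3 \<in> ?I" "C1 \<noteq> C2" "C2 \<noteq> C3" "C1 \<noteq> C3"
    using C123 by (simp_all only: insert_subset not_False_eq_True)
  have CC: "C1 \<in> CC" "C2 \<in> CC" "C3 \<in> CC" using C by auto
  define a1 where "a1 = aa C1"
  define a2 where "a2 = aa C2"
  define a3 where "a3 = aa C3"
  define z1 where "z1 = zz C1"
  define z2 where "z2 = zz C2"
  define z3 where "z3 = zz C3"
  note defs = a1_def a2_def a3_def z1_def z2_def z3_def
  define D1 where "D1 = {l \<in> Lsp H. ip V l z1 = 0}"
  define D where "D = {l \<in> D1. ip V l z2 = 0}"
  have ort: "ip V a1 z1 = 0" "ip V a1 z2 = 0" "ip V a1 z3 = 0" "ip V a2 z1 = 0" "ip V a2 z2 = 0"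
    "ip V a2 z3 = 0" "ip V a3 z1 = 0" "ip V a3 z2 = 0" "ip V a3 z3 = 0"
    using C aa_zz_other[OF CC(1,2)] aa_zz_other[OF CC(1,3)] aa_zz_other[OF CC(2,1)] aa_zz_other[OF CC(2,3)]
      aa_zz_other[OF CC(3,1)] aa_zz_other[OF CC(3,2)] by (auto simp: defs)
  have aL: "a1 \<in> Lsp H" "a2 \<in> Lsp H" "a3 \<in> Lsp H" using aa(2) CC by (auto simp: defs)
  have aD: "a1 \<in> D" "a2 \<in> D" "a3 \<in> D" using aL ort by (auto simp: D_def D1_def)
  have a0: "a1 \<noteq> 0" "a2 \<noteq> 0" "a3 \<noteq> 0" using aa(1) CC by (auto simp: defs)
  have app: "ip V a1 a1 \<noteq> 0" "ip V a2 a2 \<noteq> 0" using aa_pos CC by (auto simp: defs)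
  have sV: "Lsp H \<subseteq> supp_in V" by (rule Lsp_supp)
  have DL: "D \<subseteq> Lsp H" by (auto simp: D_def D1_def)
  have sD1: "fs.subspace D1"
    unfolding D1_def using Lsp_subspace[of H] by (auto simp: fs.subspace_def ip_add ip_scale)
  have lz: "ip V (L \<omega> w) z1 = \<omega> (eC C1) * ip V w a1" "ip V (L \<omega> w) z2 = \<omega> (eC C2) * ip V w a2"
    "ip V (L \<omega> w) z3 = \<omega> (eC C3) * ip V w a3" if "\<omega> \<in> S H" for \<omega> w
    using ip_lap_zz[OF CC(1) that] ip_lap_zz[OF CC(2) that] ip_lap_zz[OF CC(3) that] by (auto simp: defs)
  have sgH: "sg C1 \<in> S H" "sg C2 \<in> S H" using sg(3) CC by auto
  have sge: "sg C1 (eC C1) = 0" "sg C2 (eC C2) = 0" "sg C1 (eC C2) \<noteq> 0" "sg C2 (eC C1) \<noteq> 0"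
    "sg C1 (eC C3) \<noteq> 0" "sg C2 (eC C3) \<noteq> 0" using sg_eC CC C by auto
  \<comment> \<open>The vectors \<open>L (sg C2) a1\<close> and \<open>L (sg C1) a2\<close> witness
    that both conditions cut the dimension; the second lies in \<open>D1\<close> because
    \<open>sg C1\<close> vanishes at \<open>eC C1\<close>.\<close>
  have d1: "fs.dim (Lsp H) = fs.dim D1 + 1"
    unfolding D1_def
    by (rule dim_functional[of V "Lsp H" "\<lambda>l. ip V l z1" "L (sg C2) a1", OF finV sV Lsp_subspace ip_add ip_scale])
      (use lap_Lsp[OF sgH(2)] lz(1)[OF sgH(2)] sge app in auto)
  have d2: "fs.dim D1 = fs.dim D + 1"
    unfolding D_def
  proof (rule dim_functional[of V D1 "\<lambda>l. ip V l z2" "L (sg C1) a2", OF finV _ sD1 ip_add ip_scale])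
    show "D1 \<subseteq> supp_in V" using sV by (auto simp: D1_def)
    show "L (sg C1) a2 \<in> D1" using lap_Lsp[OF sgH(1)] lz(1)[OF sgH(1)] sge by (simp add: D1_def)
    show "ip V (L (sg C1) a2) z2 \<noteq> 0" using lz(2)[OF sgH(1)] sge app by simp
  qed
  have D2: "fs.dim D \<le> 2" using d1 d2 R4 by (simp add: R_def)
  have DV: "D \<subseteq> supp_in V" using DL sV by blast
  have "\<exists>\<alpha> \<beta>. (\<alpha> \<noteq> 0 \<or> \<beta> \<noteq> 0) \<and> (\<forall>x. \<alpha> * a1 x + \<beta> * a2 x = 0)"
  proof (rule ccontr)
    assume ind: "\<not> ?thesis"
    \<comment> \<open>Independent \<open>a1\<close> and \<open>a2\<close> would span
      \<open>D\<close>, so \<open>z3\<close>, orthogonal to both, would be orthogonal to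
      \<open>D\<close>.\<close>
    have Dz3: "ip V d z3 = 0" if d: "d \<in> D" for d
    proof -
      obtain \<alpha> \<beta> \<gamma> where dep: "\<alpha> \<noteq> 0 \<or> \<beta> \<noteq> 0 \<or> \<gamma> \<noteq> 0" "\<And>x. \<alpha> * d x + \<beta> * a1 x + \<gamma> * a2 x = 0"
        by (rule dependent3[OF DV D2 d aD(1,2)]) blast
      have "\<alpha> \<noteq> 0"
      proof
        assume "\<alpha> = 0"
        then have "\<beta> \<noteq> 0 \<or> \<gamma> \<noteq> 0" "\<forall>x. \<beta> * a1 x + \<gamma> * a2 x = 0" using dep by auto
        then show False using ind by blast
      qed
      have "0 = ip V (\<lambda>x. \<alpha> * d x + \<beta> * a1 x + \<gamma> * a2 x) z3" unfolding dep(2) by (simp add: ip_def)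
      also have "\<dots> = \<alpha> * ip V d z3 + \<beta> * ip V a1 z3 + \<gamma> * ip V a2 z3"
        by (simp add: ip_def sum_distrib_left sum.distrib algebra_simps)
      finally show ?thesis using ort \<open>\<alpha> \<noteq> 0\<close> by simp
    qed
    \<comment> \<open>For such \<open>w\<close> the vector \<open>L (sg C2) w\<close> lies in
      \<open>D\<close>, and its pairing with \<open>z3\<close> is a nonzero multiple of
      \<open>ip V w a3\<close>. Hence \<open>a3\<close> is parallel to \<open>a1\<close>, and
      likewise to \<open>a2\<close>.\<close>
    have 1: "ip V w a3 = 0" if "ip V w a1 = 0" for w
    proof -
      have "L (sg C2) w \<in> D"
        using lap_Lsp[OF sgH(2)] lz(1,2)[OF sgH(2)] sge that by (simp add: D_def D1_def)
      from Dz3[OF this] show ?thesis using lz(3)[OF sgH(2)] sge by simp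
    qed
    have 2: "ip V w a3 = 0" if "ip V w a2 = 0" for w
    proof -
      have "L (sg C1) w \<in> D"
        using lap_Lsp[OF sgH(1)] lz(1,2)[OF sgH(1)] sge that by (simp add: D_def D1_def)
      from Dz3[OF this] show ?thesis using lz(3)[OF sgH(1)] sge by simp
    qed
    have sa: "a1 \<in> supp_in V" "a2 \<in> supp_in V" "a3 \<in> supp_in V" using aL sV by auto
    obtain k where k: "k \<noteq> 0" "\<And>x. a3 x = k * a1 x" by (rule parallel_to[OF sa(1,3) a0(3) app(1) 1]) blast+
    obtain k' where k': "k' \<noteq> 0" "\<And>x. a3 x = k' * a2 x" by (rule parallel_to[OF sa(2,3) a0(3) app(2) 2]) blast+
    have "k * a1 x + (- k') * a2 x = 0" for x using k(2)[of x] k'(2)[of x] by linarith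
    then show False using ind k(1) by blast
  qed
  then obtain \<alpha> \<beta> where par: "\<alpha> \<noteq> 0 \<or> \<beta> \<noteq> 0" "\<And>x. \<alpha> * a1 x + \<beta> * a2 x = 0" by blast
  have "\<alpha> \<noteq> 0" using par a0(2) by (auto simp: fun_eq_iff)
  have "\<beta> \<noteq> 0" using par a0(1) by (auto simp: fun_eq_iff)
  have same: "a1 x = 0 \<longleftrightarrow> a2 x = 0" for x using par(2)[of x] \<open>\<alpha> \<noteq> 0\<close> \<open>\<beta> \<noteq> 0\<close> by auto
  show ?thesis
  proof (rule that[of a1 D])
    show "a1 \<in> D" "a1 \<noteq> 0" by fact+
    show "D \<subseteq> affperp" using DL Lsp_affperp by blast
    \<comment> \<open>The support of \<open>a1\<close> avoids \<open>A C\<close> for every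
      \<open>C\<close> other than \<open>C1\<close>; it equals the support of \<open>a2\<close>,
      which avoids \<open>A C1\<close>.\<close>
    show "x \<in> Q" if "a1 x \<noteq> 0" for x
    proof -
      have 1: "x \<in> \<Union>C" if "C \<in> CC" "C \<noteq> C1" for C
        using aa_supp[OF CC(1) that] \<open>a1 x \<noteq> 0\<close> by (simp add: a1_def)
      have 2: "x \<in> \<Union>C1"
        using aa_supp[OF CC(2,1)] C(4) \<open>a1 x \<noteq> 0\<close> same[of x] by (simp add: a2_def)
      then have "x \<in> \<Union>H" using CC_H[OF CC(1)] by blast
      then show ?thesis using 1 2 by (auto simp: Q_def)
    qed
    show "L \<omega> (unit_fun x) \<in> D" if "x \<in> V" "a1 x = 0" "\<omega> \<in> S H" for x \<omega>
      using lap_Lsp[OF that(3)] lz(1,2)[OF that(3)] that same[of x] by (simp add: D_def D1_def ip_unit)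
    show "\<exists>\<alpha> \<beta> \<gamma>. (\<alpha> \<noteq> 0 \<or> \<beta> \<noteq> 0) \<and> (\<forall>x. \<alpha> * r x + \<beta> * r' x + \<gamma> * a1 x = 0)"
      if r: "r \<in> D" "r' \<in> D" for r r'
    proof -
      obtain \<alpha> \<beta> \<gamma> where dep: "\<alpha> \<noteq> 0 \<or> \<beta> \<noteq> 0 \<or> \<gamma> \<noteq> 0" "\<And>x. \<alpha> * r x + \<beta> * r' x + \<gamma> * a1 x = 0"
        by (rule dependent3[OF DV D2 r aD(1)]) blast
      have "\<alpha> \<noteq> 0 \<or> \<beta> \<noteq> 0" using dep a0(1) by (auto simp: fun_eq_iff)
      then show ?thesis using dep(2) by blast
    qed
  qed
qed

definition N where "N x = {v \<in> V - {x}. {x, v} \<in> H}"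

lemma card_N: "card (N x) = card (star H x)"
  unfolding N_def by (rule bij_betw_same_card[OF star_bij[OF HK]])

lemma N_commute: "x \<in> V \<Longrightarrow> y \<in> N x \<Longrightarrow> x \<in> N y"
  by (auto simp: N_def insert_commute)

lemma finN: "finite (N x)"
  using finV by (simp add: N_def)

lemma degree_ge4:
  assumes "C \<in> CC" "A C = {}" "f \<in> H" "f \<notin> C" "x \<in> f" shows "4 \<le> card (star H x)"
proof -
  have "\<Union>C = \<Union>H" using assms(2) CC_H[OF assms(1)] by (auto simp: A_def)
  then have "x \<in> \<Union>C" using assms(3,5) by auto
  then have "3 \<le> card (star C x)" by (rule circuit_degree[OF CC_circuit[OF assms(1)]])
  moreover have "star C x \<subset> star H x" using assms CC_H[OF assms(1)] by (auto simp: star_def)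
  then have "card (star C x) < card (star H x)"
    by (rule psubset_card_mono[rotated]) (simp add: star_def finH)
  ultimately show ?thesis by simp
qed

text \<open>Six edges on four vertices are dependent, and degrees of at least 3 in a circuit require
  four vertices.\<close>

lemma K4_circuit:
  assumes d: "distinct [x, y, g, h]"
    and e: "{x, y} \<in> H" "{x, g} \<in> H" "{x, h} \<in> H" "{y, g} \<in> H" "{y, h} \<in> H" "{g, h} \<in> H"
  obtains C where "C \<in> CC" "\<Union>C = {x, y, g, h}"
proof -
  let ?F = "{{x, y}, {x, g}, {x, h}, {y, g}, {y, h}, {g, h}}"
  have FH: "?F \<subseteq> H" using e by simp
  have FK: "?F \<subseteq> KE V" using FH HK by blast
  have U: "\<Union>?F = {x, y, g, h}" by auto
  have UV: "{x, y, g, h} \<subseteq> V" using finite_Union_KE[OF finV FK] U by simp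
  have d': "y \<noteq> x" "g \<noteq> x" "h \<noteq> x" "g \<noteq> y" "h \<noteq> y" "h \<noteq> g" using d by auto
  have "card ?F = 6" using d d' by (simp add: doubleton_eq_iff)
  moreover have "card {x, y, g, h} = 4" using d by simp
  ultimately have "\<not> S ?F \<subseteq> {0}" using indep_bound[OF FK, of "{x, y, g, h}"] UV U by auto
  then obtain \<omega> where "\<omega> \<in> S ?F" "\<omega> \<noteq> 0" by blast
  moreover from this obtain e where "\<omega> e \<noteq> 0" by (auto simp: fun_eq_iff)
  ultimately have \<omega>: "\<omega> \<in> S ?F" "\<omega> e \<noteq> 0" by auto
  obtain C where C: "circuit C" "C \<subseteq> {f. \<omega> f \<noteq> 0}" using circuit_exists[OF FK \<omega>] by blast
  have CF: "C \<subseteq> ?F" using C(2) St_supp[OF \<omega>(1)] by blast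
  have CU: "\<Union>C \<subseteq> {x, y, g, h}" using CF U by blast
  have "{x, y, g, h} = \<Union>C"
  proof (rule ccontr)
    assume "{x, y, g, h} \<noteq> \<Union>C"
    then have "\<Union>C \<subset> {x, y, g, h}" using CU by (metis psubsetI)
    then have "card (\<Union>C) < card {x, y, g, h}" by (rule psubset_card_mono[rotated]) simp
    then have c3: "card (\<Union>C) \<le> 3" using d by simp
    obtain f where f: "f \<in> C" using circuit_nonempty[OF C(1)] by blast
    then have "f \<in> KE V" using circuit_KE[OF C(1)] by blast
    then obtain v v' where v: "f = {v, v'}" by (rule KE_E)
    have vC: "v \<in> \<Union>C" using f v by auto
    have CV: "\<Union>C \<subseteq> V" "finite (\<Union>C)" using finite_Union_KE[OF finV circuit_KE[OF C(1)]] by auto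
    have "3 \<le> card (star C v)" by (rule circuit_degree[OF C(1) vC])
    also have "card (star C v) = card {u \<in> V - {v}. {v, u} \<in> C}"
      by (rule bij_betw_same_card[OF star_bij[OF circuit_KE[OF C(1)]], symmetric])
    also have "\<dots> \<le> card (\<Union>C - {v})" by (rule card_mono) (use CV in auto)
    also have "\<dots> < card (\<Union>C)" using vC CV(2) by (rule card_Diff1_less[rotated])
    finally show False using c3 by simp
  qed
  then show ?thesis using that[of C] C(1) CF FH by (auto simp: CC_def)
qed

text \<open>Rows of the stress matrices at vertices where \<open>a\<close> vanishes lie in \<open>D\<close>, hence are pairwise dependent
  modulo \<open>a\<close>. So only one circuit \<open>K\<close> is not spanning, and counting degrees gives two vertices of degree
  three outside \<open>K\<close>; the dependence of their rows makes three lines concurrent or produces a \<open>K\<^sub>4\<close>.\<close>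

lemma theta_spanning:
  assumes C0: "C0 \<in> CC" "A C0 = {}"
  shows False
proof -
  have q4: "4 \<le> card Q" using Q_A_ge4[OF C0(1)] C0(2) by simp
  have c7: "7 \<le> card CC" using card_CC q4 by linarith
  obtain D a where aD: "a \<in> D" and a0: "a \<noteq> 0" and Daff: "D \<subseteq> affperp" and aQ: "\<And>x. a x \<noteq> 0 \<Longrightarrow> x \<in> Q"
    and rowD: "\<And>x \<omega>. x \<in> V \<Longrightarrow> a x = 0 \<Longrightarrow> \<omega> \<in> S H \<Longrightarrow> L \<omega> (unit_fun x) \<in> D"
    and dep: "\<And>r r'. r \<in> D \<Longrightarrow> r' \<in> D \<Longrightarrow> \<exists>\<alpha> \<beta> \<gamma>. (\<alpha> \<noteq> 0 \<or> \<beta> \<noteq> 0) \<and> (\<forall>x. \<alpha> * r x + \<beta> * r' x + \<gamma> * a x = 0)"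
    by (rule isotropic_vector[OF c7]) blast+
  have aA: "a x = 0" if "C \<in> CC" "x \<in> A C" for C x
    using aQ[of x] that by (auto simp: Q_def A_def)
  have AV: "A C \<subseteq> V" for C using WV by (auto simp: A_def)
  \<comment> \<open>Two such circuits supply rows at \<open>u\<close> and \<open>u'\<close> in
    \<open>D\<close>. At \<open>v\<close> the second row and \<open>a\<close> vanish, at
    \<open>v'\<close> the first row and \<open>a\<close>, so no dependence modulo \<open>a\<close>
    is possible.\<close>
  have one: "C = C'" if C: "C \<in> CC" "C' \<in> CC" "A C \<noteq> {}" "A C' \<noteq> {}" for C C'
  proof (rule ccontr)
    assume ne: "C \<noteq> C'"
    have "card {C, C'} \<le> 2" using card_insert_le_m1[of 2 "{C'}" C] by simp
    then have "\<not> CC \<subseteq> {C, C'}" using card_mono[of "{C, C'}" CC] c7 by auto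
    then obtain C'' where C'': "C'' \<in> CC" "C'' \<noteq> C" "C'' \<noteq> C'" by blast
    obtain u v where uv: "u \<in> A C" "v \<in> A C" "L (sg C'') (unit_fun u) v \<noteq> 0"
      using block_nonzero[OF C(1,3) C''(1,2)] by blast
    obtain u' v' where uv': "u' \<in> A C'" "v' \<in> A C'" "L (sg C'') (unit_fun u') v' \<noteq> 0"
      using block_nonzero[OF C(2,4) C''(1,3)] by blast
    have sH: "sg C'' \<in> S H" by (rule sg(3)[OF C''(1)])
    have uV: "u \<in> V" "v \<in> V" "u' \<in> V" "v' \<in> V" using uv uv' AV by blast+
    have off: "L (sg C'') (unit_fun s) t = 0" if "{s, t} \<notin> H" "s \<noteq> t" "s \<in> V" "t \<in> V" for s t
    proof -
      have "sg C'' {s, t} = 0" using sg(2)[OF C''(1)] CC_H[OF C''(1)] that(1) by blast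
      then show ?thesis using lap_unit[OF finV that(3,4,2), of "sg C''"] by simp
    qed
    have 1: "L (sg C'') (unit_fun u) v' = 0"
      by (rule off) (use A_disjoint_edge[OF C(1,2) ne uv(1) uv'(2)] uV in auto)
    have 2: "L (sg C'') (unit_fun u') v = 0"
      by (rule off) (use A_disjoint_edge[OF C(2,1) ne[symmetric] uv'(1) uv(2)] uV in auto)
    obtain \<alpha> \<beta> \<gamma> where ab: "\<alpha> \<noteq> 0 \<or> \<beta> \<noteq> 0"
      "\<forall>x. \<alpha> * L (sg C'') (unit_fun u) x + \<beta> * L (sg C'') (unit_fun u') x + \<gamma> * a x = 0"
      using dep[OF rowD[OF uV(1) aA[OF C(1) uv(1)] sH] rowD[OF uV(3) aA[OF C(2) uv'(1)] sH]] by blast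
    have "\<alpha> = 0" using spec[OF ab(2), of v] 2 uv(3) aA[OF C(1) uv(2)] by simp
    moreover have "\<beta> = 0" using spec[OF ab(2), of v'] 1 uv'(3) aA[OF C(2) uv'(2)] by simp
    ultimately show False using ab(1) by simp
  qed
  have hs: "(\<Sum>x\<in>\<Union>H. card (star H x)) + 2 = 4 * card (\<Union>H)"
    using handshake[OF fW HK finH subset_refl] card_H by simp
  \<comment> \<open>If all circuits were spanning, every degree would be at least 4, against the
    degree sum \<open>4 * card (\<Union>H) - 2\<close>.\<close>
  have "\<exists>K\<in>CC. A K \<noteq> {}"
  proof (rule ccontr)
    assume none: "\<not> ?thesis"
    have "4 \<le> card (star H x)" if "x \<in> \<Union>H" for x
    proof -
      obtain f where f: "f \<in> H" "x \<in> f" using \<open>x \<in> \<Union>H\<close> by blast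
      obtain C where C: "C \<in> CC" "f \<notin> C" by (rule avoiding_exists[OF f(1)])
      show ?thesis by (rule degree_ge4[OF C(1) _ f(1) C(2) f(2)]) (use none C in blast)
    qed
    then have "4 * card (\<Union>H) \<le> (\<Sum>x\<in>\<Union>H. card (star H x))"
      using sum_bounded_below[of "\<Union>H" 4 "\<lambda>x. card (star H x)"] by simp
    then show False using hs by simp
  qed
  then obtain K where K: "K \<in> CC" "A K \<noteq> {}" by blast
  let ?A = "A K"
  have spanning: "A C = {}" if "C \<in> CC" "C \<noteq> K" for C using one[OF that(1) K(1)] K(2) that(2) by blast
  obtain C2 where C2: "C2 \<in> CC" "C2 \<noteq> K" by (rule other_circuit[OF K(1)])
  define \<omega> where "\<omega> = sg C2"
  define r where "r x = L \<omega> (unit_fun x)" for x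
  have \<omega>H: "\<omega> \<in> S H" unfolding \<omega>_def by (rule sg(3)[OF C2(1)])
  have HK2: "H - K \<subseteq> C2" using avoiding_unique[OF K(1) C2(1)] C2(2) by blast
  have rD: "r x \<in> D" if "x \<in> ?A" for x
    unfolding r_def by (rule rowD[OF _ aA[OF K(1) that] \<omega>H]) (use that AV in blast)
  have rN: "r x v \<noteq> 0 \<longleftrightarrow> v \<in> N x" if x: "x \<in> ?A" and v: "v \<noteq> x" for x v
  proof (cases "v \<in> V")
    case True
    have xV: "x \<in> V" using x AV by blast
    have "{x, v} \<in> H \<longleftrightarrow> {x, v} \<in> C2"
      using HK2 missing_edge[OF x, of "{x, v}"] CC_H[OF C2(1)] by blast
    then have "\<omega> {x, v} \<noteq> 0 \<longleftrightarrow> {x, v} \<in> H" using sg(2)[OF C2(1)] by (simp add: \<omega>_def)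
    then show ?thesis using True v lap_unit[OF finV xV True] by (auto simp: r_def N_def)
  next
    case False
    then show ?thesis by (auto simp: r_def N_def lap_def)
  qed
  have d3: "3 \<le> card (star H x)" if "x \<in> \<Union>H" for x by (rule conn_degree[OF Hc that])
  define T3 where "T3 = {x \<in> ?A. card (star H x) = 3}"
  have AH: "?A \<subseteq> \<Union>H" by (auto simp: A_def)
  have UK: "\<Union>H - ?A = \<Union>K" using CC_H[OF K(1)] by (auto simp: A_def)
  have split: "(\<Sum>x\<in>\<Union>H. card (star H x)) = (\<Sum>x\<in>?A. card (star H x)) + (\<Sum>x\<in>\<Union>K. card (star H x))"
    using sum.subset_diff[OF AH fW, of "\<lambda>x. card (star H x)"] UK by simp
  have fK: "finite (\<Union>K)" using finite_subset[OF _ fW, of "\<Union>K"] UK by auto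
  have d4K: "4 \<le> card (star H y)" if "y \<in> \<Union>K" for y
  proof -
    obtain f where f: "f \<in> K" "y \<in> f" using \<open>y \<in> \<Union>K\<close> by blast
    have fH: "f \<in> H" using f CC_H[OF K(1)] by blast
    obtain C where C: "C \<in> CC" "f \<notin> C" by (rule avoiding_exists[OF fH])
    have "C \<noteq> K" using C f by blast
    then show ?thesis using degree_ge4[OF C(1) spanning[OF C(1)] fH C(2) f(2)] by blast
  qed
  have sumK: "4 * card (\<Union>K) \<le> (\<Sum>x\<in>\<Union>K. card (star H x))"
    using sum_bounded_below[of "\<Union>K" 4 "\<lambda>x. card (star H x)"] d4K by simp
  have cAK: "card ?A + card (\<Union>K) = card (\<Union>H)" by (rule card_A[OF K(1)])
  \<comment> \<open>The vertices of \<open>K\<close> take at least 4 each from the degree sum, so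
    the whole deficit of 2 falls on \<open>A K\<close>, which therefore has two vertices of degree
    three.\<close>
  have sumA_le: "(\<Sum>x\<in>?A. card (star H x)) + 2 \<le> 4 * card ?A" using hs split sumK cAK by linarith
  have sumA_ge: "4 * card ?A \<le> (\<Sum>x\<in>?A. card (star H x)) + card T3"
  proof -
    have "(\<Sum>x\<in>?A. 4) \<le> (\<Sum>x\<in>?A. card (star H x) + (if x \<in> T3 then 1 else 0))"
    proof (rule sum_mono)
      fix x assume x: "x \<in> ?A"
      then have "3 \<le> card (star H x)" using d3 AH by blast
      then show "4 \<le> card (star H x) + (if x \<in> T3 then 1 else 0)" using x by (auto simp: T3_def)
    qed
    also have "\<dots> = (\<Sum>x\<in>?A. card (star H x)) + (\<Sum>x\<in>?A. if x \<in> T3 then 1 else 0)"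
      by (rule sum.distrib)
    also have "(\<Sum>x\<in>?A. if x \<in> T3 then 1 else 0) = card T3"
      using finA[of K] by (simp add: sum.If_cases T3_def Int_def)
    finally show ?thesis by simp
  qed
  have T32: "2 \<le> card T3" using sumA_le sumA_ge by linarith
  have T3A: "x \<in> ?A" "card (N x) = 3" if "x \<in> T3" for x using that card_N by (auto simp: T3_def)
  have diag: "r x x \<noteq> 0" and suppr: "r x v \<noteq> 0 \<longleftrightarrow> v \<in> insert x (N x)" if x: "x \<in> T3" for x v
  proof -
    have xA: "x \<in> ?A" by (rule T3A(1)[OF x])
    have "N x \<noteq> {}" using T3A(2)[OF x] by auto
    then obtain u where u: "u \<in> N x" by blast
    then have "r x u \<noteq> 0" using rN[OF xA, of u] by (auto simp: N_def)
    then have "r x \<noteq> 0" by auto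
    then have c4: "4 \<le> card {v \<in> V. r x v \<noteq> 0}" using affperp_support rD[OF xA] Daff by blast
    \<comment> \<open>Only \<open>x\<close> and its three neighbours can carry entries of this row,
      and an affine dependence needs four of them.\<close>
    show dg: "r x x \<noteq> 0"
    proof
      assume "r x x = 0"
      then have "v \<noteq> x" if "r x v \<noteq> 0" for v using that by auto
      then have sub: "{v \<in> V. r x v \<noteq> 0} \<subseteq> N x" using rN[OF xA] by blast
      have "card {v \<in> V. r x v \<noteq> 0} \<le> 3" using card_mono[OF finN sub] T3A(2)[OF x] by simp
      then show False using c4 by simp
    qed
    show "r x v \<noteq> 0 \<longleftrightarrow> v \<in> insert x (N x)" using rN[OF xA, of v] dg by (cases "v = x") auto
  qed
  have twins: "{x, y} \<in> H \<and> insert x (N x) = insert y (N y)" if xy: "x \<in> T3" "y \<in> T3" "x \<noteq> y" for x y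
  proof -
    have xA: "x \<in> ?A" "y \<in> ?A" using T3A(1) xy by auto
    have ax: "a x = 0" "a y = 0" using aA[OF K(1)] xA by auto
    have xV: "x \<in> V" "y \<in> V" using xA AV by auto
    obtain \<alpha> \<beta> \<gamma> where ab: "\<alpha> \<noteq> 0 \<or> \<beta> \<noteq> 0" "\<And>v. \<alpha> * r x v + \<beta> * r y v + \<gamma> * a v = 0"
      using dep[OF rD[OF xA(1)] rD[OF xA(2)]] by blast
    \<comment> \<open>At \<open>x\<close> and \<open>y\<close> the vector \<open>a\<close> vanishes,
      so the nonzero diagonal entries make \<alpha> and \<beta> nonzero and force the edge
      \<open>xy\<close>.\<close>
    have ex: "\<alpha> * r x x + \<beta> * r y x = 0" using ab(2)[of x] ax by simp
    have ey: "\<alpha> * r x y + \<beta> * r y y = 0" using ab(2)[of y] ax by simp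
    have "\<alpha> \<noteq> 0" using ey ab(1) diag[OF xy(2)] by auto
    have "\<beta> \<noteq> 0" using ex ab(1) diag[OF xy(1)] by auto
    have "r y x \<noteq> 0" using ex \<open>\<alpha> \<noteq> 0\<close> diag[OF xy(1)] by auto
    then have xNy: "x \<in> N y" using suppr[OF xy(2), of x] xy(3) by auto
    then have yNx: "y \<in> N x" using N_commute[OF xV(2)] by blast
    have edge: "{x, y} \<in> H" using yNx by (simp add: N_def)
    have "\<gamma> = 0"
    proof (rule ccontr)
      assume \<gamma>: "\<gamma> \<noteq> 0"
      have "a \<in> affperp" using aD Daff by blast
      then have c4: "4 \<le> card {v \<in> V. a v \<noteq> 0}" using affperp_support a0 by blast
      let ?X = "N x - {y}"
      let ?Y = "N y - {x}"
      have cX: "card ?X = 2" "card ?Y = 2" using T3A(2) xy xNy yNx finN by (simp_all add: card_Diff_singleton)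
      \<comment> \<open>With \<gamma> nonzero, \<open>a\<close> is supported on the remaining two
        neighbours of \<open>x\<close> and of \<open>y\<close>. Four points of support leave no
        overlap, so six distinct vertices are involved.\<close>
      have sub: "{v \<in> V. a v \<noteq> 0} \<subseteq> (?X - ?A) \<union> (?Y - ?A)"
      proof
        fix v assume v: "v \<in> {v \<in> V. a v \<noteq> 0}"
        then have "r x v \<noteq> 0 \<or> r y v \<noteq> 0" using ab(2)[of v] \<gamma> by auto
        then have "v \<in> insert x (N x) \<or> v \<in> insert y (N y)" using suppr xy by blast
        moreover have "v \<notin> ?A" using aA[OF K(1)] v by blast
        moreover have "v \<noteq> x" "v \<noteq> y" using ax v by auto
        ultimately show "v \<in> (?X - ?A) \<union> (?Y - ?A)" by blast
      qed
      have fXY: "finite (?X - ?A)" "finite (?Y - ?A)" using finN by auto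
      have "4 \<le> card ((?X - ?A) \<union> (?Y - ?A))" using c4 card_mono[OF _ sub] fXY by simp
      moreover have "card ((?X - ?A) \<union> (?Y - ?A)) + card ((?X - ?A) \<inter> (?Y - ?A)) = card (?X - ?A) + card (?Y - ?A)"
        using card_Un_Int[OF fXY] by simp
      moreover have "card (?X - ?A) \<le> 2" "card (?Y - ?A) \<le> 2"
        using card_mono[of ?X "?X - ?A"] card_mono[of ?Y "?Y - ?A"] cX finN by (auto simp del: card_Diff_insert)
      ultimately have full: "card (?X - ?A) = 2" "card (?Y - ?A) = 2" "card ((?X - ?A) \<inter> (?Y - ?A)) = 0" by linarith+
      have "?X - ?A = ?X" "?Y - ?A = ?Y" using card_subset_eq[of ?X "?X - ?A"] card_subset_eq[of ?Y "?Y - ?A"] full cX finN by auto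
      then have disj: "?X \<inter> ?Y = {}" using full(3) fXY by auto
      obtain u1 u2 where u: "?X = {u1, u2}" "u1 \<noteq> u2" using cX(1) unfolding card_2_iff by blast
      obtain w1 w2 where w: "?Y = {w1, w2}" "w1 \<noteq> w2" using cX(2) unfolding card_2_iff by blast
      have Nx: "N x = {y, u1, u2}" "N y = {x, w1, w2}" using u(1) w(1) xNy yNx by blast+
      have uw: "u1 \<in> V" "u2 \<in> V" "w1 \<in> V" "w2 \<in> V" "u1 \<noteq> x" "u2 \<noteq> x" "w1 \<noteq> y" "w2 \<noteq> y"
        using Nx unfolding N_def by blast+
      have uw': "u1 \<noteq> y" "u2 \<noteq> y" "w1 \<noteq> x" "w2 \<noteq> x" using u(1) w(1) by blast+
      have uw'': "u1 \<noteq> w1" "u1 \<noteq> w2" "u2 \<noteq> w1" "u2 \<noteq> w2" using disj u(1) w(1) by blast+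
      have dist6: "distinct [x, y, u1, u2, w1, w2]" using xy(3) u(2) w(2) uw uw' uw'' by auto
      \<comment> \<open>The affine function \<open>tri p v u1 u2\<close> of \<open>v\<close>
        vanishes at \<open>u1\<close> and \<open>u2\<close>, so the affine dependence
        \<open>r x\<close> keeps only its terms at \<open>x\<close> and \<open>y\<close>.\<close>
      have s1: "r x x * tri p x u1 u2 + r x y * tri p y u1 u2 = 0"
      proof -
        have "(\<Sum>v\<in>V. r x v * tri p v u1 u2) = 0" using affperp_tri rD[OF xA(1)] Daff by blast
        moreover have "(\<Sum>v\<in>V. r x v * tri p v u1 u2) = (\<Sum>v\<in>{x, y}. r x v * tri p v u1 u2)"
          by (rule sum.mono_neutral_right) (use finV xV suppr[OF xy(1)] Nx in \<open>auto simp: tri_def\<close>)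
        ultimately show ?thesis using xy(3) by simp
      qed
      have s2: "r y x * tri p x w1 w2 + r y y * tri p y w1 w2 = 0"
      proof -
        have "(\<Sum>v\<in>V. r y v * tri p v w1 w2) = 0" using affperp_tri rD[OF xA(2)] Daff by blast
        moreover have "(\<Sum>v\<in>V. r y v * tri p v w1 w2) = (\<Sum>v\<in>{x, y}. r y v * tri p v w1 w2)"
          by (rule sum.mono_neutral_right) (use finV xV suppr[OF xy(2)] Nx in \<open>auto simp: tri_def\<close>)
        ultimately show ?thesis using xy(3) by simp
      qed
      \<comment> \<open>Eliminating row \<open>y\<close> gives the relation for \<open>w1w2\<close>
        the same weights at \<open>x\<close> and \<open>y\<close> as the one for
        \<open>u1u2\<close>: both lines meet \<open>xy\<close> in the same point.\<close>
      have "\<beta> * (r y x * tri p x w1 w2 + r y y * tri p y w1 w2)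
          = - \<alpha> * (r x x * tri p x w1 w2 + r x y * tri p y w1 w2)
            + (\<alpha> * r x x + \<beta> * r y x) * tri p x w1 w2 + (\<alpha> * r x y + \<beta> * r y y) * tri p y w1 w2"
        by (simp add: algebra_simps)
      then have s3: "r x x * tri p x w1 w2 + r x y * tri p y w1 w2 = 0"
        unfolding s2 ex ey using \<open>\<alpha> \<noteq> 0\<close> by simp
      have "r x x * (tri p x u1 u2 * tri p y w1 w2 - tri p y u1 u2 * tri p x w1 w2)
          = (r x x * tri p x u1 u2 + r x y * tri p y u1 u2) * tri p y w1 w2
            - (r x x * tri p x w1 w2 + r x y * tri p y w1 w2) * tri p y u1 u2"
        by (simp add: algebra_simps)
      then have "r x x * (tri p x u1 u2 * tri p y w1 w2 - tri p y u1 u2 * tri p x w1 w2) = 0"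
        unfolding s1 s3 by simp
      then have "tri p x u1 u2 * tri p y w1 w2 = tri p y u1 u2 * tri p x w1 w2" using diag[OF xy(1)] by simp
      moreover have "tri p x u1 u2 * tri p y w1 w2 \<noteq> tri p y u1 u2 * tri p x w1 w2"
        by (rule not_concurrent_generic[OF gen _ dist6]) (use xV uw in auto)
      ultimately show False by blast
    qed
    then have "r x v \<noteq> 0 \<longleftrightarrow> r y v \<noteq> 0" for v using ab(2)[of v] \<open>\<alpha> \<noteq> 0\<close> \<open>\<beta> \<noteq> 0\<close> by auto
    then have "insert x (N x) = insert y (N y)" using suppr[OF xy(1)] suppr[OF xy(2)] by blast
    then show ?thesis using edge by blast
  qed
  \<comment> \<open>A circuit on these four vertices passes through \<open>x\<close>, so it is not
    \<open>K\<close> and spans \<open>H\<close>; but \<open>Q\<close> has at least four vertices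
    other than \<open>x\<close>.\<close>
  have noK4: False if K4: "distinct [x, y, g, h]" "x \<in> ?A" "{x, y} \<in> H" "{x, g} \<in> H" "{x, h} \<in> H"
    "{y, g} \<in> H" "{y, h} \<in> H" "{g, h} \<in> H" for x y g h
  proof -
    obtain C where C: "C \<in> CC" "\<Union>C = {x, y, g, h}" by (rule K4_circuit[OF K4(1,3-8)])
    have "x \<notin> \<Union>K" using K4(2) by (simp add: A_def)
    then have "C \<noteq> K" using C(2) by auto
    have "\<Union>H = \<Union>C" using spanning[OF C(1) \<open>C \<noteq> K\<close>] CC_H[OF C(1)] unfolding A_def by blast
    then have "card (\<Union>H) \<le> 4" using K4(1) C(2) by simp
    moreover have "Q \<subseteq> \<Union>H - {x}" using \<open>x \<notin> \<Union>K\<close> K(1) by (auto simp: Q_def)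
    then have "card Q \<le> card (\<Union>H - {x})" by (rule card_mono[rotated]) (use fW in blast)
    moreover have "card (\<Union>H - {x}) < card (\<Union>H)" by (rule card_Diff1_less[OF fW]) (use K4(2) AH in blast)
    ultimately show False using q4 by linarith
  qed
  obtain x y where xy: "x \<in> T3" "y \<in> T3" "x \<noteq> y" by (rule card_ge2_obtain[OF T32])
  have xA: "x \<in> ?A" "y \<in> ?A" using T3A(1) xy by auto
  have tw: "{x, y} \<in> H" "insert x (N x) = insert y (N y)" using twins[OF xy] by auto
  have xV: "x \<in> V" "y \<in> V" using xA AV by auto
  have yNx: "y \<in> N x" using tw(1) xV xy(3) by (simp add: N_def)
  have "card (N x - {y}) = 2" using T3A(2)[OF xy(1)] yNx finN by (simp add: card_Diff_singleton)
  then obtain g h where gh: "N x - {y} = {g, h}" "g \<noteq> h" unfolding card_2_iff by blast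
  have Nx: "N x = {y, g, h}" using gh(1) yNx by blast
  have ghx: "g \<noteq> x" "h \<noteq> x" "g \<noteq> y" "h \<noteq> y" "g \<in> V" "h \<in> V" "{x, g} \<in> H" "{x, h} \<in> H"
    using Nx gh(1) unfolding N_def by blast+
  have "g \<in> N y" "h \<in> N y" using tw(2) Nx ghx by blast+
  then have ye: "{y, g} \<in> H" "{y, h} \<in> H" by (auto simp: N_def)
  have d4: "distinct [x, y, g, h]" using xy(3) gh(2) ghx by auto
  have "{g, h} \<in> H"
  proof (cases "\<exists>w\<in>T3. w \<noteq> x \<and> w \<noteq> y")
    case True
    then obtain w where w: "w \<in> T3" "w \<noteq> x" "w \<noteq> y" by blast
    have tww: "{x, w} \<in> H" "insert x (N x) = insert w (N w)" using twins[OF xy(1) w(1)] w(2) by auto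
    have "w \<in> {g, h}" using tww(2) Nx w by blast
    then show ?thesis
    proof
      assume "w = g"
      then have "h \<in> N g" using tww(2) Nx gh(2) ghx by blast
      then show ?thesis by (simp add: N_def)
    next
      assume "w \<in> {h}"
      then have "g \<in> N h" using tww(2) Nx gh(2) ghx by blast
      then show ?thesis by (simp add: N_def insert_commute)
    qed
  next
    case False
    then have "T3 = {x, y}" using xy by blast
    then have "card T3 = 2" using xy(3) by simp
    \<comment> \<open>With only two vertices of degree three the degree count is tight, so all
      vertices of \<open>K\<close> have degree exactly 4.\<close>
    then have sumK_eq: "(\<Sum>x\<in>\<Union>K. card (star H x)) = 4 * card (\<Union>K)"
      using hs split sumA_ge sumK cAK by linarith
    have eq4: "card (star H v) = 4" if "v \<in> \<Union>K" for v
    proof (rule ccontr)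
      assume "card (star H v) \<noteq> 4"
      then have "4 < card (star H v)" using d4K[OF that] by simp
      then have "(\<Sum>x\<in>\<Union>K. 4) < (\<Sum>x\<in>\<Union>K. card (star H x))"
        by (intro sum_strict_mono_ex1[OF fK]) (use d4K that in blast)+
      then show False using sumK_eq by simp
    qed
    \<comment> \<open>A common neighbour of \<open>x\<close> and \<open>y\<close> on
      \<open>K\<close> would have three edges in \<open>K\<close> and two more.\<close>
    have inA: "v \<in> ?A" if v: "{x, v} \<in> H" "{y, v} \<in> H" "v \<in> V" for v
    proof (rule ccontr)
      assume "v \<notin> ?A"
      moreover have "v \<in> \<Union>H" using v(1) by blast
      ultimately have vK: "v \<in> \<Union>K" using UK by blast
      have "3 \<le> card (star K v)" by (rule circuit_degree[OF CC_circuit[OF K(1)] vK])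
      moreover have "insert {x, v} (insert {y, v} (star K v)) \<subseteq> star H v"
        using v CC_H[OF K(1)] by (auto simp: star_def)
      then have "card (insert {x, v} (insert {y, v} (star K v))) \<le> card (star H v)"
        by (rule card_mono[rotated]) (simp add: star_def finH)
      moreover have "{x, v} \<notin> star K v" "{y, v} \<notin> star K v"
        using missing_edge[OF xA(1), of "{x, v}"] missing_edge[OF xA(2), of "{y, v}"] by (auto simp: star_def)
      moreover have "{x, v} \<noteq> {y, v}" using xy(3) by (auto simp: doubleton_eq_iff)
      moreover have "finite (star K v)"
        by (rule finite_subset[OF _ finH]) (use CC_H[OF K(1)] in \<open>auto simp: star_def\<close>)
      ultimately show False using eq4[OF vK] by simp
    qed
    have gA: "g \<in> ?A" by (rule inA) (use ghx ye in auto)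
    have hA: "h \<in> ?A" by (rule inA) (use ghx ye in auto)
    \<comment> \<open>Since \<open>a\<close> vanishes at \<open>x\<close> and \<open>h\<close>, the
      entry of row \<open>x\<close> at \<open>h\<close> forces a nonzero entry of row
      \<open>g\<close> there, which means an edge \<open>gh\<close>.\<close>
    obtain \<alpha> \<beta> \<gamma> where ab: "\<alpha> \<noteq> 0 \<or> \<beta> \<noteq> 0" "\<And>v. \<alpha> * r g v + \<beta> * r x v + \<gamma> * a v = 0"
      using dep[OF rD[OF gA] rD[OF xA(1)]] by blast
    have e1: "\<alpha> * r g x + \<beta> * r x x = 0" using ab(2)[of x] aA[OF K(1) xA(1)] by simp
    have e2: "\<alpha> * r g h + \<beta> * r x h = 0" using ab(2)[of h] aA[OF K(1) hA] by simp
    have "\<beta> \<noteq> 0"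
    proof
      assume "\<beta> = 0"
      moreover have "x \<in> N g" using N_commute[OF xV(1), of g] Nx by blast
      then have "r g x \<noteq> 0" using rN[OF gA, of x] ghx by auto
      ultimately show False using e1 ab(1) by simp
    qed
    moreover have "r x h \<noteq> 0" using suppr[OF xy(1), of h] Nx by blast
    ultimately have "r g h \<noteq> 0" using e2 by auto
    then have "h \<in> N g" using rN[OF gA, of h] gh(2) by auto
    then show ?thesis by (simp add: N_def)
  qed
  then show False by (rule noK4[OF d4 xA(1) tw(1) ghx(7,8) ye])
qed

end

section \<open>The edge count\<close>

context critical
begin

text \<open>A circuit with a chord is connected, has two stresses and contains a spanning circuit,
  against \<open>theta_spanning\<close>. Induction on the number of vertices supplies
  \<open>chordless\<close>.\<close>

lemma no_chord:
  assumes small: "\<And>F. F \<subseteq> E \<Longrightarrow> s F = 2 \<Longrightarrow> R F \<le> 4"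
  shows "circuit C \<Longrightarrow> C \<subseteq> E \<Longrightarrow> e \<in> E \<Longrightarrow> e \<subseteq> \<Union>C \<Longrightarrow> e \<in> C"
proof (induction "card (\<Union>C)" arbitrary: C e rule: less_induct)
  case less
  note C = less.prems(1)
  show ?case
  proof (rule ccontr)
    assume eC: "e \<notin> C"
    let ?H = "insert e C"
    have CK: "C \<subseteq> KE V" "finite C" using circuit_KE[OF C] finKE by auto
    have HE: "?H \<subseteq> E" using less.prems by blast
    have HK: "?H \<subseteq> KE V" using HE EK by blast
    have UH: "\<Union>?H = \<Union>C" using less.prems(4) by blast
    have fW: "finite (\<Union>C)" "\<Union>C \<subseteq> V" using finite_Union_KE[OF finV CK(1)] by auto
    obtain g where g: "g \<in> C" using circuit_nonempty[OF C] by blast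
    let ?G = "insert e (C - {g})"
    have GK: "?G \<subseteq> KE V" using HK by blast
    \<comment> \<open>Exchanging \<open>g\<close> for \<open>e\<close> keeps
      \<open>2 * card (\<Union>C) - 2\<close> edges, one more than independence allows.\<close>
    have "card ?G = card C" using eC CK(2) card.remove[OF CK(2) g] by simp
    then have "\<not> card ?G + 3 \<le> 2 * card (\<Union>C)" using circuit_card[OF C] by simp
    moreover have "2 \<le> card (\<Union>C)" by (rule card_Union_ge2[OF CK(1) circuit_nonempty[OF C]])
    moreover have "\<Union>?G \<subseteq> \<Union>C" using less.prems(4) by blast
    ultimately have "\<not> S ?G \<subseteq> {0}" using indep_bound[OF GK _ fW(2)] by blast
    then obtain \<omega> where \<omega>: "\<omega> \<in> S ?G" "\<omega> \<noteq> 0" by blast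
    have we: "\<omega> e \<noteq> 0"
    proof
      assume "\<omega> e = 0"
      then have "\<omega> \<in> S (C - {g})" by (intro St_restrict[OF \<omega>(1)]) (use St_supp[OF \<omega>(1)] in auto)
      moreover have "C - {g} \<subset> C" using g by blast
      then have "S (C - {g}) \<subseteq> {0}" using C by (simp add: circuit_def)
      ultimately show False using \<omega>(2) by blast
    qed
    have \<omega>H: "\<omega> \<in> S ?H" by (rule subsetD[OF St_mono \<omega>(1)]) blast
    have sH: "s ?H = 2"
      using s_remove[OF HK \<omega>H we] eC circuit_s[OF C] by simp
    obtain D where D: "circuit D" "e \<in> D" "D \<subseteq> ?H"
      using circuit_exists[OF HK \<omega>H we] St_supp[OF \<omega>H] by blast
    \<comment> \<open>Otherwise \<open>D\<close> would be the single edge \<open>e\<close>, but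
      circuits have even size.\<close>
    have "D \<inter> C \<noteq> {}"
    proof
      assume "D \<inter> C = {}"
      then have "D = {e}" using D by blast
      then have "card D = 1" by simp
      then show False using circuit_card[OF D(1)] by presburger
    qed
    then have "conn (C \<union> D)" by (rule conn_Un[OF circuit_conn[OF C] D(1)])
    moreover have "C \<union> D = ?H" using D by blast
    ultimately have cH: "conn ?H" by simp
    interpret th: theta V p E ?H
    proof unfold_locales
      show "conn ?H" "?H \<subseteq> E" "s ?H = 2" "R ?H \<le> 4" using cH HE sH small[OF HE sH] by auto
      fix C' f assume C': "C' \<subseteq> ?H" "circuit C'" "\<Union>C' \<noteq> \<Union>?H" and f: "f \<in> ?H - C'"
      have "\<Union>C' \<subset> \<Union>C" using C' UH by (metis Union_mono psubsetI)
      then have "card (\<Union>C') < card (\<Union>C)" by (rule psubset_card_mono[OF fW(1)])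
      from less.hyps[OF this C'(2)] show "\<not> f \<subseteq> \<Union>C'" using C'(1) HE f by blast
    qed
    have "C \<in> th.CC" using C by (auto simp: th.CC_def)
    moreover have "th.A C = {}" unfolding th.A_def UH by simp
    ultimately show False by (rule th.theta_spanning)
  qed
qed

text \<open>An ear without new vertices would contain a chord of some circuit. So each ear adds a
  vertex and, by \<open>conn_card\<close>, at least three edges; the start is
  \<open>15 = 3 * 2 + 9\<close>.\<close>

lemma conn_card_ge:
  assumes small: "\<And>F. F \<subseteq> E \<Longrightarrow> s F = 2 \<Longrightarrow> R F \<le> 4"
  shows "conn F \<Longrightarrow> F \<subseteq> E \<Longrightarrow> 2 \<le> s F \<Longrightarrow> 3 * s F + 9 \<le> card F"
proof (induction "card F" arbitrary: F rule: less_induct)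
  case less
  note F = less.prems(1) and FE = less.prems(2)
  have FK: "F \<subseteq> KE V" "finite F" using conn_KE[OF F] finKE by auto
  show ?case
  proof (cases "s F = 2")
    case True
    interpret th: theta V p E F
    proof unfold_locales
      show "conn F" "F \<subseteq> E" "s F = 2" "R F \<le> 4" using F FE True small[OF FE True] by auto
      fix C f assume C: "C \<subseteq> F" "circuit C" "\<Union>C \<noteq> \<Union>F" "f \<in> F - C"
      show "\<not> f \<subseteq> \<Union>C" using no_chord[OF small C(2)] C FE by blast
    qed
    have "15 \<le> card F" using th.theta_card th.theta_spanning by blast
    then show ?thesis using True by simp
  next
    case False
    obtain H where H: "conn H" "H \<subset> F" "s F = s H + 1" by (rule ear[OF F less.prems(3)])
    have cH: "card H < card F" by (rule psubset_card_mono[OF FK(2) H(2)])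
    have IH: "3 * s H + 9 \<le> card H"
      using less.hyps[OF cH H(1)] H FE False less.prems(3) by auto
    have fU: "finite (\<Union>F)" using finite_Union_KE[OF finV FK(1)] by blast
    have UHF: "\<Union>H \<subseteq> \<Union>F" using H(2) by blast
    have "card F + 3 = 2 * card (\<Union>F) + s F" "card H + 3 = 2 * card (\<Union>H) + s H"
      using conn_card F H(1) by auto
    moreover have "card (\<Union>H) \<noteq> card (\<Union>F)"
    proof
      assume "card (\<Union>H) = card (\<Union>F)"
      then have eq: "\<Union>H = \<Union>F" by (rule card_subset_eq[OF fU UHF])
      obtain e where e: "e \<in> F" "e \<notin> H" using H(2) by blast
      then have "e \<in> KE V" using FK by blast
      then obtain u v where uv: "e = {u, v}" by (rule KE_E)
      have "u \<in> \<Union>H" "v \<in> \<Union>H" unfolding eq using e uv by auto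
      then obtain f g where fg: "f \<in> H" "u \<in> f" "g \<in> H" "v \<in> g" by blast
      obtain C where C: "C \<subseteq> H" "circuit C" "f \<in> C" "g \<in> C" by (rule conn_circuit[OF H(1) fg(1,3)])
      have "C \<subseteq> E" "e \<in> E" using C H(2) FE e by auto
      moreover have "e \<subseteq> \<Union>C" using C fg uv by auto
      ultimately have "e \<in> C" using no_chord[OF small C(2)] by blast
      then show False using e C(1) by blast
    qed
    moreover have "card (\<Union>H) \<le> card (\<Union>F)" by (rule card_mono[OF fU UHF])
    ultimately show ?thesis using IH H(3) by linarith
  qed
qed

lemma circuit_card_ge6: assumes "circuit C" shows "6 \<le> card C"
proof -
  have CK: "C \<subseteq> KE V" "finite C" using circuit_KE[OF assms] finKE by auto
  have fW: "finite (\<Union>C)" using finite_Union_KE[OF finV CK(1)] by blast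
  have "3 * card (\<Union>C) \<le> (\<Sum>x\<in>\<Union>C. card (star C x))"
    using sum_bounded_below[of "\<Union>C" 3 "\<lambda>x. card (star C x)"] circuit_degree[OF assms] by simp
  then show ?thesis using handshake[OF fW CK subset_refl] circuit_card[OF assms] by linarith
qed

text \<open>The bound \<open>3 * s F + 9\<close> fails for one \<open>K\<^sub>4\<close> and for two
  vertex-disjoint ones, which have 6 and 12 edges. With the minimum it covers these cases and is
  subadditive in \<open>s\<close>, so it passes to unions of matroid components.\<close>

lemma card_ge:
  assumes small: "\<And>F. F \<subseteq> E \<Longrightarrow> s F = 2 \<Longrightarrow> R F \<le> 4"
  shows "F \<subseteq> E \<Longrightarrow> 3 * s F + 3 * min (s F) 3 \<le> card F"
proof (induction "card F" arbitrary: F rule: less_induct)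
  case less
  have FK: "F \<subseteq> KE V" "finite F" using less.prems EK finKE by auto
  show ?case
  proof (cases "\<exists>e\<in>F. \<forall>\<omega>\<in>S F. \<omega> e = 0")
    case True
    then obtain e where e: "e \<in> F" "\<And>\<omega>. \<omega> \<in> S F \<Longrightarrow> \<omega> e = 0" by blast
    have "S (insert e (F - {e})) = S (F - {e})"
      by (rule S_insert_indep) (use e in \<open>auto simp: insert_absorb\<close>)
    then have "s F = s (F - {e})" using e(1) by (simp add: s_def insert_absorb)
    moreover have c: "card (F - {e}) < card F" by (rule card_Diff1_less[OF FK(2) e(1)])
    moreover have "3 * s (F - {e}) + 3 * min (s (F - {e})) 3 \<le> card (F - {e})"
      by (rule less.hyps[OF c]) (use less.prems in blast)
    ultimately show ?thesis by simp
  next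
    case False
    show ?thesis
    proof (cases "F = {}")
      case True
      then have "S F \<subseteq> {0}" by (auto simp: St_def supp_in_def fun_eq_iff)
      then show ?thesis using s_0_iff[OF FK(1)] by simp
    next
      case ne: False
      have circ: "\<exists>C\<subseteq>F. circuit C \<and> e \<in> C" if e: "e \<in> F" for e
      proof -
        obtain \<omega> where \<omega>: "\<omega> \<in> S F" "\<omega> e \<noteq> 0" using False e by blast
        then show ?thesis using circuit_exists[OF FK(1) \<omega>] St_supp[OF \<omega>(1)] by blast
      qed
      obtain e where e: "e \<in> F" using ne by blast
      \<comment> \<open>The matroid component of \<open>e\<close>.\<close>
      define F1 where "F1 = {f \<in> F. \<exists>C\<subseteq>F. circuit C \<and> e \<in> C \<and> f \<in> C}"
      define F2 where "F2 = F - F1"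
      have eF1: "e \<in> F1" using circ[OF e] e by (auto simp: F1_def)
      have closed: "C \<subseteq> F1" if C: "circuit C" "C \<subseteq> F" "f \<in> C" "f \<in> F1" for C f
      proof
        fix g assume g: "g \<in> C"
        obtain C1 where C1: "C1 \<subseteq> F" "circuit C1" "e \<in> C1" "f \<in> C1" using C(4) by (auto simp: F1_def)
        have "C1 \<inter> C \<noteq> {}" using C1 C by blast
        from circuit_common[OF C1(2) C(1) this C1(3) g] show "g \<in> F1" using C1(1) C(2) g by (auto simp: F1_def)
      qed
      show ?thesis
      proof (cases "F2 = {}")
        case True
        then have all: "f \<in> F1" if "f \<in> F" for f using that by (auto simp: F2_def)
        have "\<exists>C\<subseteq>F. circuit C \<and> f \<in> C \<and> g \<in> C" if fg: "f \<in> F" "g \<in> F" for f g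
        proof -
          obtain C1 where C1: "C1 \<subseteq> F" "circuit C1" "e \<in> C1" "f \<in> C1" using all[OF fg(1)] by (auto simp: F1_def)
          obtain C2 where C2: "C2 \<subseteq> F" "circuit C2" "e \<in> C2" "g \<in> C2" using all[OF fg(2)] by (auto simp: F1_def)
          have "C1 \<inter> C2 \<noteq> {}" using C1 C2 by blast
          from circuit_common[OF C1(2) C2(2) this C1(4) C2(4)] show ?thesis using C1(1) C2(1) by blast
        qed
        then have cF: "conn F" using ne FK unfolding conn_def by blast
        show ?thesis
        proof (cases "s F = 1")
          case True
          then show ?thesis using circuit_card_ge6[OF conn_s1_circuit[OF cF]] by simp
        next
          case False
          then have "3 * s F + 9 \<le> card F"
            using conn_card_ge[OF small cF less.prems] conn_s_pos[OF cF] by simp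
          then show ?thesis by simp
        qed
      next
        case F2: False
        have part: "F = F1 \<union> F2" "F1 \<inter> F2 = {}" by (auto simp: F1_def F2_def)
        have fin: "finite F1" "finite F2" using part(1) FK(2) by auto
        have sub: "F1 \<subset> F" "F2 \<subset> F" using F2 eF1 part by blast+
        have IH: "3 * s F1 + 3 * min (s F1) 3 \<le> card F1" "3 * s F2 + 3 * min (s F2) 3 \<le> card F2"
          using less.hyps[OF psubset_card_mono[OF FK(2) sub(1)]] less.hyps[OF psubset_card_mono[OF FK(2) sub(2)]]
            sub less.prems by auto
        have K12: "F1 \<subseteq> KE V" "F2 \<subseteq> KE V" using sub FK by auto
        obtain B1 where B1: "B1 \<subseteq> F1" "S B1 \<subseteq> {0}" "card F1 = card B1 + s F1"
          by (rule max_indep[OF K12(1)])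
        obtain B2 where B2: "B2 \<subseteq> F2" "S B2 \<subseteq> {0}" "card F2 = card B2 + s F2"
          by (rule max_indep[OF K12(2)])
        have "B1 \<subseteq> F" "B2 \<subseteq> F" using B1(1) B2(1) sub by auto
        then have BF: "B1 \<union> B2 \<subseteq> F" by simp
        have BK: "B1 \<union> B2 \<subseteq> KE V" using BF FK(1) by (rule subset_trans)
        \<comment> \<open>Each circuit lies entirely in \<open>F1\<close> or in \<open>F2\<close>,
          so independent sets of the two parts combine to an independent set.\<close>
        have "S (B1 \<union> B2) \<subseteq> {0}"
        proof (rule ccontr)
          assume "\<not> ?thesis"
          then obtain \<omega> where "\<omega> \<in> S (B1 \<union> B2)" "\<omega> \<noteq> 0" by blast
          moreover from this obtain f where "\<omega> f \<noteq> 0" by (auto simp: fun_eq_iff)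
          ultimately have \<omega>: "\<omega> \<in> S (B1 \<union> B2)" "\<omega> f \<noteq> 0" by auto
          obtain C where C: "circuit C" "f \<in> C" "C \<subseteq> B1 \<union> B2"
            using circuit_exists[OF BK \<omega>] St_supp[OF \<omega>(1)] by blast
          have CF: "C \<subseteq> F" using C(3) BF by blast
          have "C \<subseteq> B1 \<or> C \<subseteq> B2"
          proof (cases "C \<inter> F1 = {}")
            case True
            then show ?thesis using C(3) B1(1) by blast
          next
            case False
            then obtain g where "g \<in> C" "g \<in> F1" by blast
            then have "C \<subseteq> F1" by (rule closed[OF C(1) CF])
            then show ?thesis using C(3) B2(1) part(2) by blast
          qed
          then have "S C \<subseteq> {0}" using St_mono[of C B1 V p] St_mono[of C B2 V p] B1(2) B2(2) by blast
          then show False using C(1) by (simp add: circuit_def)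
        qed
        then have "card (B1 \<union> B2) + s F \<le> card F" by (rule indep_card_le[OF BF FK(1)])
        moreover have "card (B1 \<union> B2) = card B1 + card B2"
        proof (rule card_Un_disjoint)
          show "finite B1" "finite B2" using finite_subset[OF B1(1) fin(1)] finite_subset[OF B2(1) fin(2)] by auto
          show "B1 \<inter> B2 = {}" using B1(1) B2(1) part(2) by fast
        qed
        moreover have cF: "card F = card F1 + card F2"
          unfolding part(1) by (rule card_Un_disjoint[OF fin part(2)])
        ultimately have "s F \<le> s F1 + s F2" using B1(3) B2(3) by linarith
        then show ?thesis using IH cF by linarith
      qed
    qed
  qed
qed

theorem s_bound:
  assumes "8 \<le> card V" shows "s E + 6 \<le> card V"
proof (cases "\<exists>F\<subseteq>E. s F = 2 \<and> 5 \<le> R F")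
  case True
  then obtain F where F: "F \<subseteq> E" "s F = 2" "5 \<le> R F" by blast
  have "R F + s E \<le> R E + s F" by (rule excess_mono[OF F(1) subset_refl])
  then show ?thesis using F R_le[of E] by linarith
next
  case False
  then have small: "\<And>F. F \<subseteq> E \<Longrightarrow> s F = 2 \<Longrightarrow> R F \<le> 4" by fastforce
  have ge: "3 * s E + 3 * min (s E) 3 \<le> card E" by (rule card_ge[OF small]) auto
  obtain B where B: "B \<subseteq> E" "S B \<subseteq> {0}" "card E = card B + s E" by (rule max_indep[OF EK])
  have BK: "B \<subseteq> KE V" using B EK by blast
  have "card B + 3 \<le> 2 * card V"
    by (rule indep_bound[OF BK _ subset_refl _ B(2)]) (use finite_Union_KE[OF finV BK] assms in auto)
  then show ?thesis
  proof (cases "3 \<le> s E")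
    case True
    then have "min (s E) 3 = 3" by simp
    \<comment> \<open>\<open>3 * s E + 9 \<le> card E \<le> 2 * card V - 3 + s E\<close>.\<close>
    then show ?thesis using ge B(3) \<open>card B + 3 \<le> 2 * card V\<close> by linarith
  next
    case False
    \<comment> \<open>Here \<open>s E \<le> 2\<close>, and \<open>2 + 6 \<le> 8\<close>.\<close>
    then show ?thesis using assms by linarith
  qed
qed

end

section \<open>Transfer to subgraphs and to the rigidity matroid\<close>

lemma lap_vertex_restrict:
  assumes "finite V" "W \<subseteq> V" "\<omega> \<in> supp_in F" "F \<subseteq> KE W"
  shows "lap V \<omega> z = lap W \<omega> z"
proof
  fix x
  have zero: "\<omega> {x, y} = 0" if "x \<notin> W \<or> y \<notin> W" for x y
  proof -
    have "{x, y} \<notin> F" using that assms(4) by (auto simp: KE_def)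
    then show ?thesis using assms(3) by (simp add: supp_in_def)
  qed
  show "lap V \<omega> z x = lap W \<omega> z x"
  proof (cases "x \<in> W")
    case True
    have "(\<Sum>y\<in>V. \<omega> {x, y} * (z x - z y)) = (\<Sum>y\<in>W. \<omega> {x, y} * (z x - z y))"
      by (rule sum.mono_neutral_right) (use assms zero in auto)
    then show ?thesis using True assms(2) by (auto simp: lap_def)
  next
    case False
    then show ?thesis using zero by (simp add: lap_def)
  qed
qed

lemma St_vertex_restrict:
  assumes "finite V" "W \<subseteq> V" "F \<subseteq> KE W" shows "St V p F = St W p F"
  using lap_vertex_restrict[OF assms(1,2) _ assms(3)] by (auto simp: St_def)

lemma NS_vertex_restrict:
  assumes "finite V" "W \<subseteq> V" "F \<subseteq> KE W" shows "NS V p F = NS W p F"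
proof -
  have "lap V \<omega> z = lap W \<omega> z" if "\<omega> \<in> St W p F" for \<omega> z
    by (rule lap_vertex_restrict[OF assms(1,2) _ assms(3)]) (use that in \<open>simp add: St_def\<close>)
  then show ?thesis by (simp add: NS_def St_vertex_restrict[OF assms])
qed

lemma stresses_eq:
  assumes "finite V"
  shows "stresses V E p = {w \<in> supp_in E. \<forall>i. lap V w (\<lambda>v. p v $ i) = 0}"
proof -
  have "(\<Sum>x | x \<in> V \<and> {x, y} \<in> E. w {x, y} *\<^sub>R (p x - p y)) $ i = - lap V w (\<lambda>v. p v $ i) y"
    if w: "w \<in> supp_in E" and y: "y \<in> V" for w y i
  proof -
    have "(\<Sum>x | x \<in> V \<and> {x, y} \<in> E. w {x, y} *\<^sub>R (p x - p y)) $ i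
        = (\<Sum>x | x \<in> V \<and> {x, y} \<in> E. w {x, y} * (p x $ i - p y $ i))"
      by (simp add: sum_component)
    also have "\<dots> = (\<Sum>x\<in>V. w {x, y} * (p x $ i - p y $ i))"
      by (rule sum.mono_neutral_left) (use assms w in \<open>auto simp: supp_in_def\<close>)
    also have "\<dots> = (\<Sum>x\<in>V. - (w {y, x} * (p y $ i - p x $ i)))"
      by (rule sum.cong) (auto simp: insert_commute algebra_simps)
    finally show ?thesis using y by (simp add: lap_def sum_negf)
  qed
  then have *: "(\<forall>y\<in>V. (\<Sum>x | x \<in> V \<and> {x, y} \<in> E. w {x, y} *\<^sub>R (p x - p y)) = 0)
      \<longleftrightarrow> (\<forall>i. lap V w (\<lambda>v. p v $ i) = 0)" if "w \<in> supp_in E" for w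
    using that by (auto simp: vec_eq_iff fun_eq_iff lap_def)
  have "stresses V E p = {w \<in> supp_in E. \<forall>y\<in>V. (\<Sum>x | x \<in> V \<and> {x, y} \<in> E. w {x, y} *\<^sub>R (p x - p y)) = 0}"
    by (auto simp: stresses_def supp_in_def)
  then show ?thesis using * by auto
qed

lemma (in framework) rows_independent_iff:
  assumes "F \<subseteq> KE V" shows "rows_independent V p F \<longleftrightarrow> S F \<subseteq> {0}"
proof -
  have rm: "rigidity_matrix p e v $ i = row e (v, i = 1)" for e v i
    using exhaust_2[of i] by (auto simp: rigidity_matrix_def row_def co_def)
  have eq: "(\<forall>v\<in>V. (\<Sum>e\<in>F. c e *\<^sub>R rigidity_matrix p e v) = 0) \<longleftrightarrow> (\<lambda>e. if e \<in> F then c e else 0) \<in> S F" for c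
  proof -
    let ?c = "\<lambda>e. if e \<in> F then c e else 0"
    have cF: "?c \<in> supp_in F" by (simp add: supp_in_def)
    have sm: "(\<Sum>e\<in>F. c e *\<^sub>R rigidity_matrix p e v) $ i = lap V ?c (co (i = 1)) v" if "v \<in> V" for v i
    proof -
      have "(\<Sum>e\<in>F. c e *\<^sub>R rigidity_matrix p e v) $ i = (\<Sum>e\<in>F. ?c e * row e (v, i = 1))"
        by (simp add: sum_component rm)
      then show ?thesis using stress_rows[OF cF assms that] by simp
    qed
    have "(\<forall>v\<in>V. (\<Sum>e\<in>F. c e *\<^sub>R rigidity_matrix p e v) = 0) \<longleftrightarrow> (\<forall>v\<in>V. \<forall>i. lap V ?c (co (i = (1::2))) v = 0)"
      using sm by (simp add: vec_eq_iff)
    also have "\<dots> \<longleftrightarrow> (\<forall>v\<in>V. lap V ?c X v = 0 \<and> lap V ?c Y v = 0)"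
      by (simp add: forall_2 co_eq)
    also have "\<dots> \<longleftrightarrow> ?c \<in> S F"
      using cF by (auto simp: St_def forall_2 fun_eq_iff lap_def)
    finally show ?thesis .
  qed
  show ?thesis
  proof
    assume r: "rows_independent V p F"
    show "S F \<subseteq> {0}"
    proof
      fix \<omega> assume \<omega>: "\<omega> \<in> S F"
      have "(\<lambda>e. if e \<in> F then \<omega> e else 0) = \<omega>" using St_supp[OF \<omega>] by (auto simp: fun_eq_iff)
      then have "\<forall>e\<in>F. \<omega> e = 0" using r \<omega> eq[of \<omega>] by (simp add: rows_independent_def)
      then show "\<omega> \<in> {0}" using St_supp[OF \<omega>] by (auto simp: fun_eq_iff)
    qed
  next
    assume S0: "S F \<subseteq> {0}"
    show "rows_independent V p F"
      unfolding rows_independent_def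
    proof (intro allI impI ballI)
      fix c e assume "\<forall>v\<in>V. (\<Sum>e\<in>F. c e *\<^sub>R rigidity_matrix p e v) = 0" "e \<in> F"
      then have "(\<lambda>e. if e \<in> F then c e else 0) = 0" using eq[of c] S0 by blast
      from fun_cong[OF this, of e] show "c e = 0" using \<open>e \<in> F\<close> by simp
    qed
  qed
qed

lemma (in framework) r2_eq:
  assumes F: "F \<subseteq> KE V" shows "r2 V F + s F = card F"
proof -
  let ?q = "SOME p. generic V p"
  have gq: "generic V ?q" using someI_ex[OF generic_exists[OF finV]] .
  interpret fq: framework V ?q using finV gq card3 by unfold_locales
  have fin: "finite F" by (rule finKE[OF F])
  have "rows_independent V ?q B \<longleftrightarrow> S B \<subseteq> {0}" if "B \<subseteq> F" for B
  proof -
    have BK: "B \<subseteq> KE V" using that F by blast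
    show ?thesis
      using fq.rows_independent_iff[OF BK] independence_generic[OF finV finKE[OF BK] gq gen]
        independence_generic[OF finV finKE[OF BK] gen gq] by blast
  qed
  then have rm: "rigidity_matroid V F = {B. B \<subseteq> F \<and> S B \<subseteq> {0}}" by (auto simp: rigidity_matroid_def)
  obtain B where B: "B \<subseteq> F" "S B \<subseteq> {0}" "card F = card B + s F" by (rule max_indep[OF F])
  have "r2 V F = card B"
    unfolding r2_def
  proof (rule Max_eqI)
    show "finite (card ` rigidity_matroid V F)" using fin by (simp add: rm)
    show "card B \<in> card ` rigidity_matroid V F" using B by (auto simp: rm)
    show "n \<le> card B" if "n \<in> card ` rigidity_matroid V F" for n
      using that indep_card_le[OF _ F] B(3) by (fastforce simp: rm)
  qed
  then show ?thesis using B(3) by simp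
qed

theorem theorem4p7:
  fixes V V' :: "'a set" and E E' :: "'a set set"
  assumes "simple_graph V E"
    and "stress_independent V E"
    and "subgraph V' E' V E"
    and "card V' \<ge> 8"
  shows "int (card E') \<le> int (r2 V' E') + int (card V') - 6 \<and>
         int (r2 V' E') + int (card V') - 6 \<le> 3 * int (card V') - 9"
proof -
  have V: "finite V" "E \<subseteq> KE V" using assms(1) by (auto simp: simple_graph_def KE_def)
  have V': "finite V'" "E' \<subseteq> KE V'" "V' \<subseteq> V" "E' \<subseteq> E"
    using assms(3) by (auto simp: subgraph_def simple_graph_def KE_def)
  obtain p where p: "generic V p" using generic_exists[OF V(1)] by blast
  have "8 \<le> card V" using card_mono[OF V(1) V'(3)] assms(4) by simp
  then interpret G: framework V p using V p by unfold_locales auto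
  have p': "generic V' p" by (rule generic_subset[OF p V'(3)])
  \<comment> \<open>An edge carrying a stress is linked, so stress-independence yields a generic
    \<open>p1\<close> and some \<open>q\<close> separating the stresses. The assumed inclusion moves
    from \<open>p\<close> to \<open>p1\<close>, where the coordinates of \<open>q\<close> violate
    it.\<close>
  have critE: "\<not> NS V p (E - {e}) \<subseteq> NS V p E" if e: "e \<in> E" and \<omega>: "\<omega> \<in> St V p E" "\<omega> e \<noteq> 0" for e \<omega>
  proof
    assume sub: "NS V p (E - {e}) \<subseteq> NS V p E"
    have EeK: "E - {e} \<subseteq> KE V" using V(2) by blast
    have "card (E - {e}) + 1 = card E" using card.remove[OF G.finKE[OF V(2)] e] by simp
    then have "r2 V E = r2 V (E - {e})"
      using G.r2_eq[OF V(2)] G.r2_eq[OF EeK] G.s_remove[OF V(2) \<omega>] by simp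
    then have "linked V (E - {e}) e" using e by (simp add: linked_def insert_absorb)
    moreover have "\<not> stress_linked V (E - {e}) e" using assms(2) e by (simp add: stress_independent_def)
    ultimately obtain p1 q where pq: "generic V p1" "stresses V (E - {e}) p1 \<subseteq> stresses V (E - {e}) q"
      "\<not> stresses V E p1 \<subseteq> stresses V E q"
      using e by (auto simp: stress_linked_def insert_absorb)
    have st1: "stresses V F p1 = St V p1 F" for F by (simp add: stresses_eq[OF V(1)] St_def)
    have NSi: "NS V p1 (E - {e}) \<subseteq> NS V p1 E"
      by (rule NS_subset_generic[OF V(1) _ _ p pq(1) sub]) (use G.finKE V(2) in auto)
    have "(\<lambda>v. q v $ i) \<in> NS V p1 (E - {e})" for i
      using pq(2) unfolding NS_def st1[symmetric] by (auto simp: stresses_eq[OF V(1), of _ q])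
    then have "(\<lambda>v. q v $ i) \<in> NS V p1 E" for i using NSi by blast
    then have "stresses V E p1 \<subseteq> stresses V E q"
      unfolding NS_def st1[symmetric] by (auto simp: stresses_eq[OF V(1)])
    then show False using pq(3) by blast
  qed
  interpret C: critical V' p E'
  proof unfold_locales
    show "finite V'" "generic V' p" "E' \<subseteq> KE V'" using V' p' by auto
    show "3 \<le> card V'" using assms(4) by simp
    fix e \<omega> assume e: "e \<in> E'" and \<omega>': "\<omega> \<in> St V' p E'" "\<omega> e \<noteq> 0"
    have EeK: "E' - {e} \<subseteq> KE V'" using V'(2) by blast
    have \<omega>1: "\<omega> \<in> St V p E'" using \<omega>'(1) St_vertex_restrict[OF V(1) V'(3,2)] by blast
    then have \<omega>: "\<omega> \<in> St V p E" by (rule subsetD[OF St_mono[OF V'(4)]])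
    have "e \<in> E" using e V'(4) by blast
    then obtain z where z: "z \<in> NS V p (E - {e})" "z \<notin> NS V p E" using critE[OF _ \<omega> \<omega>'(2)] by blast
    have "St V p (E' - {e}) \<subseteq> St V p (E - {e})" by (rule St_mono) (use V'(4) in blast)
    then have z1: "z \<in> NS V p (E' - {e})" using z(1) by (auto simp: NS_def)
    \<comment> \<open>Criticality passes to the subgraph with the same \<open>z\<close>: every
      stress of \<open>E\<close> is a multiple of \<omega> plus a stress avoiding \<open>e\<close>,
      so if \<open>z\<close> satisfied \<omega>, it would satisfy them all.\<close>
    have "z \<notin> NS V p E'"
    proof
      assume "z \<in> NS V p E'"
      then have 0: "lap V \<omega> z = 0" using \<omega>1 by (simp add: NS_def)
      have "lap V \<tau> z = 0" if \<tau>: "\<tau> \<in> St V p E" for \<tau>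
      proof -
        let ?c = "\<tau> e / \<omega> e"
        let ?\<sigma> = "\<lambda>g. \<tau> g - ?c * \<omega> g"
        have \<sigma>E: "?\<sigma> \<in> St V p E" using St_comb[OF \<tau> \<omega>, of ?c] by simp
        have "?\<sigma> \<in> St V p (E - {e})"
          by (rule St_restrict[OF \<sigma>E]) (use St_supp[OF \<sigma>E] \<omega>'(2) in auto)
        then have "lap V ?\<sigma> z = 0" using z(1) by (simp add: NS_def)
        moreover have "\<tau> = ?\<sigma> + (\<lambda>g. ?c * \<omega> g)" by (auto simp: fun_eq_iff)
        from arg_cong[OF this, of "\<lambda>\<omega>. lap V \<omega> z"]
        have "lap V \<tau> z = lap V ?\<sigma> z + (\<lambda>x. ?c * lap V \<omega> z x)" by (simp only: lap_add_left lap_scale_left)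
        ultimately show ?thesis using 0 by (auto simp: fun_eq_iff)
      qed
      then show False using z(2) by (simp add: NS_def)
    qed
    then show "\<not> NS V' p (E' - {e}) \<subseteq> NS V' p E'"
      using z1 NS_vertex_restrict[OF V(1) V'(3) EeK] NS_vertex_restrict[OF V(1) V'(3,2)] by blast
  qed
  have r: "r2 V' E' + C.s E' = card E'" by (rule C.r2_eq[OF V'(2)])
  have sb: "C.s E' + 6 \<le> card V'" by (rule C.s_bound[OF assms(4)])
  \<comment> \<open>The second inequality is the bound \<open>2 * card V' - 3\<close> on the size of
    \<open>B\<close>, which equals the rank.\<close>
  obtain B where B: "B \<subseteq> E'" "C.S B \<subseteq> {0}" "card E' = card B + C.s E'" by (rule C.max_indep[OF V'(2)])
  have BK: "B \<subseteq> KE V'" using B(1) V'(2) by blast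
  have "card B + 3 \<le> 2 * card V'"
    by (rule C.indep_bound[OF BK _ subset_refl _ B(2)])
      (use finite_Union_KE[OF V'(1) BK] assms(4) in auto)
  then show ?thesis using r sb B(3) by linarith
qed

end
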